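(* Let $\widehat U=\widehat U(t,m,z)$ denote the value function $V(t,\mu)$ expressed in terms of the mean $m\in\mathbb{R}$ and variance $z>0$ of the Gaussian measure $\mu=\mathcal{N}(m,z)$. Then $\widehat U$ satisfies the HJB equation $$\frac{\partial\widehat U}{\partial t}(t,m,z)+z+m^2-\theta m\frac{\partial\widehat U}{\partial m}(t,m,z)+(b^2-2\theta z)\frac{\partial\widehat U}{\partial z}(t,m,z)-\frac{1}{4C}\Big[\frac{\partial\widehat U}{\partial m}(t,m,z)\Big]^2=0,$$ for $t_i\le t<t_{i+1}$, $i=0,\dots,n$, together with $$\widehat U(t_i^-,m,z)=\int_{\mathbb{R}}\widehat U\Big(t_i,\;m+\frac{z}{\sqrt{z+\varepsilon^2}}\,w,\;\frac{z\varepsilon^2}{z+\varepsilon^2}\Big)\phi(w)\,dw,\qquad i=1,\dots,n,$$ $$\widehat U(T,m,z)=m^2+z,$$ where $\phi$ denotes the density of the standard normal distribution.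
   Context: Fix $T>0$, deterministic observation times $0<t_1<\dots<t_n<T$, $t_0=0$, $t_{n+1}=T$, constants $\theta,b\in\mathbb{R}$, $C>0$ and a fixed (uncontrolled) noise level $\varepsilon>0$. The unobserved state is a controlled Ornstein--Uhlenbeck process with generator $\mathcal{G}(\alpha)f(x)=(-\theta x+\alpha)f'(x)+\frac12b^2f''(x)$, with control $\alpha\in\mathbb{R}$. The conditional law $\mu^\alpha_t$ of the unobserved process given the observations evolves as follows: between observation times, $d\mu^\alpha_t=\mathcal{G}^*(\alpha_t)\mu^\alpha_t\,dt$ (in the weak sense, $\langle\mathcal{G}^*(\alpha)\mu,f\rangle=\int\mathcal{G}(\alpha)f\,d\mu$); at time $t_i$ one observes $Y_i=\widehat X_i+\varepsilon Z_i$ with $\widehat X_i\sim\mu^\alpha_{t_i^-}$ and $Z_i\sim\mathcal{N}(0,1)$, independent of each other and of all other sources of randomness, and updates $\mu^\alpha_{t_i}(dx)=K_\varepsilon(x;\mu^\alpha_{t_i^-},Y_i)\,\mu^\alpha_{t_i^-}(dx)$, where $K_\varepsilon(x;\mu,y)=\rho_\varepsilon(y-x)/\int\rho_\varepsilon(y-x')\mu(dx')$ and $\rho_\varepsilon$ is the density of $\mathcal{N}(0,\varepsilon^2)$. Admissible controls on $[s,T]$ are real-valued processes $\alpha$ adapted to the filtration $\mathcal{F}_t=\sigma(Y_i:t_i\le t)$ generated by the observations. The value function is $$V(s,\mu)=\inf_{\alpha}\mathbb{E}\Big[\int_s^T\Big(\int_{\mathbb{R}}x^2\mu^\alpha_t(dx)+C\alpha_t^2\Big)dt+\int_{\mathbb{R}}x^2\mu^\alpha_T(dx)\Big],\qquad\mu^\alpha_s=\mu,$$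 with $V(T,\mu)=\int x^2\mu(dx)$; only observations at times $t_i>s$ enter the problem started at $s$. $V(t_i^-,\mu)$ (hence $\widehat U(t_i^-,\cdot,\cdot)$) denotes the value of the problem started in $\mu$ immediately before the observation and update at $t_i$. $\mathcal{N}(m,z)$ denotes the normal law with mean $m$ and variance $z$. *)

theory Defs
  imports "HOL-Probability.Probability"
begin

definition gaussian :: "real \<Rightarrow> real \<Rightarrow> real measure" where
  "gaussian m z = density lborel (\<lambda>x. ennreal (normal_density m (sqrt z) x))"

text \<open>Test functions of the weak formulation: C2 functions with bounded second derivative. They grow
  at most quadratically, hence are integrable against laws with finite second moment, and they include
  the compactly supported C2 functions as well as \<open>x\<close>, \<open>x^2\<close>, \<open>sin (u * x)\<close>, \<open>cos (u * x)\<close>.\<close>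

definition test_function :: "(real \<Rightarrow> real) \<Rightarrow> bool" where
  "test_function f \<longleftrightarrow>
     (\<forall>x. f differentiable (at x)) \<and> (\<forall>x. deriv f differentiable (at x)) \<and>
     continuous_on UNIV (deriv (deriv f)) \<and> bounded (range (deriv (deriv f)))"

definition has_second_moment :: "real measure \<Rightarrow> bool" where
  "has_second_moment \<mu> \<longleftrightarrow> integrable \<mu> (\<lambda>x. x\<^sup>2)"

text \<open>A sample point lists, for every observation that enters the problem (indices \<open>I\<close>), the pair
  consisting of the sampled state and the observation noise. The sample space, the observations and
  their filtration do not depend on the control; the probability on the sample space does.\<close>

type_synonym outcome = "nat \<Rightarrow> real \<times> real"

definition outcome_space :: "nat set \<Rightarrow> outcome measure" where
  "outcome_space I = (\<Pi>\<^sub>M i\<in>I. borel)"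

definition state_sample :: "nat \<Rightarrow> outcome \<Rightarrow> real" where
  "state_sample i \<omega> = fst (\<omega> i)"

definition noise :: "nat \<Rightarrow> outcome \<Rightarrow> real" where
  "noise i \<omega> = snd (\<omega> i)"

definition past_events :: "nat set \<Rightarrow> nat \<Rightarrow> outcome set set" where
  "past_events I i = sigma_sets (space (outcome_space I))
     {(\<lambda>\<omega>. \<omega> j) -` B \<inter> space (outcome_space I) | j B. j \<in> I \<and> j < i \<and> B \<in> sets borel}"

text \<open>Parameters: drift \<open>\<theta>\<close> and diffusion \<open>b\<close> of the Ornstein-Uhlenbeck state, control cost
  weight \<open>C\<close>, noise level \<open>\<epsilon>\<close>, horizon \<open>T\<close>, and observation times \<open>\<tau> 1 < \<dots> < \<tau> n\<close>.\<close>

context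
  fixes \<theta> b C \<epsilon> T :: real and n :: nat and \<tau> :: "nat \<Rightarrow> real"
begin

definition generator :: "real \<Rightarrow> (real \<Rightarrow> real) \<Rightarrow> real \<Rightarrow> real" where
  "generator a f x = (- \<theta> * x + a) * deriv f x + (1/2) * b\<^sup>2 * deriv (deriv f) x"

definition bayes_kernel :: "real measure \<Rightarrow> real \<Rightarrow> real \<Rightarrow> real" where
  "bayes_kernel \<mu> y x =
     normal_density 0 \<epsilon> (y - x) / (\<integral>x'. normal_density 0 \<epsilon> (y - x') \<partial>\<mu>)"

definition observation :: "nat \<Rightarrow> outcome \<Rightarrow> real" where
  "observation i \<omega> = state_sample i \<omega> + \<epsilon> * noise i \<omega>"

definition observation_sigma :: "nat set \<Rightarrow> nat set \<Rightarrow> outcome measure" where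
  "observation_sigma I J = sigma (space (outcome_space I))
     {observation j -` B \<inter> space (outcome_space I) | j B. j \<in> J \<and> B \<in> sets borel}"

definition obs_filtration :: "nat set \<Rightarrow> real \<Rightarrow> outcome measure" where
  "obs_filtration I t = observation_sigma I {i\<in>I. \<tau> i \<le> t}"

definition obs_filtration_left :: "nat set \<Rightarrow> real \<Rightarrow> outcome measure" where
  "obs_filtration_left I t = observation_sigma I {i\<in>I. \<tau> i < t}"

text \<open>Time-integrated weak form of \<open>d\<mu> = G*(a) \<mu> dt\<close> on \<open>[r,t]\<close>.\<close>

definition weak_evolution ::
    "(real \<Rightarrow> real) \<Rightarrow> (real \<Rightarrow> real measure) \<Rightarrow> real \<Rightarrow> real \<Rightarrow> bool" where
  "weak_evolution a \<mu> r t \<longleftrightarrow>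
     (\<forall>f. test_function f \<longrightarrow>
        set_integrable lborel {r..t} (\<lambda>u. \<integral>x. generator (a u) f x \<partial>\<mu> u) \<and>
        (\<integral>x. f x \<partial>\<mu> t) =
          (\<integral>x. f x \<partial>\<mu> r) + (LINT u:{r..t}|lborel. (\<integral>x. generator (a u) f x \<partial>\<mu> u)))"

text \<open>One trajectory of the filter on \<open>[s,T]\<close> for the control path \<open>a\<close> and the observed values
  \<open>y\<close>. Here \<open>\<nu> i\<close> is the law immediately before the update at \<open>\<tau> i\<close>. If \<open>s\<close> itself is the time of
  an observation in \<open>I\<close>, then \<open>\<mu>0\<close> is the law before that update.\<close>

definition filter_path ::
    "nat set \<Rightarrow> real \<Rightarrow> real measure \<Rightarrow> (real \<Rightarrow> real) \<Rightarrow> (nat \<Rightarrow> real) \<Rightarrow>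
     (real \<Rightarrow> real measure) \<Rightarrow> (nat \<Rightarrow> real measure) \<Rightarrow> bool" where
  "filter_path I s \<mu>0 a y \<mu> \<nu> \<longleftrightarrow>
     ((\<forall>i\<in>I. \<tau> i \<noteq> s) \<longrightarrow> \<mu> s = \<mu>0) \<and>
     (\<forall>i\<in>I. \<tau> i = s \<longrightarrow> \<nu> i = \<mu>0) \<and>
     (\<forall>t\<in>{s..T}. has_second_moment (\<mu> t)) \<and>
     (\<forall>r t. s \<le> r \<longrightarrow> r \<le> t \<longrightarrow> t \<le> T \<longrightarrow> (\<forall>i\<in>I. \<tau> i \<notin> {r<..t}) \<longrightarrow> weak_evolution a \<mu> r t) \<and>
     (\<forall>i\<in>I. s < \<tau> i \<longrightarrow> has_second_moment (\<nu> i) \<and>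
        (\<forall>f. test_function f \<longrightarrow>
           ((\<lambda>t. \<integral>x. f x \<partial>\<mu> t) \<longlongrightarrow> (\<integral>x. f x \<partial>\<nu> i)) (at_left (\<tau> i)))) \<and>
     (\<forall>i\<in>I. \<mu> (\<tau> i) = density (\<nu> i) (\<lambda>x. ennreal (bayes_kernel (\<nu> i) (y i) x)))"

text \<open>The second clause is joint measurability in time and sample point.\<close>

definition admissible_control :: "nat set \<Rightarrow> real \<Rightarrow> (real \<Rightarrow> outcome \<Rightarrow> real) \<Rightarrow> bool" where
  "admissible_control I s \<alpha> \<longleftrightarrow>
     (\<forall>t\<in>{s..T}. \<alpha> t \<in> borel_measurable (obs_filtration I t)) \<and>
     (\<lambda>(t, \<omega>). \<alpha> t \<omega>) \<in> borel_measurable (restrict_space borel {s..T} \<Otimes>\<^sub>M outcome_space I)"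

text \<open>\<open>P\<close> and \<open>\<mu>\<close>, \<open>\<nu>\<close> are the probability and the filter induced by the control \<open>\<alpha>\<close>. The
  displayed product formula says: conditionally on all earlier state samples and noises, the \<open>i\<close>-th
  state sample has law \<open>\<nu> i\<close>, and the \<open>i\<close>-th noise is standard normal, independent of the past and
  of the \<open>i\<close>-th state sample.\<close>

definition controlled_filter ::
    "nat set \<Rightarrow> real \<Rightarrow> real measure \<Rightarrow> (real \<Rightarrow> outcome \<Rightarrow> real) \<Rightarrow> outcome measure \<Rightarrow>
     (real \<Rightarrow> outcome \<Rightarrow> real measure) \<Rightarrow> (nat \<Rightarrow> outcome \<Rightarrow> real measure) \<Rightarrow> bool" where
  "controlled_filter I s \<mu>0 \<alpha> P \<mu> \<nu> \<longleftrightarrow>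
     prob_space P \<and> sets P = sets (outcome_space I) \<and>
     (\<forall>t\<in>{s..T}. \<mu> t \<in> obs_filtration I t \<rightarrow>\<^sub>M prob_algebra borel) \<and>
     (\<forall>i\<in>I. \<nu> i \<in> obs_filtration_left I (\<tau> i) \<rightarrow>\<^sub>M prob_algebra borel) \<and>
     (\<forall>i\<in>I. \<forall>A\<in>past_events I i. \<forall>B\<in>sets borel. \<forall>D\<in>sets borel.
        emeasure P {\<omega>\<in>A. state_sample i \<omega> \<in> B \<and> noise i \<omega> \<in> D} =
          (\<integral>\<^sup>+\<omega>\<in>A. emeasure (\<nu> i \<omega>) B \<partial>P) * emeasure (gaussian 0 1) D) \<and>
     (AE \<omega> in P. filter_path I s \<mu>0 (\<lambda>t. \<alpha> t \<omega>) (\<lambda>i. observation i \<omega>) (\<lambda>t. \<mu> t \<omega>) (\<lambda>i. \<nu> i \<omega>))"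

definition expected_cost ::
    "real \<Rightarrow> (real \<Rightarrow> outcome \<Rightarrow> real) \<Rightarrow> outcome measure \<Rightarrow>
     (real \<Rightarrow> outcome \<Rightarrow> real measure) \<Rightarrow> ennreal" where
  "expected_cost s \<alpha> P \<mu> =
     (\<integral>\<^sup>+\<omega>. (\<integral>\<^sup>+t\<in>{s..T}. ((\<integral>\<^sup>+x. ennreal (x\<^sup>2) \<partial>\<mu> t \<omega>) + ennreal (C * (\<alpha> t \<omega>)\<^sup>2)) \<partial>lborel)
          + (\<integral>\<^sup>+x. ennreal (x\<^sup>2) \<partial>\<mu> T \<omega>) \<partial>P)"

definition optimal_cost :: "nat set \<Rightarrow> real \<Rightarrow> real measure \<Rightarrow> ennreal" where
  "optimal_cost I s \<mu>0 = Inf {expected_cost s \<alpha> P \<mu> | \<alpha> P \<mu> \<nu>.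
     admissible_control I s \<alpha> \<and> controlled_filter I s \<mu>0 \<alpha> P \<mu> \<nu>}"

definition V :: "real \<Rightarrow> real measure \<Rightarrow> ennreal" where
  "V s \<mu> = optimal_cost {i\<in>{1..n}. s < \<tau> i} s \<mu>"

text \<open>Value of the problem started immediately before the observation and update at time \<open>s\<close>.\<close>

definition V_left :: "real \<Rightarrow> real measure \<Rightarrow> ennreal" where
  "V_left s \<mu> = optimal_cost {i\<in>{1..n}. s \<le> \<tau> i} s \<mu>"

definition U_hat :: "real \<Rightarrow> real \<Rightarrow> real \<Rightarrow> real" where
  "U_hat t m z = enn2real (V t (gaussian m z))"

definition U_hat_left :: "real \<Rightarrow> real \<Rightarrow> real \<Rightarrow> real" where
  "U_hat_left t m z = enn2real (V_left t (gaussian m z))"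

end

end

theory Submission
  imports Defs
begin

text \<open>A weak solution of the forward equation that starts from a Gaussian law stays Gaussian, because
  testing with \<open>cos (l x + c)\<close> along the characteristics of the Fourier transformed equation determines
  its characteristic function. So the filter reduces to a controlled mean \<open>M\<close> and a variance that does
  not depend on the control. Let \<open>p\<close> solve the Riccati equation \<open>p' = p\<^sup>2 / C + 2 \<theta> p - 1\<close>, \<open>p T = 1\<close>.
  Completing the square shows that, between two observations, the integral of \<open>M\<^sup>2 + C \<alpha>\<^sup>2\<close> plus the increment
  of \<open>p M\<^sup>2\<close> is the integral of \<open>C (\<alpha> + p M / C)\<^sup>2\<close>, while an observation at variance \<open>z\<close> increases the
  expectation of \<open>M\<^sup>2\<close> by \<open>z\<^sup>2 / (z + \<epsilon>\<^sup>2)\<close>. Hence every control costs \<open>p(s) m\<^sup>2\<close>, plus a function of \<open>s\<close> and the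
  initial variance only, plus the expected squared deviation from the feedback \<open>\<alpha> = - p M / C\<close>. An explicit
  linear Gaussian model realises this feedback, so the value is known in closed form, and the claimed
  equations become calculus.\<close>

section \<open>Absolutely continuous functions\<close>

text \<open>A control is only an integrable path in time, so the mean and the phase of the Fourier
  characteristics are merely absolutely continuous. Moreover the time derivative of the cosine
  transform contains the expectation of \<open>x * sin (l * x + c)\<close>; for nonzero
  \<open>l\<close> this function has an unbounded second derivative and is not a test function. Its
  expectation is reached through difference quotients of the transform in \<open>l\<close>, which
  yields continuity of order 1/2 in the clock given by the integral of
  \<open>1 + \<bar>a\<bar>\<close>. This is the source of the exponent 3/2 in the first lemma. The
  Riccati equation is what the HJB equation demands of an ansatz
  \<open>p t * m\<^sup>2 + W t z\<close>: the squared gradient stays in the part with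
  \<open>m\<close>, and the equation left for \<open>W\<close> is linear. Costs may be infinite and
  every control carries its own probability. Hence the cost identity is one between extended
  nonnegative numbers, with all terms added and none subtracted, and the probability enters its
  expectation only through the conditional law of each observation.\<close>

lemma constant_if_superlinear_increments:
  fixes k A :: "real \<Rightarrow> real"
  assumes rt: "r \<le> t" and cA: "continuous_on {r..t} A"
    and inc: "\<And>u v. u \<in> {r..t} \<Longrightarrow> v \<in> {r..t} \<Longrightarrow> u \<le> v \<Longrightarrow>
        \<bar>k v - k u\<bar> \<le> K * \<bar>A v - A u\<bar> * sqrt \<bar>A v - A u\<bar>"
  shows "k t = k r"
proof -
  \<comment> \<open>The points chosen below by the intermediate value theorem need not be ordered in
    time, so the bound is needed for either order of \<open>u\<close> and \<open>v\<close>.\<close>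
  have inc': "\<bar>k v - k u\<bar> \<le> K * \<bar>A v - A u\<bar> * sqrt \<bar>A v - A u\<bar>"
    if "u \<in> {r..t}" "v \<in> {r..t}" for u v
    using inc[of u v] inc[of v u] that by (cases "u \<le> v") (auto simp: abs_minus_commute)
  define d where "d = A t - A r"
  have pts: "\<exists>x\<in>{r..t}. A x = A r + l * d" if "0 \<le> l" "l \<le> 1" for l
  proof -
    have "A r + l * d \<in> closed_segment (A r) (A t)"
      using that by (auto simp: closed_segment_def d_def algebra_simps intro!: exI[of _ l])
    moreover have "closed_segment (A r) (A t) \<subseteq> A ` {r..t}"
    proof -
      have "connected (A ` {r..t})" by (intro connected_continuous_image cA connected_Icc)
      hence "is_interval (A ` {r..t})" by (simp add: is_interval_connected_1)
      hence "convex (A ` {r..t})" by (simp add: is_interval_convex_1)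
      thus ?thesis using rt by (intro closed_segment_subset) auto
    qed
    ultimately show ?thesis by (force elim!: imageE dest!: subsetD)
  qed
  \<comment> \<open>The range from \<open>A r\<close> to \<open>A t\<close>, not the interval, is
    cut into \<open>N + 1\<close> equal steps. Each step contributes \<open>K\<close> times the step
    width to the power 3/2, so the sum is of order \<open>1 / sqrt (N + 1)\<close>.\<close>
  have bound: "\<bar>k t - k r\<bar> \<le> K * \<bar>d\<bar> * sqrt \<bar>d\<bar> * inverse (sqrt (real (Suc N)))" for N
  proof -
    let ?N = "Suc N"
    have "\<forall>j. \<exists>x. j \<le> ?N \<longrightarrow> x \<in> {r..t} \<and> A x = A r + (real j / real ?N) * d"
    proof
      fix j show "\<exists>x. j \<le> ?N \<longrightarrow> x \<in> {r..t} \<and> A x = A r + (real j / real ?N) * d"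
        using pts[of "real j / real ?N"] by (cases "j \<le> ?N") (auto simp: divide_simps simp del: of_nat_Suc)
    qed
    then obtain x where x: "\<And>j. j \<le> ?N \<Longrightarrow> x j \<in> {r..t} \<and> A (x j) = A r + (real j / real ?N) * d"
      by metis
    \<comment> \<open>The first and the last point may differ from \<open>r\<close> and
      \<open>t\<close>, but \<open>A\<close> takes the same values there, and the increment bound
      then forces equal values of \<open>k\<close>.\<close>
    have ends: "k (x 0) = k r" "k (x ?N) = k t"
      using inc'[of r "x 0"] inc'[of t "x ?N"] x[of 0] x[of ?N] rt by (auto simp: d_def)
    define e where "e = K * (\<bar>d\<bar> / ?N) * sqrt (\<bar>d\<bar> / ?N)"
    have step: "\<bar>k (x (Suc j)) - k (x j)\<bar> \<le> e" if "j < ?N" for j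
    proof -
      have "A (x (Suc j)) - A (x j) = d / ?N"
        using x[of j] x[of "Suc j"] that by (simp add: diff_divide_distrib add_divide_distrib algebra_simps)
      thus ?thesis using inc'[of "x j" "x (Suc j)"] x[of j] x[of "Suc j"] that
        by (simp add: e_def abs_divide del: of_nat_Suc)
    qed
    have "\<bar>k (x j) - k (x 0)\<bar> \<le> j * e" if "j \<le> ?N" for j using that
    proof (induction j)
      case (Suc j)
      thus ?case using step[of j] by (simp add: algebra_simps abs_le_iff)
    qed simp
    from this[of ?N] have "\<bar>k t - k r\<bar> \<le> ?N * e" by (simp only: ends)
    also have "?N * e = K * \<bar>d\<bar> * sqrt \<bar>d\<bar> * inverse (sqrt (real ?N))"
      by (simp add: e_def real_sqrt_divide field_simps del: of_nat_Suc)
    finally show ?thesis .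
  qed
  have "(\<lambda>N. inverse (sqrt (real (Suc N)))) \<longlonglongrightarrow> 0"
    using tendsto_real_sqrt[OF LIMSEQ_inverse_real_of_nat] by (simp add: real_sqrt_inverse)
  hence "(\<lambda>N. K * \<bar>d\<bar> * sqrt \<bar>d\<bar> * inverse (sqrt (real (Suc N)))) \<longlonglongrightarrow> K * \<bar>d\<bar> * sqrt \<bar>d\<bar> * 0"
    by (intro tendsto_mult tendsto_const)
  hence "\<bar>k t - k r\<bar> \<le> K * \<bar>d\<bar> * sqrt \<bar>d\<bar> * 0"
    using bound by (intro LIMSEQ_le_const) auto
  thus ?thesis by simp
qed

text \<open>Absolute continuity with density \<open>f\<close>, encoded through the integral so that
  no almost everywhere differentiation is involved.\<close>

definition primitive_on :: "real \<Rightarrow> real \<Rightarrow> (real \<Rightarrow> real) \<Rightarrow> (real \<Rightarrow> real) \<Rightarrow> bool" where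
  "primitive_on r t F f \<longleftrightarrow>
     set_integrable lborel {r..t} f \<and> (\<forall>u\<in>{r..t}. F u = F r + (LINT v:{r..u}|lborel. f v))"

lemma set_integrable_Icc_subset:
  fixes f :: "real \<Rightarrow> real"
  assumes "set_integrable lborel {r..t} f" "r \<le> u" "v \<le> t"
  shows "set_integrable lborel {u..v} f"
  by (rule set_integrable_subset[OF assms(1)]) (use assms in auto)

lemma set_integral_combine:
  fixes f :: "real \<Rightarrow> real"
  assumes f: "set_integrable lborel {r..t} f" and ord: "r \<le> u" "u \<le> t"
  shows "(LINT v:{r..t}|lborel. f v) = (LINT v:{r..u}|lborel. f v) + (LINT v:{u..t}|lborel. f v)"
proof -
  have *: "set_integrable lborel {r..u} f" "set_integrable lborel {u..t} f"
    using ord set_integrable_Icc_subset[OF f, of r u] set_integrable_Icc_subset[OF f, of u t] by auto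
  show ?thesis
    using Henstock_Kurzweil_Integration.integral_combine[OF ord set_borel_integral_eq_integral(1)[OF f]]
    by (simp add: set_borel_integral_eq_integral(2)[OF f]
        set_borel_integral_eq_integral(2)[OF *(1)] set_borel_integral_eq_integral(2)[OF *(2)])
qed

lemma set_integral_const_Icc: "u \<le> v \<Longrightarrow> (LINT w:{u..v}|lborel. (c::real)) = (v - u) * c"
  by (simp add: set_lebesgue_integral_def)

lemma set_integral_abs_le:
  fixes f g :: "real \<Rightarrow> real"
  assumes "set_integrable lborel S f" "set_integrable lborel S g" "\<And>x. x \<in> S \<Longrightarrow> \<bar>f x\<bar> \<le> g x"
  shows "\<bar>LINT x:S|lborel. f x\<bar> \<le> (LINT x:S|lborel. g x)"
proof -
  have "\<bar>LINT x:S|lborel. f x\<bar> \<le> (LINT x:S|lborel. \<bar>f x\<bar>)"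
    using set_integral_norm_bound[OF assms(1)] by simp
  also have "\<dots> \<le> (LINT x:S|lborel. g x)"
    using assms by (intro set_integral_mono set_integrable_abs) auto
  finally show ?thesis .
qed

lemma set_integral_abs_nonneg: "0 \<le> (LINT v:S|lborel. \<bar>f v\<bar> + \<bar>g v :: real\<bar>)"
  unfolding set_lebesgue_integral_def by (intro integral_nonneg_AE AE_I2) (auto simp: indicator_def)

lemma primitive_onD:
  assumes "primitive_on r t F f" "r \<le> u" "u \<le> t"
  shows "F u = F r + (LINT v:{r..u}|lborel. f v)"
  using assms unfolding primitive_on_def by (meson atLeastAtMost_iff)

lemma primitive_on_integrable: "primitive_on r t F f \<Longrightarrow> set_integrable lborel {r..t} f"
  by (simp add: primitive_on_def)

lemma primitive_on_diff:
  assumes "primitive_on r t F f" "r \<le> u" "u \<le> v" "v \<le> t"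
  shows "F v - F u = (LINT w:{u..v}|lborel. f w)"
proof -
  have "set_integrable lborel {r..v} f"
    by (rule set_integrable_Icc_subset[OF primitive_on_integrable[OF assms(1)]]) (use assms in auto)
  from set_integral_combine[OF this assms(2,3)]
  show ?thesis using primitive_onD[OF assms(1), of u] primitive_onD[OF assms(1), of v] assms by linarith
qed

lemma primitive_on_continuous:
  assumes "primitive_on r t F f" shows "continuous_on {r..t} F"
proof -
  have f: "set_integrable lborel {r..t} f" using assms by (simp add: primitive_on_def)
  have "continuous_on {r..t} (\<lambda>u. F r + integral {r..u} f)"
    by (intro continuous_intros indefinite_integral_continuous_1 set_borel_integral_eq_integral(1) f)
  moreover have "F u = F r + integral {r..u} f" if "u \<in> {r..t}" for u
    using that primitive_onD[OF assms, of u]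
      set_borel_integral_eq_integral(2)[OF set_integrable_Icc_subset[OF f, of r u]] by simp
  ultimately show ?thesis using continuous_on_cong[OF refl, of "{r..t}" F "\<lambda>u. F r + integral {r..u} f"] by blast
qed

lemma set_integral_Icc_refl: "(LINT v:{r..r}|lborel. (f (v::real) :: real)) = 0"
proof -
  have "AE v in lborel. indicator {r..r} v *\<^sub>R f v = 0"
    using AE_lborel_singleton[of r] by eventually_elim (auto simp: indicator_def dest: order_antisym)
  thus ?thesis unfolding set_lebesgue_integral_def by (rule integral_eq_zero_AE)
qed

lemma primitive_on_indefinite:
  assumes "set_integrable lborel {r..t} f"
  shows "primitive_on r t (\<lambda>u. c + (LINT v:{r..u}|lborel. f v)) f"
  unfolding primitive_on_def set_integral_Icc_refl using assms by simp

lemma primitive_on_C1: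
  assumes "r \<le> t" "\<And>u. u \<in> {r..t} \<Longrightarrow> (F has_real_derivative f u) (at u within {r..t})"
    "continuous_on {r..t} f"
  shows "primitive_on r t F f"
proof -
  have i: "set_integrable lborel {r..t} f"
    using assms(3) by (intro borel_integrable_atLeastAtMost') auto
  have FTC: "F u = F r + (LINT v:{r..u}|lborel. f v)" if "u \<in> {r..t}" for u
  proof -
    have "(f has_integral F u - F r) {r..u}"
      using that assms(2) by (intro fundamental_theorem_of_calculus)
        (auto simp: has_real_derivative_iff_has_vector_derivative[symmetric] intro!: DERIV_subset[of F "f _" _ "{r..t}" "{r..u}"])
    thus ?thesis
      using set_borel_integral_eq_integral(2)[OF set_integrable_Icc_subset[OF i, of r u]] that
      by (simp add: integral_unique)
  qed
  show ?thesis unfolding primitive_on_def using i FTC by blast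
qed

text \<open>Continuity on a compact interval bounds \<open>g\<close> by some \<open>B\<close>, and
  \<open>B * f\<close> dominates the product.\<close>

lemma set_integrable_mult_continuous:
  fixes f g :: "real \<Rightarrow> real"
  assumes "set_integrable lborel {r..t} f" "continuous_on {r..t} g"
  shows "set_integrable lborel {r..t} (\<lambda>x. f x * g x)"
proof -
  obtain B where B: "\<And>x. x \<in> {r..t} \<Longrightarrow> \<bar>g x\<bar> \<le> B"
    using compact_continuous_image[OF assms(2) compact_Icc] compact_imp_bounded
    by (force simp: bounded_iff)
  have "set_borel_measurable lborel {r..t} g"
    using borel_measurable_continuous_on_indicator[OF _ assms(2)] by (simp add: set_borel_measurable_def)
  hence m: "set_borel_measurable lborel {r..t} (\<lambda>x. f x * g x)"
  proof -
    assume "set_borel_measurable lborel {r..t} g"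
    moreover have "set_borel_measurable lborel {r..t} f"
      using assms(1) by (simp add: set_integrable_def set_borel_measurable_def)
    ultimately have "(\<lambda>x. (indicator {r..t} x *\<^sub>R f x) * (indicator {r..t} x *\<^sub>R g x)) \<in> borel_measurable lborel"
      unfolding set_borel_measurable_def by measurable
    also have "(\<lambda>x. (indicator {r..t} x *\<^sub>R f x) * (indicator {r..t} x *\<^sub>R g x))
      = (\<lambda>x. indicator {r..t} x *\<^sub>R (f x * g x))" by (auto simp: indicator_def)
    finally show ?thesis by (simp add: set_borel_measurable_def)
  qed
  have "set_integrable lborel {r..t} (\<lambda>x. B * f x)" using assms(1) by simp
  moreover have "AE x in lborel. x \<in> {r..t} \<longrightarrow> norm (f x * g x) \<le> norm (B * f x)"
  proof (intro AE_I2 impI)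
    fix x assume x: "x \<in> {r..t}"
    hence "\<bar>g x\<bar> \<le> \<bar>B\<bar>" using B[OF x] by linarith
    thus "norm (f x * g x) \<le> norm (B * f x)"
      by (simp add: abs_mult mult_right_mono mult.commute[of "\<bar>f x\<bar>"])
  qed
  ultimately show ?thesis using set_integrable_bound[OF _ m] by blast
qed

text \<open>Integration by parts without differentiability. With \<open>A\<close> the integral of
  \<open>\<bar>f\<bar> + \<bar>g\<bar>\<close>, the increments of \<open>F\<close> and of
  \<open>G\<close> are at most the increment \<open>D\<close> of \<open>A\<close>, and the defect of
  the product rule over the same interval is at most \<open>D\<^sup>2\<close>, which is
  superlinear.\<close>

lemma primitive_on_mult:
  assumes F: "primitive_on r t F f" and G: "primitive_on r t G g"
  shows "primitive_on r t (\<lambda>u. F u * G u) (\<lambda>u. f u * G u + F u * g u)"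
proof -
  note cF = primitive_on_continuous[OF F] and cG = primitive_on_continuous[OF G]
  note iF = primitive_on_integrable[OF F] and iG = primitive_on_integrable[OF G]
  define h where "h u = f u * G u + F u * g u" for u
  have ih: "set_integrable lborel {r..t} h" unfolding h_def
    using set_integrable_mult_continuous[OF iF cG] set_integrable_mult_continuous[OF iG cF]
    by (auto simp: mult.commute[of "F _"] intro!: set_integral_add)
  define A where "A u = 0 + (LINT v:{r..u}|lborel. \<bar>f v\<bar> + \<bar>g v\<bar>)" for u
  have iA: "set_integrable lborel {r..t} (\<lambda>v. \<bar>f v\<bar> + \<bar>g v\<bar>)"
    by (intro set_integral_add set_integrable_abs iF iG)
  have pA: "primitive_on r t A (\<lambda>v. \<bar>f v\<bar> + \<bar>g v\<bar>)"
    unfolding A_def by (rule primitive_on_indefinite[OF iA])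
  have main: "F t' * G t' - (LINT v:{r..t'}|lborel. h v) = F r * G r - (LINT v:{r..r}|lborel. h v)"
    if t': "t' \<in> {r..t}" for t'
  proof (rule constant_if_superlinear_increments[where r = r and t = t' and
        A = A and K = "2 * sqrt (A t' - A r)" and k = "\<lambda>u. F u * G u - (LINT v:{r..u}|lborel. h v)"])
    show "r \<le> t'" using t' by simp
    show "continuous_on {r..t'} A"
      by (rule continuous_on_subset[OF primitive_on_continuous[OF pA]]) (use t' in auto)
    fix u v assume uv: "u \<in> {r..t'}" "v \<in> {r..t'}" "u \<le> v"
    have bds: "r \<le> u" "v \<le> t" "u \<le> v" "u \<le> t" "r \<le> v" using uv t' by auto
    note sub = set_integrable_Icc_subset[OF _ bds(1,2)]
    have Amono: "A x \<le> A y" if "r \<le> x" "x \<le> y" "y \<le> t" for x y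
      using primitive_on_diff[OF pA that] set_integral_abs_nonneg[of "{x..y}" f g] by linarith
    have dF: "\<bar>F y - F x\<bar> \<le> A v - A u" if "u \<le> x" "x \<le> y" "y \<le> v" for x y
    proof -
      have "\<bar>F y - F x\<bar> \<le> A y - A x"
        using that bds primitive_on_diff[OF F, of x y] primitive_on_diff[OF pA, of x y]
        by (auto intro!: set_integral_abs_le set_integrable_Icc_subset[OF iF] set_integrable_Icc_subset[OF iA])
      also have "\<dots> \<le> A v - A u" using Amono[of y v] Amono[of u x] that bds by auto
      finally show ?thesis .
    qed
    have dG: "\<bar>G y - G x\<bar> \<le> A v - A u" if "u \<le> x" "x \<le> y" "y \<le> v" for x y
    proof -
      have "\<bar>G y - G x\<bar> \<le> A y - A x"
        using that bds primitive_on_diff[OF G, of x y] primitive_on_diff[OF pA, of x y]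
        by (auto intro!: set_integral_abs_le set_integrable_Icc_subset[OF iG] set_integrable_Icc_subset[OF iA])
      also have "\<dots> \<le> A v - A u" using Amono[of y v] Amono[of u x] that bds by auto
      finally show ?thesis .
    qed
    let ?D = "A v - A u"
    have D0: "?D \<ge> 0" using Amono bds by auto
    have "(F v * G v - (LINT v:{r..v}|lborel. h v)) - (F u * G u - (LINT v:{r..u}|lborel. h v))
       = (F v - F u) * G u + F v * (G v - G u) - (LINT w:{u..v}|lborel. h w)"
      using set_integral_combine[OF set_integrable_Icc_subset[OF ih, of r v], of u] bds
      by (simp add: algebra_simps)
    \<comment> \<open>The increments of \<open>F\<close> and \<open>G\<close> are written as
      integrals too; under the integral each density then meets an increment of the other
      function.\<close>
    also have "\<dots> = (LINT w:{u..v}|lborel. f w * G u + F v * g w - h w)"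
      using sub[OF iF] sub[OF iG] sub[OF ih] primitive_on_diff[OF F bds(1,3,2)]
        primitive_on_diff[OF G bds(1,3,2)]
      by (simp add: set_integral_diff set_integral_add)
    also have "\<bar>\<dots>\<bar> \<le> (LINT w:{u..v}|lborel. ?D * (\<bar>f w\<bar> + \<bar>g w\<bar>))"
    proof (intro set_integral_abs_le)
      fix w assume w: "w \<in> {u..v}"
      have "\<bar>f w * G u + F v * g w - h w\<bar> = \<bar>f w * (G u - G w) + g w * (F v - F w)\<bar>"
        by (simp add: h_def algebra_simps)
      also have "\<dots> \<le> \<bar>f w\<bar> * \<bar>G u - G w\<bar> + \<bar>g w\<bar> * \<bar>F v - F w\<bar>"
        by (metis abs_mult abs_triangle_ineq)
      also have "\<dots> \<le> \<bar>f w\<bar> * ?D + \<bar>g w\<bar> * ?D"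
        using dG[of u w] dF[of w v] w by (intro add_mono mult_left_mono) (auto simp: abs_minus_commute)
      finally show "\<bar>f w * G u + F v * g w - h w\<bar> \<le> ?D * (\<bar>f w\<bar> + \<bar>g w\<bar>)"
        by (simp add: algebra_simps)
    qed (use sub[OF iF] sub[OF iG] sub[OF ih] sub[OF iA] in \<open>auto intro!: set_integral_diff set_integral_add\<close>)
    also have "\<dots> = ?D * ?D" using primitive_on_diff[OF pA bds(1,3,2)] by simp
    also have "\<dots> = ?D * sqrt ?D * sqrt ?D" using D0 by simp
    \<comment> \<open>One of the two factors \<open>sqrt ?D\<close> is bounded by the root of the
      total increment, which leaves the exponent 3/2.\<close>
    also have "\<dots> \<le> (2 * sqrt (A t' - A r)) * \<bar>?D\<bar> * sqrt \<bar>?D\<bar>"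
    proof -
      have "sqrt ?D \<le> 2 * sqrt (A t' - A r)"
      proof -
        have "A r \<le> A u" "A v \<le> A t'" using Amono[of r u] Amono[of v t'] uv t' by auto
        hence 1: "?D \<le> A t' - A r" by linarith
        hence "sqrt ?D \<le> sqrt (A t' - A r)" by (rule real_sqrt_le_mono)
        moreover have "0 \<le> sqrt (A t' - A r)" using 1 D0 by (intro real_sqrt_ge_zero) linarith
        ultimately show ?thesis by linarith
      qed
      hence "sqrt ?D * (?D * sqrt ?D) \<le> (2 * sqrt (A t' - A r)) * (?D * sqrt ?D)"
        by (rule mult_right_mono) (use D0 in simp)
      thus ?thesis using D0 by (simp add: mult_ac)
    qed
    finally show "\<bar>F v * G v - (LINT v:{r..v}|lborel. h v) - (F u * G u - (LINT v:{r..u}|lborel. h v))\<bar>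
        \<le> (2 * sqrt (A t' - A r)) * \<bar>?D\<bar> * sqrt \<bar>?D\<bar>" .
  qed
  have "primitive_on r t (\<lambda>u. F u * G u) h"
    unfolding primitive_on_def
  proof (intro conjI ih ballI)
    fix u assume "u \<in> {r..t}"
    from main[OF this] show "F u * G u = F r * G r + (LINT v:{r..u}|lborel. h v)"
      unfolding set_integral_Icc_refl by linarith
  qed
  thus ?thesis by (simp add: h_def[abs_def])
qed

section \<open>Gaussian laws\<close>

lemma sets_gaussian [simp, measurable_cong]: "sets (gaussian m z) = sets borel"
  by (simp add: gaussian_def)

lemma space_gaussian [simp]: "space (gaussian m z) = UNIV"
  by (simp add: gaussian_def)

lemma prob_space_gaussian: "z > 0 \<Longrightarrow> prob_space (gaussian m z)"
  by (simp add: gaussian_def prob_space_normal_density)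

text \<open>Standardisation: Gaussian integrals become integrals against one fixed law, with mean
  and variance moved into the integrand.\<close>

lemma gaussian_eq_distr:
  assumes "z > 0"
  shows "gaussian m z = distr (gaussian 0 1) borel (\<lambda>w. m + sqrt z * w)"
proof -
  interpret prob_space "gaussian 0 1" by (rule prob_space_gaussian) simp
  have "distributed (gaussian 0 1) lborel (\<lambda>w. w) (normal_density 0 1)"
    by (simp add: distributed_def gaussian_def distr_id2)
  hence "distributed (gaussian 0 1) lborel (\<lambda>w. m + sqrt z * w) (normal_density (m + sqrt z * 0) (\<bar>sqrt z\<bar> * 1))"
    using assms by (intro normal_density_affine) auto
  hence "distr (gaussian 0 1) lborel (\<lambda>w. m + sqrt z * w) = density lborel (normal_density m (sqrt z))"
    using assms by (simp add: distributed_def)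
  moreover have "distr (gaussian 0 1) lborel (\<lambda>w. m + sqrt z * w) = distr (gaussian 0 1) borel (\<lambda>w. m + sqrt z * w)"
    by (intro distr_cong) auto
  ultimately show ?thesis by (simp add: gaussian_def)
qed

lemma integrable_gaussian_iff:
  fixes f :: "real \<Rightarrow> real"
  assumes "z > 0" "f \<in> borel_measurable borel"
  shows "integrable (gaussian m z) f \<longleftrightarrow> integrable (gaussian 0 1) (\<lambda>w. f (m + sqrt z * w))"
  unfolding gaussian_eq_distr[OF assms(1)] using assms(2) by (intro integrable_distr_eq) auto

lemma integral_gaussian:
  fixes f :: "real \<Rightarrow> real"
  assumes "z > 0" "f \<in> borel_measurable borel"
  shows "(\<integral>x. f x \<partial>gaussian m z) = (\<integral>w. f (m + sqrt z * w) \<partial>gaussian 0 1)"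
  unfolding gaussian_eq_distr[OF assms(1)] using assms(2) by (intro integral_distr) auto

lemma gaussian_std: "gaussian 0 1 = density lborel (\<lambda>x. ennreal (std_normal_density x))"
  by (simp add: gaussian_def)

section \<open>Moments of Gaussian laws\<close>

lemma std_gaussian_moments:
  "integrable (gaussian 0 1) (\<lambda>w. w)" "(\<integral>w. w \<partial>gaussian 0 1) = 0"
  "integrable (gaussian 0 1) (\<lambda>w. w\<^sup>2)" "(\<integral>w. w\<^sup>2 \<partial>gaussian 0 1) = 1"
proof -
  show "integrable (gaussian 0 1) (\<lambda>w. w)"
    using integrable_std_normal_moment[of 1] by (simp add: gaussian_std integrable_density)
  show "(\<integral>w. w \<partial>gaussian 0 1) = 0"
    using integral_std_normal_moment_odd[of 0] by (simp add: gaussian_std integral_density)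
  show "integrable (gaussian 0 1) (\<lambda>w. w\<^sup>2)"
    using integrable_std_normal_moment[of 2] by (simp add: gaussian_std integrable_density)
  show "(\<integral>w. w\<^sup>2 \<partial>gaussian 0 1) = 1"
    using integral_std_normal_moment_even[of 1] by (simp add: gaussian_std integral_density)
qed

lemma std_gaussian_affine_square:
  "integrable (gaussian 0 1) (\<lambda>w. (u + c * w)\<^sup>2)" "(\<integral>w. (u + c * w)\<^sup>2 \<partial>gaussian 0 1) = u\<^sup>2 + c\<^sup>2"
  "(\<integral>\<^sup>+w. ennreal ((u + c * w)\<^sup>2) \<partial>gaussian 0 1) = ennreal (u\<^sup>2 + c\<^sup>2)"
proof -
  interpret prob_space "gaussian 0 1" by (rule prob_space_gaussian) simp
  note [simp] = std_gaussian_moments prob_space[simplified]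
  have eq: "(u + c * w)\<^sup>2 = u\<^sup>2 + (2 * u * c) * w + c\<^sup>2 * w\<^sup>2" for w :: real
    by (simp add: power2_eq_square algebra_simps)
  show 1: "integrable (gaussian 0 1) (\<lambda>w. (u + c * w)\<^sup>2)" unfolding eq by simp
  show 2: "(\<integral>w. (u + c * w)\<^sup>2 \<partial>gaussian 0 1) = u\<^sup>2 + c\<^sup>2" unfolding eq by simp
  show "(\<integral>\<^sup>+w. ennreal ((u + c * w)\<^sup>2) \<partial>gaussian 0 1) = ennreal (u\<^sup>2 + c\<^sup>2)"
    using nn_integral_eq_integral[OF 1] 2 by simp
qed

lemma gaussian_moments:
  assumes "z > 0"
  shows "integrable (gaussian m z) (\<lambda>x. x)" "(\<integral>x. x \<partial>gaussian m z) = m"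
    "has_second_moment (gaussian m z)" "(\<integral>\<^sup>+x. ennreal (x\<^sup>2) \<partial>gaussian m z) = ennreal (m\<^sup>2 + z)"
proof -
  interpret prob_space "gaussian 0 1" by (rule prob_space_gaussian) simp
  note [simp] = std_gaussian_moments prob_space[simplified]
  show "integrable (gaussian m z) (\<lambda>x. x)" using assms by (subst integrable_gaussian_iff) auto
  show "(\<integral>x. x \<partial>gaussian m z) = m" using assms by (subst integral_gaussian) auto
  show "has_second_moment (gaussian m z)"
    unfolding has_second_moment_def using assms std_gaussian_affine_square
    by (subst integrable_gaussian_iff) auto
  have "(\<integral>\<^sup>+x. ennreal (x\<^sup>2) \<partial>gaussian m z) = (\<integral>\<^sup>+w. ennreal ((m + sqrt z * w)\<^sup>2) \<partial>gaussian 0 1)"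
    unfolding gaussian_eq_distr[OF assms, of m] by (subst nn_integral_distr) auto
  thus "(\<integral>\<^sup>+x. ennreal (x\<^sup>2) \<partial>gaussian m z) = ennreal (m\<^sup>2 + z)"
    using assms by (simp add: std_gaussian_affine_square)
qed

section \<open>Characteristic functions of Gaussian laws\<close>

lemma char_gaussian_std: "char (gaussian 0 1) u = complex_of_real (exp (- (u\<^sup>2) / 2))"
  using char_std_normal_distribution by (simp add: gaussian_std fun_eq_iff)

lemma prob_space_real_distribution:
  "prob_space \<mu> \<Longrightarrow> sets \<mu> = sets borel \<Longrightarrow> real_distribution (\<mu> :: real measure)"
  by (simp add: real_distribution_def real_distribution_axioms_def)

lemma char_eq_cos_sin:
  assumes "prob_space \<mu>" "sets \<mu> = sets borel"
  shows "char \<mu> u = Complex (\<integral>x. cos (u * x) \<partial>\<mu>) (\<integral>x. sin (u * x) \<partial>\<mu>)"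
proof -
  interpret real_distribution \<mu> using assms by (rule prob_space_real_distribution)
  have i: "integrable \<mu> (\<lambda>x. iexp (u * x))"
    by (rule integrable_const_bound[where B = 1]) auto
  show ?thesis
    unfolding char_def
    using integral_Re[OF i] integral_Im[OF i]
    by (intro complex_eqI) (simp_all add: Re_exp Im_exp)
qed

text \<open>The phase \<open>c\<close> lets one real formula carry both parts of the characteristic
  function, since a sine is a cosine with phase \<open>- (pi/2)\<close>. The addition theorem
  reduces it to the standard law, whose sine transform vanishes.\<close>

lemma gaussian_cos:
  assumes "z > 0"
  shows "(\<integral>x. cos (u * x + c) \<partial>gaussian m z) = exp (- (u\<^sup>2 * z) / 2) * cos (u * m + c)"
proof -
  interpret prob_space "gaussian 0 1" by (rule prob_space_gaussian) simp
  let ?v = "u * sqrt z" and ?d = "u * m + c"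
  have i: "integrable (gaussian 0 1) (\<lambda>x. cos (?v * x))" "integrable (gaussian 0 1) (\<lambda>x. sin (?v * x))"
    by (rule integrable_const_bound[where B = 1]; simp)+
  have ch: "(\<integral>x. cos (?v * x) \<partial>gaussian 0 1) = exp (- (?v\<^sup>2) / 2)" "(\<integral>x. sin (?v * x) \<partial>gaussian 0 1) = 0"
    using char_gaussian_std[of ?v] char_eq_cos_sin[of "gaussian 0 1" ?v]
    by (simp_all add: prob_space_gaussian complex_eq_iff Re_exp Im_exp)
  have "(\<integral>x. cos (u * x + c) \<partial>gaussian m z) = (\<integral>x. cos (?v * x + ?d) \<partial>gaussian 0 1)"
    using assms by (subst integral_gaussian) (auto simp: algebra_simps)
  also have "\<dots> = (\<integral>x. cos ?d * cos (?v * x) - sin ?d * sin (?v * x) \<partial>gaussian 0 1)"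
    by (simp add: cos_add mult.commute)
  also have "\<dots> = cos ?d * exp (- (?v\<^sup>2) / 2)" using i ch by simp
  finally show ?thesis using assms by (simp add: power_mult_distrib)
qed

text \<open>The phases \<open>0\<close> and \<open>- (pi/2)\<close> recover the real and the
  imaginary part of the characteristic function, and Levy's uniqueness theorem applies.\<close>

lemma gaussian_eqI:
  assumes "prob_space \<mu>" "sets \<mu> = sets borel" "z > 0"
    and cos: "\<And>u c. (\<integral>x. cos (u * x + c) \<partial>\<mu>) = exp (- (u\<^sup>2 * z) / 2) * cos (u * m + c)"
  shows "\<mu> = gaussian m z"
proof (rule Levy_uniqueness)
  show "real_distribution \<mu>" "real_distribution (gaussian m z)"
    using assms prob_space_gaussian by (auto intro!: prob_space_real_distribution)
  have "(\<integral>x. cos (u * x) \<partial>\<mu>) = (\<integral>x. cos (u * x) \<partial>gaussian m z)" for u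
    using cos[of u 0] gaussian_cos[OF assms(3), where u = u and c = 0 and m = m] by simp
  moreover have "(\<integral>x. sin (u * x) \<partial>\<mu>) = (\<integral>x. sin (u * x) \<partial>gaussian m z)" for u
    using cos[of u "- (pi/2)"] gaussian_cos[OF assms(3), where u = u and c = "- (pi/2)" and m = m] by (simp add: cos_diff)
  ultimately show "char \<mu> = char (gaussian m z)"
    using assms by (intro ext) (simp add: char_eq_cos_sin prob_space_gaussian)
qed

text \<open>The joint density of state \<open>x\<close> and observation \<open>y\<close>,
  disintegrated in the other order: marginal of \<open>y\<close> times posterior of \<open>x\<close>
  given \<open>y\<close>.\<close>

lemma gaussian_times_noise:
  assumes "z > 0" "e > 0"
  shows "normal_density m (sqrt z) x * normal_density 0 e (y - x) =
    normal_density m (sqrt (z + e\<^sup>2)) y *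
    normal_density (m + z / (z + e\<^sup>2) * (y - m)) (sqrt (z * e\<^sup>2 / (z + e\<^sup>2))) x"
proof -
  have pos: "z + e\<^sup>2 > 0" using assms by (simp add: add_pos_pos)
  let ?v = "z * e\<^sup>2 / (z + e\<^sup>2)" and ?n = "m + z / (z + e\<^sup>2) * (y - m)"
  have v: "?v > 0" using assms pos by simp
  \<comment> \<open>The normalising constants agree because
    \<open>z * e\<^sup>2 = (z + e\<^sup>2) * ?v\<close>.\<close>
  have c: "sqrt (2 * pi * z) * sqrt (2 * pi * e\<^sup>2) = sqrt (2 * pi * (z + e\<^sup>2)) * sqrt (2 * pi * ?v)"
    using pos by (simp add: real_sqrt_mult[symmetric])
  \<comment> \<open>Completing the square in \<open>x\<close>. In the centred variables
    \<open>d\<close> and \<open>h\<close> it comes down to a polynomial identity whose right side is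
    \<open>(s * h - z * d)\<^sup>2\<close>.\<close>
  have q: "- ((x - m)\<^sup>2) / (2 * z) + - ((y - x)\<^sup>2) / (2 * e\<^sup>2) =
      - ((y - m)\<^sup>2) / (2 * (z + e\<^sup>2)) + - ((x - ?n)\<^sup>2) / (2 * ?v)"
  proof -
    define s where "s = z + e\<^sup>2"
    define d where "d = y - m"
    define h where "h = x - m"
    have s: "s > 0" "z = s - e\<^sup>2" "z > 0" "e\<^sup>2 > 0" using pos assms by (auto simp: s_def)
    have 1: "(x - ?n)\<^sup>2 / (2 * ?v) = (s * h - z * d)\<^sup>2 / (2 * s * z * e\<^sup>2)"
    proof -
      have "x - ?n = (s * h - z * d) / s"
        using s(1) by (simp add: s_def[symmetric] h_def d_def diff_divide_distrib)
      moreover have "(a / s)\<^sup>2 / (2 * (z * q / s)) = a\<^sup>2 / (2 * s * z * q)" if "q > 0" for a q :: real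
        using that s(1,3) by (simp add: power2_eq_square field_simps)
      ultimately show ?thesis using s(4) by (simp add: s_def[symmetric])
    qed
    have "h\<^sup>2 / (2 * z) + (d - h)\<^sup>2 / (2 * e\<^sup>2) - d\<^sup>2 / (2 * s) = 
      (h\<^sup>2 * e\<^sup>2 * s + (d - h)\<^sup>2 * z * s - d\<^sup>2 * z * e\<^sup>2) / (2 * s * z * e\<^sup>2)"
    proof -
      have "X / (2 * z) + Y / (2 * q) - W / (2 * s) = (X * q * s + Y * z * s - W * z * q) / (2 * s * z * q)"
        if "q > 0" for X Y W q :: real
        using that s(1,3) by (simp add: add_frac_eq diff_frac_eq) (simp add: field_simps)
      thus ?thesis using s(4) by blast
    qed
    also have "h\<^sup>2 * e\<^sup>2 * s + (d - h)\<^sup>2 * z * s - d\<^sup>2 * z * e\<^sup>2 = (s * h - z * d)\<^sup>2"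
      unfolding s_def by (simp add: power2_eq_square algebra_simps)
    finally have "h\<^sup>2 / (2 * z) + (d - h)\<^sup>2 / (2 * e\<^sup>2) = d\<^sup>2 / (2 * s) + (x - ?n)\<^sup>2 / (2 * ?v)"
      using 1 by simp
    thus ?thesis unfolding h_def d_def s_def by simp
  qed
  have sq: "(sqrt z)\<^sup>2 = z" "(sqrt (z + e\<^sup>2))\<^sup>2 = z + e\<^sup>2" "(sqrt ?v)\<^sup>2 = ?v"
    using assms(1) pos v by (simp_all add: real_sqrt_pow2 del: real_sqrt_pow2_iff)
  have "normal_density m (sqrt z) x * normal_density 0 e (y - x) =
    1 / (sqrt (2 * pi * z) * sqrt (2 * pi * e\<^sup>2)) *
      exp (- ((x - m)\<^sup>2) / (2 * z) + - ((y - x)\<^sup>2) / (2 * e\<^sup>2))"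
    unfolding normal_density_def sq exp_add by simp
  also have "\<dots> = normal_density m (sqrt (z + e\<^sup>2)) y * normal_density ?n (sqrt ?v) x"
    unfolding normal_density_def sq c q exp_add by simp
  finally show ?thesis .
qed

text \<open>The denominator of the Bayes kernel is the marginal density of \<open>y\<close>, so
  dividing \<open>gaussian_times_noise\<close> by it leaves the posterior density.\<close>

lemma gaussian_bayes_update:
  assumes "z > 0" "e > 0"
  shows "density (gaussian m z) (\<lambda>x. ennreal (bayes_kernel e (gaussian m z) y x)) =
    gaussian (m + z / (z + e\<^sup>2) * (y - m)) (z * e\<^sup>2 / (z + e\<^sup>2))"
proof -
  let ?g = "normal_density m (sqrt (z + e\<^sup>2)) y"
  have g: "?g > 0" using assms by (intro normal_density_pos) (simp add: add_pos_pos)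
  have "(\<integral>x'. normal_density 0 e (y - x') \<partial>gaussian m z) = 
      (\<integral>x. normal_density m (sqrt z) x * normal_density 0 e (y - x) \<partial>lborel)"
    unfolding gaussian_def by (subst integral_density) auto
  also have "\<dots> = ?g"
    unfolding gaussian_times_noise[OF assms] using assms by (simp add: add_pos_pos)
  finally have k: "bayes_kernel e (gaussian m z) y x = normal_density 0 e (y - x) / ?g" for x
    by (simp add: bayes_kernel_def)
  have "density (gaussian m z) (\<lambda>x. ennreal (bayes_kernel e (gaussian m z) y x)) =
    density lborel (\<lambda>x. ennreal (normal_density m (sqrt z) x) * ennreal (normal_density 0 e (y - x) / ?g))"
    unfolding k unfolding gaussian_def by (subst density_density_eq) auto
  also have "\<dots> = gaussian (m + z / (z + e\<^sup>2) * (y - m)) (z * e\<^sup>2 / (z + e\<^sup>2))"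
    unfolding gaussian_def
  proof (intro density_cong AE_I2)
    fix x
    have "normal_density m (sqrt z) x * (normal_density 0 e (y - x) / ?g) =
      normal_density (m + z / (z + e\<^sup>2) * (y - m)) (sqrt (z * e\<^sup>2 / (z + e\<^sup>2))) x"
      using gaussian_times_noise[OF assms, of m x y] g by (simp add: field_simps)
    thus "ennreal (normal_density m (sqrt z) x) * ennreal (normal_density 0 e (y - x) / ?g) =
      ennreal (normal_density (m + z / (z + e\<^sup>2) * (y - m)) (sqrt (z * e\<^sup>2 / (z + e\<^sup>2))) x)"
      by (metis ennreal_mult' normal_density_nonneg)
  qed auto
  finally show ?thesis .
qed

text \<open>The law is the image of a fixed law under a map that is jointly measurable in
  \<open>m\<close> and the integration variable. The measurability of the constructed filter rests
  on this.\<close>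

lemma gaussian_measurable_mean:
  assumes "z > 0"
  shows "(\<lambda>m. gaussian m z) \<in> borel \<rightarrow>\<^sub>M prob_algebra borel"
proof -
  have "(\<lambda>m. distr (gaussian 0 1) borel (\<lambda>w. m + sqrt z * w)) \<in> borel \<rightarrow>\<^sub>M prob_algebra borel"
  proof (rule measurable_distr_prob_space2[where M = borel])
    show "(\<lambda>m. gaussian 0 1) \<in> borel \<rightarrow>\<^sub>M prob_algebra borel"
      by (intro measurable_const) (simp add: space_prob_algebra prob_space_gaussian)
  qed measurable
  thus ?thesis by (simp add: gaussian_eq_distr[OF assms, symmetric])
qed

section \<open>Uniqueness for the weak evolution\<close>

lemma test_functionI:
  fixes f f' f'' :: "real \<Rightarrow> real"
  assumes f: "\<And>x. (f has_real_derivative f' x) (at x)" and f': "\<And>x. (f' has_real_derivative f'' x) (at x)"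
    and f'': "continuous_on UNIV f''" "\<And>x. \<bar>f'' x\<bar> \<le> B"
  shows "test_function f" "deriv f = f'" "deriv (deriv f) = f''"
proof -
  show 1: "deriv f = f'" using f by (intro ext DERIV_imp_deriv)
  show 2: "deriv (deriv f) = f''" unfolding 1 using f' by (intro ext DERIV_imp_deriv)
  show "test_function f"
    unfolding test_function_def 2 unfolding 1
    using f f' f'' by (auto simp: bounded_iff real_differentiable_def)
qed

lemma test_function_id: "test_function (\<lambda>x. x)" "deriv (\<lambda>x::real. x) = (\<lambda>x. 1)" "deriv (\<lambda>x::real. 1) = (\<lambda>x. 0::real)"
  using test_functionI[of "\<lambda>x. x" "\<lambda>x. 1" "\<lambda>x. 0" 0] by (auto intro!: derivative_eq_intros)

lemma test_function_square: "test_function (\<lambda>x. x\<^sup>2)" "deriv (\<lambda>x::real. x\<^sup>2) = (\<lambda>x. 2 * x)"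
  "deriv (\<lambda>x::real. 2 * x) = (\<lambda>x. 2::real)"
proof -
  have 1: "((\<lambda>x. x\<^sup>2) has_real_derivative 2 * x) (at x)" for x :: real
    by (auto intro!: derivative_eq_intros)
  have 2: "((\<lambda>x. 2 * x) has_real_derivative 2) (at x)" for x :: real
    by (auto intro!: derivative_eq_intros)
  have 3: "continuous_on UNIV (\<lambda>x::real. 2::real)" "\<And>x::real. \<bar>2::real\<bar> \<le> 2" by auto
  show "test_function (\<lambda>x. x\<^sup>2)" "deriv (\<lambda>x::real. x\<^sup>2) = (\<lambda>x. 2 * x)"
    "deriv (\<lambda>x::real. 2 * x) = (\<lambda>x. 2::real)"
    using test_functionI[OF 1 2 3] by simp_all
qed

lemma test_function_cos:
  "test_function (\<lambda>x. cos (l * x + c))" "deriv (\<lambda>x. cos (l * x + c)) = (\<lambda>x. - l * sin (l * x + c))"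
  "deriv (\<lambda>x. - l * sin (l * x + c)) = (\<lambda>x. - (l\<^sup>2) * cos (l * x + c))"
proof -
  have 1: "((\<lambda>x. cos (l * x + c)) has_real_derivative - l * sin (l * x + c)) (at x)"
    "((\<lambda>x. - l * sin (l * x + c)) has_real_derivative - (l\<^sup>2) * cos (l * x + c)) (at x)" for x
    by (auto intro!: derivative_eq_intros simp: power2_eq_square)
  have 2: "continuous_on UNIV (\<lambda>x. - (l\<^sup>2) * cos (l * x + c))" by (intro continuous_intros)
  have 3: "\<bar>- (l\<^sup>2) * cos (l * x + c)\<bar> \<le> l\<^sup>2" for x
    using mult_left_mono[OF abs_cos_le_one[of "l * x + c"], of "l\<^sup>2"] by (simp add: abs_mult)
  show "test_function (\<lambda>x. cos (l * x + c))" "deriv (\<lambda>x. cos (l * x + c)) = (\<lambda>x. - l * sin (l * x + c))"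
    "deriv (\<lambda>x. - l * sin (l * x + c)) = (\<lambda>x. - (l\<^sup>2) * cos (l * x + c))"
    using test_functionI[OF 1 2 3] by auto
qed

text \<open>The integral of \<open>exp (- 2 * \<theta> * u)\<close> over \<open>u\<close> from
  \<open>0\<close> to \<open>h\<close>; the case distinction covers
  \<open>\<theta> = 0\<close>.\<close>

definition exp_integral :: "real \<Rightarrow> real \<Rightarrow> real" where
  "exp_integral \<theta> h = (if \<theta> = 0 then h else (1 - exp (- 2 * \<theta> * h)) / (2 * \<theta>))"

lemma exp_integral_0 [simp]: "exp_integral \<theta> 0 = 0"
  by (simp add: exp_integral_def)

lemma exp_integral_eq: "2 * \<theta> * exp_integral \<theta> h = 1 - exp (- 2 * \<theta> * h)"
  by (simp add: exp_integral_def)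

lemma exp_integral_deriv [derivative_intros]:
  assumes "(f has_real_derivative f') (at x within S)"
  shows "((\<lambda>x. exp_integral \<theta> (f x)) has_real_derivative exp (- 2 * \<theta> * f x) * f') (at x within S)"
proof (cases "\<theta> = 0")
  case True thus ?thesis using assms by (simp add: exp_integral_def)
next
  case False thus ?thesis unfolding exp_integral_def using assms
    by (auto intro!: derivative_eq_intros)
qed

lemma exp_integral_nonneg: assumes "h \<ge> 0" shows "exp_integral \<theta> h \<ge> 0"
proof -
  have "exp_integral \<theta> 0 \<le> exp_integral \<theta> h"
    by (rule DERIV_nonneg_imp_nondecreasing[OF assms]) (auto intro!: exI derivative_eq_intros)
  thus ?thesis by simp
qed

text \<open>The solution at time \<open>h\<close> of the variance equation
  \<open>z' = b\<^sup>2 - 2 * \<theta> * z\<close> that starts in \<open>z\<close>.\<close>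

definition ou_variance :: "real \<Rightarrow> real \<Rightarrow> real \<Rightarrow> real \<Rightarrow> real" where
  "ou_variance \<theta> b h z = exp (- 2 * \<theta> * h) * z + b\<^sup>2 * exp_integral \<theta> h"

lemma ou_variance_pos: "z > 0 \<Longrightarrow> h \<ge> 0 \<Longrightarrow> ou_variance \<theta> b h z > 0"
  unfolding ou_variance_def by (intro add_pos_nonneg mult_pos_pos mult_nonneg_nonneg exp_integral_nonneg) auto

lemma ou_variance_0 [simp]: "ou_variance \<theta> b 0 z = z"
  by (simp add: ou_variance_def)

lemma primitive_on_cong:
  assumes "primitive_on r t F f" "\<And>u. u \<in> {r..t} \<Longrightarrow> f u = g u"
  shows "primitive_on r t F g"
proof -
  have "set_integrable lborel {r..t} g"
    using primitive_on_integrable[OF assms(1)] assms(2)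
    by (subst set_integrable_cong[OF refl, where f' = f]) auto
  moreover have "F u = F r + (LINT v:{r..u}|lborel. g v)" if "u \<in> {r..t}" for u
  proof -
    have "(LINT v:{r..u}|lborel. f v) = (LINT v:{r..u}|lborel. g v)"
      using assms(2) that by (intro set_lebesgue_integral_cong) auto
    thus ?thesis using primitive_onD[OF assms(1), of u] that by simp
  qed
  ultimately show ?thesis unfolding primitive_on_def by blast
qed

lemma abs_le_1_plus_square: "\<bar>x::real\<bar> \<le> 1 + x\<^sup>2"
proof -
  have "2 * x \<le> 1 + x\<^sup>2" "- 2 * x \<le> 1 + x\<^sup>2"
    using zero_le_power2[of "x - 1"] zero_le_power2[of "x + 1"] by (simp_all add: power2_eq_square algebra_simps)
  thus ?thesis using zero_le_power2[of x] by linarith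
qed

text \<open>A global quadratic remainder, from the addition theorem and second order bounds for
  \<open>sin h\<close> and \<open>cos h\<close> at zero. After integration over \<open>x\<close> it
  costs no more than a second moment.\<close>

lemma cos_taylor: "\<bar>cos (y + h) - cos y + h * sin y\<bar> \<le> h\<^sup>2" for y h :: real
proof -
  have sc: "\<bar>sin h - h\<bar> \<le> h\<^sup>2 / 2" "\<bar>cos h - 1\<bar> \<le> h\<^sup>2 / 2"
  proof -
    show "\<bar>cos h - 1\<bar> \<le> h\<^sup>2 / 2"
      using cos_ge_minus_one cos_le_one[of h] Maclaurin_cos_expansion[of h 2] 
        cos_double_sin[of "h/2"] abs_sin_x_le_abs_x[of "h/2"] 
        power_mono[OF abs_sin_x_le_abs_x[of "h/2"], of 2] by (simp add: power_divide)
    obtain s where "sin h = (\<Sum>m<2. sin_coeff m * h ^ m) + sin (s + 1/2 * real 2 * pi) / fact 2 * h ^ 2"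
      using Maclaurin_sin_expansion[of h 2] by blast
    hence "sin h - h = sin (s + pi) / 2 * h\<^sup>2"
      by (simp add: sin_coeff_def numeral_2_eq_2)
    thus "\<bar>sin h - h\<bar> \<le> h\<^sup>2 / 2" 
      using mult_right_mono[OF abs_sin_le_one[of s], of "h\<^sup>2"] by (simp add: abs_mult)
  qed
  have "cos (y + h) - cos y + h * sin y = cos y * (cos h - 1) - sin y * (sin h - h)"
    by (simp add: cos_add algebra_simps)
  also have "\<bar>\<dots>\<bar> \<le> \<bar>cos y\<bar> * \<bar>cos h - 1\<bar> + \<bar>sin y\<bar> * \<bar>sin h - h\<bar>"
    by (metis abs_mult abs_triangle_ineq4)
  also have "\<dots> \<le> 1 * (h\<^sup>2/2) + 1 * (h\<^sup>2/2)"
    using sc by (intro add_mono mult_mono) auto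
  finally show ?thesis by simp
qed

text \<open>One stretch without observations, for a fixed observation path. The control is just a
  function; all its regularity has to come out of the weak evolution.\<close>

locale weak_ou_path =
  fixes \<theta> b :: real and a :: "real \<Rightarrow> real" and \<mu> :: "real \<Rightarrow> real measure" and r t :: real
  assumes rt: "r \<le> t"
    and prob: "\<And>u. u \<in> {r..t} \<Longrightarrow> prob_space (\<mu> u)"
    and sets_mu: "\<And>u. u \<in> {r..t} \<Longrightarrow> sets (\<mu> u) = sets borel"
    and second_moment: "\<And>u. u \<in> {r..t} \<Longrightarrow> has_second_moment (\<mu> u)"
    and weak: "\<And>u. u \<in> {r..t} \<Longrightarrow> weak_evolution \<theta> b a \<mu> r u"
begin

lemma measurable_mu: "f \<in> borel_measurable borel \<Longrightarrow> u \<in> {r..t} \<Longrightarrow> f \<in> borel_measurable (\<mu> u)"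
  using measurable_cong_sets[OF sets_mu refl] by blast

lemma integrable_quadratic:
  fixes f :: "real \<Rightarrow> real"
  assumes "u \<in> {r..t}" "f \<in> borel_measurable borel" "\<And>x. \<bar>f x\<bar> \<le> B * (1 + x\<^sup>2)"
  shows "integrable (\<mu> u) f"
proof -
  interpret prob_space "\<mu> u" by (rule prob[OF assms(1)])
  have "integrable (\<mu> u) (\<lambda>x. x\<^sup>2)" using second_moment[OF assms(1)] by (simp add: has_second_moment_def)
  hence "integrable (\<mu> u) (\<lambda>x. B * (1 + x\<^sup>2))" by simp
  thus ?thesis
  proof (rule Bochner_Integration.integrable_bound)
    show "AE x in \<mu> u. norm (f x) \<le> norm (B * (1 + x\<^sup>2))"
    proof (rule AE_I2)
      fix x
      have "\<bar>f x\<bar> \<le> B * (1 + x\<^sup>2)" by (rule assms)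
      also have "\<dots> \<le> \<bar>B * (1 + x\<^sup>2)\<bar>" by (rule abs_ge_self)
      finally show "norm (f x) \<le> norm (B * (1 + x\<^sup>2))" by simp
    qed
  qed (use measurable_mu assms in auto)
qed

lemma test_primitive:
  assumes "test_function f"
  shows "primitive_on r t (\<lambda>u. \<integral>x. f x \<partial>\<mu> u) (\<lambda>u. \<integral>x. generator \<theta> b (a u) f x \<partial>\<mu> u)"
  unfolding primitive_on_def
proof (intro conjI ballI)
  have "t \<in> {r..t}" using rt by simp
  from weak[OF this] assms
  show "set_integrable lborel {r..t} (\<lambda>u. \<integral>x. generator \<theta> b (a u) f x \<partial>\<mu> u)"
    unfolding weak_evolution_def by blast
  fix u assume "u \<in> {r..t}"
  from weak[OF this] assms
  show "(\<integral>x. f x \<partial>\<mu> u) = (\<integral>x. f x \<partial>\<mu> r) + (LINT v:{r..u}|lborel. \<integral>x. generator \<theta> b (a v) f x \<partial>\<mu> v)"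
    unfolding weak_evolution_def by blast
qed

definition mean :: "real \<Rightarrow> real" where "mean u = (\<integral>x. x \<partial>\<mu> u)"

lemma integrable_id: "u \<in> {r..t} \<Longrightarrow> integrable (\<mu> u) (\<lambda>x. x)"
  using integrable_quadratic[of u "\<lambda>x. x" 1] abs_le_1_plus_square by simp

lemma mean_primitive: "primitive_on r t mean (\<lambda>u. - \<theta> * mean u + a u)"
proof -
  have "(\<integral>x. generator \<theta> b (a u) (\<lambda>x. x) x \<partial>\<mu> u) = - \<theta> * mean u + a u" if u: "u \<in> {r..t}" for u
  proof -
    interpret prob_space "\<mu> u" by (rule prob[OF u])
    show ?thesis using integrable_id[OF u] prob_space
      by (simp add: generator_def test_function_id mean_def)
  qed
  from primitive_on_cong[OF test_primitive[OF test_function_id(1)] this]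
  show ?thesis unfolding mean_def by simp
qed

text \<open>Testing with the identity makes \<open>- \<theta> * mean u + a u\<close> integrable, and
  the mean is continuous as a primitive. So integrability of the control is a consequence of the
  weak evolution.\<close>

lemma control_integrable: "set_integrable lborel {r..t} a"
proof -
  have "set_integrable lborel {r..t} mean"
    using primitive_on_continuous[OF mean_primitive] by (intro borel_integrable_atLeastAtMost') auto
  hence "set_integrable lborel {r..t} (\<lambda>u. (- \<theta> * mean u + a u) + \<theta> * mean u)"
    using primitive_on_integrable[OF mean_primitive]
    by (intro set_integral_add(1)[of _ _ "\<lambda>u. - \<theta> * mean u + a u"] set_integrable_mult_right) auto
  thus ?thesis by simp
qed

text \<open>\<open>F\<close> is the cosine transform of the law at time \<open>u\<close>. Formally
  \<open>- P\<close> and \<open>- Q\<close> are its partial derivatives in \<open>l\<close> and in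
  \<open>c\<close>, which is how they enter the transport terms.\<close>

definition F :: "real \<Rightarrow> real \<Rightarrow> real \<Rightarrow> real" where "F u l c = (\<integral>x. cos (l * x + c) \<partial>\<mu> u)"
definition P :: "real \<Rightarrow> real \<Rightarrow> real \<Rightarrow> real" where "P u l c = (\<integral>x. x * sin (l * x + c) \<partial>\<mu> u)"
definition Q :: "real \<Rightarrow> real \<Rightarrow> real \<Rightarrow> real" where "Q u l c = (\<integral>x. sin (l * x + c) \<partial>\<mu> u)"

definition dF :: "real \<Rightarrow> real \<Rightarrow> real \<Rightarrow> real" where
  "dF u l c = \<theta> * l * P u l c - a u * l * Q u l c - 1/2 * b\<^sup>2 * l\<^sup>2 * F u l c"

lemma integrable_trig:
  assumes "u \<in> {r..t}"
  shows "integrable (\<mu> u) (\<lambda>x. cos (l * x + c))" "integrable (\<mu> u) (\<lambda>x. x * sin (l * x + c))"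
    "integrable (\<mu> u) (\<lambda>x. sin (l * x + c))"
proof -
  have 1: "1 \<le> 1 * (1 + x\<^sup>2)" for x :: real by simp
  have 2: "\<bar>x * sin (l * x + c)\<bar> \<le> 1 * (1 + x\<^sup>2)" for x
  proof -
    have "\<bar>x * sin (l * x + c)\<bar> \<le> \<bar>x\<bar> * 1" unfolding abs_mult by (intro mult_left_mono) auto
    thus ?thesis using abs_le_1_plus_square[of x] by simp
  qed
  show "integrable (\<mu> u) (\<lambda>x. cos (l * x + c))"
    by (rule integrable_quadratic[OF assms _ order_trans[OF abs_cos_le_one 1]]) measurable
  show "integrable (\<mu> u) (\<lambda>x. sin (l * x + c))"
    by (rule integrable_quadratic[OF assms _ order_trans[OF abs_sin_le_one 1]]) measurable
  show "integrable (\<mu> u) (\<lambda>x. x * sin (l * x + c))"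
    by (rule integrable_quadratic[OF assms _ 2]) measurable
qed

lemma F_primitive: "primitive_on r t (\<lambda>u. F u l c) (\<lambda>u. dF u l c)"
proof -
  have "(\<integral>x. generator \<theta> b (a u) (\<lambda>x. cos (l * x + c)) x \<partial>\<mu> u) = dF u l c" if u: "u \<in> {r..t}" for u
  proof -
    note [simp] = integrable_trig[OF u]
    have "generator \<theta> b (a u) (\<lambda>x. cos (l * x + c)) x = 
       \<theta> * l * (x * sin (l * x + c)) - a u * l * sin (l * x + c) - 1/2 * b\<^sup>2 * l\<^sup>2 * cos (l * x + c)" for x
      unfolding generator_def test_function_cos by (simp add: algebra_simps)
    thus ?thesis unfolding dF_def F_def P_def Q_def by simp
  qed
  from primitive_on_cong[OF test_primitive[OF test_function_cos(1)] this]
  show ?thesis unfolding F_def by simp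
qed

text \<open>The square is a test function, so the second moment is continuous in time and bounded on
  the compact interval. This makes the Taylor estimates for the transform uniform in time.\<close>

lemma second_moment_bound: "\<exists>B\<ge>1. \<forall>u\<in>{r..t}. (\<integral>x. 1 + x\<^sup>2 \<partial>\<mu> u) \<le> B"
proof -
  have "continuous_on {r..t} (\<lambda>u. \<integral>x. x\<^sup>2 \<partial>\<mu> u)"
    by (rule primitive_on_continuous[OF test_primitive[OF test_function_square(1)]])
  from compact_continuous_image[OF this compact_Icc]
  obtain K where K: "\<And>u. u \<in> {r..t} \<Longrightarrow> \<bar>\<integral>x. x\<^sup>2 \<partial>\<mu> u\<bar> \<le> K"
    using compact_imp_bounded by (force simp: bounded_iff)
  have "(\<integral>x. 1 + x\<^sup>2 \<partial>\<mu> u) \<le> 1 + \<bar>K\<bar>" if u: "u \<in> {r..t}" for u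
  proof -
    interpret prob_space "\<mu> u" by (rule prob[OF u])
    have "integrable (\<mu> u) (\<lambda>x. x\<^sup>2)" using second_moment[OF u] by (simp add: has_second_moment_def)
    thus ?thesis using K[OF u] prob_space by simp
  qed
  thus ?thesis by (intro exI[of _ "1 + \<bar>K\<bar>"]) auto
qed

lemma integral_quadratic_bound:
  fixes f :: "real \<Rightarrow> real"
  assumes "u \<in> {r..t}" "f \<in> borel_measurable borel" "\<And>x. \<bar>f x\<bar> \<le> K * (1 + x\<^sup>2)"
    "(\<integral>x. 1 + x\<^sup>2 \<partial>\<mu> u) \<le> B" "K \<ge> 0"
  shows "\<bar>\<integral>x. f x \<partial>\<mu> u\<bar> \<le> K * B"
proof -
  interpret prob_space "\<mu> u" by (rule prob[OF assms(1)])
  have i2: "integrable (\<mu> u) (\<lambda>x. x\<^sup>2)" using second_moment[OF assms(1)] by (simp add: has_second_moment_def)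
  have "\<bar>\<integral>x. f x \<partial>\<mu> u\<bar> \<le> (\<integral>x. \<bar>f x\<bar> \<partial>\<mu> u)" by simp
  also have "\<dots> \<le> (\<integral>x. K * (1 + x\<^sup>2) \<partial>\<mu> u)"
    using integrable_quadratic[OF assms(1-3)] i2 assms(3) by (intro integral_mono) auto
  also have "\<dots> = K * (\<integral>x. 1 + x\<^sup>2 \<partial>\<mu> u)" by simp
  also have "\<dots> \<le> K * B" using assms by (intro mult_left_mono)
  finally show ?thesis .
qed

text \<open>A common clock: its increments dominate both the elapsed time and the integral of the
  modulus of the control, so every other increment can be measured against it.\<close>

definition A :: "real \<Rightarrow> real" where "A u = 0 + (LINT v:{r..u}|lborel. \<bar>1\<bar> + \<bar>a v\<bar>)"

lemma A_primitive: "primitive_on r t A (\<lambda>v. \<bar>1\<bar> + \<bar>a v\<bar>)"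
proof -
  have "set_integrable lborel {r..t} (\<lambda>v. \<bar>1\<bar> + \<bar>a v\<bar>)"
    by (intro set_integral_add set_integrable_abs control_integrable borel_integrable_atLeastAtMost') auto
  thus ?thesis unfolding A_def by (rule primitive_on_indefinite)
qed

lemma A_increment:
  assumes "r \<le> u" "u \<le> v" "v \<le> t"
  shows "v - u \<le> A v - A u"
    and "set_integrable lborel {u..v} g \<Longrightarrow> (\<And>w. w \<in> {u..v} \<Longrightarrow> \<bar>g w\<bar> \<le> K * (1 + \<bar>a w\<bar>)) \<Longrightarrow>
      \<bar>LINT w:{u..v}|lborel. g w\<bar> \<le> K * (A v - A u)"
proof -
  have i: "set_integrable lborel {u..v} (\<lambda>v. \<bar>1\<bar> + \<bar>a v\<bar>)"
    by (rule set_integrable_Icc_subset[OF primitive_on_integrable[OF A_primitive]]) (use assms in auto)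
  note d = primitive_on_diff[OF A_primitive assms]
  have "set_integrable lborel {u..v} (\<lambda>w. 1 :: real)" by (intro borel_integrable_atLeastAtMost') auto
  hence "(LINT w:{u..v}|lborel. 1) \<le> (LINT w:{u..v}|lborel. \<bar>1\<bar> + \<bar>a w\<bar>)"
    using i by (intro set_integral_mono) auto
  thus "v - u \<le> A v - A u" using d assms by (simp add: set_integral_const_Icc)
  assume g: "set_integrable lborel {u..v} g" "\<And>w. w \<in> {u..v} \<Longrightarrow> \<bar>g w\<bar> \<le> K * (1 + \<bar>a w\<bar>)"
  have "\<bar>LINT w:{u..v}|lborel. g w\<bar> \<le> (LINT w:{u..v}|lborel. K * (\<bar>1\<bar> + \<bar>a w\<bar>))"
    using g i by (intro set_integral_abs_le) auto
  thus "\<bar>LINT w:{u..v}|lborel. g w\<bar> \<le> K * (A v - A u)" using d by simp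
qed


lemma control_integrable_mult:
  assumes "continuous_on {r..t} g" "r \<le> u" "v \<le> t"
  shows "set_integrable lborel {u..v} (\<lambda>w. g w * a w)"
  using set_integrable_Icc_subset[OF set_integrable_mult_continuous[OF control_integrable assms(1)] assms(2,3)]
  by (simp add: mult.commute)

text \<open>Along the characteristics \<open>l' = \<theta> l\<close>, \<open>c' = - l a\<close> the transport terms of the Fourier
  transformed equation cancel, and only the factor \<open>- b\<^sup>2 l\<^sup>2 / 2\<close> remains. Since \<open>c\<close> is merely absolutely
  continuous, this is derived from superlinear bounds on increments instead of derivatives.\<close>

lemma cos_along_characteristic:
  fixes l0 c0 :: real
  defines "l \<equiv> \<lambda>u. l0 * exp (\<theta> * (u - r))"
  defines "c \<equiv> \<lambda>u. c0 + (LINT v:{r..u}|lborel. - l v * a v)"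
  shows "exp (1/2 * b\<^sup>2 * (l t)\<^sup>2 * exp_integral \<theta> (t - r)) * F t (l t) (c t) = F r l0 c0"
proof -
  \<comment> \<open>The integrating factor is \<open>exp (w u)\<close>. The derivative of
    \<open>w\<close> is simply \<open>1/2 * b\<^sup>2 * (l u)\<^sup>2\<close>, because
    \<open>2 * \<theta> * exp_integral \<theta> h\<close> and
    \<open>exp (- 2 * \<theta> * h)\<close> add up to one.\<close>
  define w where "w u = 1/2 * b\<^sup>2 * (l u)\<^sup>2 * exp_integral \<theta> (u - r)" for u
  have l_cont: "continuous_on S l" for S unfolding l_def by (intro continuous_intros)
  have l_prim: "primitive_on r t l (\<lambda>u. \<theta> * l u)"
    by (rule primitive_on_C1[OF rt]) (auto simp: l_def intro!: derivative_eq_intros continuous_intros)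
  have c_prim: "primitive_on r t c (\<lambda>u. - l u * a u)"
    unfolding c_def
    by (intro primitive_on_indefinite control_integrable_mult continuous_intros l_cont) auto
  have w_deriv: "(w has_real_derivative 1/2 * b\<^sup>2 * (l u)\<^sup>2) (at u within X)" for u X
  proof -
    have e: "exp (- (2 * \<theta> * (u - r))) * (exp (\<theta> * (u - r)))\<^sup>2 = 1"
      by (simp add: power2_eq_square flip: exp_add)
    have "(w has_real_derivative 1/2 * b\<^sup>2 * ((2 * \<theta> * exp_integral \<theta> (u - r)) * (l u)\<^sup>2 
        + exp (- 2 * \<theta> * (u - r)) * (l u)\<^sup>2)) (at u within X)"
      unfolding w_def l_def by (auto intro!: derivative_eq_intros simp: power2_eq_square algebra_simps)
    also have "(2 * \<theta> * exp_integral \<theta> (u - r)) * (l u)\<^sup>2 + exp (- 2 * \<theta> * (u - r)) * (l u)\<^sup>2 = (l u)\<^sup>2"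
      unfolding exp_integral_eq by (simp add: algebra_simps)
    finally show ?thesis .
  qed
  have w_prim: "primitive_on r t w (\<lambda>u. 1/2 * b\<^sup>2 * (l u)\<^sup>2)"
    by (rule primitive_on_C1[OF rt w_deriv]) (intro continuous_intros l_cont)
  have w_mono: "w u \<le> w v" if "u \<le> v" for u v
    by (rule DERIV_nonneg_imp_nondecreasing[OF that]) (rule exI, rule conjI, rule w_deriv, simp)
  obtain B where B: "B \<ge> 1" "\<And>u. u \<in> {r..t} \<Longrightarrow> (\<integral>x. 1 + x\<^sup>2 \<partial>\<mu> u) \<le> B"
    using second_moment_bound by blast
  obtain L where L: "L \<ge> 0" "\<And>u. u \<in> {r..t} \<Longrightarrow> \<bar>l u\<bar> \<le> L"
  proof -
    obtain L where "\<And>u. u \<in> {r..t} \<Longrightarrow> \<bar>l u\<bar> \<le> L"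
      using compact_imp_bounded[OF compact_continuous_image[OF l_cont compact_Icc]]
      by (force simp: bounded_iff)
    moreover from this[of r] rt have "L \<ge> 0" by force
    ultimately show ?thesis using that by blast
  qed
  have A_mono: "A u \<le> A v" if "r \<le> u" "u \<le> v" "v \<le> t" for u v
    using A_increment(1)[OF that] that by linarith
  \<comment> \<open>A single constant above all bounds that occur. Since \<open>1 \<le> N\<close>,
    powers of it can be compared and collected.\<close>
  define N where "N = 1 + B + (L + 1) + \<bar>\<theta>\<bar> + b\<^sup>2 + (\<bar>\<theta>\<bar> * (L + 1) * B + (L + 1) + b\<^sup>2 * (L + 1)\<^sup>2)
     + (A t - A r) + \<bar>w t\<bar>"
  have At: "A r \<le> A t" using A_mono[of r t] rt by simp
  have N: "1 \<le> N" "B \<le> N" "L + 1 \<le> N" "\<bar>\<theta>\<bar> \<le> N" "b\<^sup>2 \<le> N"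
    "\<bar>\<theta>\<bar> * (L + 1) * B + (L + 1) + b\<^sup>2 * (L + 1)\<^sup>2 \<le> N" "A t - A r \<le> N" "w t \<le> N"
  proof -
    have "0 \<le> \<bar>\<theta>\<bar> * (L + 1) * B" "0 \<le> b\<^sup>2 * (L + 1)\<^sup>2" using B(1) L(1) by auto
    moreover note zero_le_power2[of b] abs_ge_zero[of \<theta>] abs_ge_self[of "w t"] abs_ge_zero[of "w t"] At B(1) L(1)
    ultimately show "1 \<le> N" "B \<le> N" "L + 1 \<le> N" "\<bar>\<theta>\<bar> \<le> N" "b\<^sup>2 \<le> N"
    "\<bar>\<theta>\<bar> * (L + 1) * B + (L + 1) + b\<^sup>2 * (L + 1)\<^sup>2 \<le> N" "A t - A r \<le> N" "w t \<le> N"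
      unfolding N_def by linarith+
  qed
  have bF: "\<bar>F u k d\<bar> \<le> 1" "\<bar>Q u k d\<bar> \<le> 1" "\<bar>P u k d\<bar> \<le> B" if u: "u \<in> {r..t}" for u k d
  proof -
    interpret prob_space "\<mu> u" by (rule prob[OF u])
    have "\<bar>F u k d\<bar> \<le> (\<integral>x. \<bar>cos (k * x + d)\<bar> \<partial>\<mu> u)" unfolding F_def by simp
    also have "\<dots> \<le> (\<integral>x. 1 \<partial>\<mu> u)" using integrable_trig[OF u] by (intro integral_mono) auto
    finally show "\<bar>F u k d\<bar> \<le> 1" using prob_space by simp
    have "\<bar>Q u k d\<bar> \<le> (\<integral>x. \<bar>sin (k * x + d)\<bar> \<partial>\<mu> u)" unfolding Q_def by simp
    also have "\<dots> \<le> (\<integral>x. 1 \<partial>\<mu> u)" using integrable_trig[OF u] by (intro integral_mono) auto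
    finally show "\<bar>Q u k d\<bar> \<le> 1" using prob_space by simp
    have "\<bar>x * sin (k * x + d)\<bar> \<le> 1 * (1 + x\<^sup>2)" for x
      using mult_left_mono[OF abs_sin_le_one[of "k * x + d"], of "\<bar>x\<bar>"] abs_le_1_plus_square[of x]
      by (simp add: abs_mult)
    from integral_quadratic_bound[OF u _ this B(2)[OF u]]
    show "\<bar>P u k d\<bar> \<le> B" unfolding P_def by simp
  qed
  have dF_int: "set_integrable lborel {u..v} (\<lambda>x. dF x k d)" if "r \<le> u" "v \<le> t" for u v k d
    by (rule set_integrable_Icc_subset[OF primitive_on_integrable[OF F_primitive] that])
  \<comment> \<open>At fixed frequency and phase the transform is Lipschitz in the clock. The range
    \<open>L + 1\<close> leaves room for the shifted frequency \<open>k + h\<close> in the estimate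
    of \<open>P\<close>.\<close>
  have incF: "\<bar>F v k d - F u k d\<bar> \<le> N * (A v - A u)"
    if uv: "r \<le> u" "u \<le> v" "v \<le> t" and k: "\<bar>k\<bar> \<le> L + 1" for u v k d
  proof -
    have "\<bar>dF x k d\<bar> \<le> N * (1 + \<bar>a x\<bar>)" if x: "x \<in> {u..v}" for x
    proof -
      have x': "x \<in> {r..t}" using x uv by auto
      have 1: "\<bar>\<theta> * k * P x k d\<bar> \<le> \<bar>\<theta>\<bar> * (L + 1) * B"
        unfolding abs_mult using bF[OF x'] k L(1) B(1) by (intro mult_mono) auto
      have 2: "\<bar>a x * k * Q x k d\<bar> \<le> \<bar>a x\<bar> * (L + 1) * 1"
        unfolding abs_mult using bF[OF x'] k L(1) by (intro mult_mono) auto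
      have 3: "\<bar>1/2 * b\<^sup>2 * k\<^sup>2 * F x k d\<bar> \<le> b\<^sup>2 * (L + 1)\<^sup>2 * 1"
      proof -
        have "k\<^sup>2 \<le> (L + 1)\<^sup>2" using k power_mono[OF k, of 2] by simp
        moreover have "\<bar>1/2 * b\<^sup>2 * k\<^sup>2 * F x k d\<bar> = (1/2 * b\<^sup>2) * k\<^sup>2 * \<bar>F x k d\<bar>" by (simp add: abs_mult)
        moreover have "(1/2 * b\<^sup>2) * k\<^sup>2 * \<bar>F x k d\<bar> \<le> b\<^sup>2 * (L + 1)\<^sup>2 * 1"
          using bF(1)[OF x'] calculation(1) by (intro mult_mono) auto
        ultimately show ?thesis by linarith
      qed
      have "\<bar>dF x k d\<bar> \<le> \<bar>\<theta> * k * P x k d\<bar> + \<bar>a x * k * Q x k d\<bar> + \<bar>1/2 * b\<^sup>2 * k\<^sup>2 * F x k d\<bar>"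
        unfolding dF_def by linarith
      also have "\<dots> \<le> (\<bar>\<theta>\<bar> * (L + 1) * B + (L + 1) + b\<^sup>2 * (L + 1)\<^sup>2) + (L + 1) * \<bar>a x\<bar>"
        using 1 2 3 L(1) by (simp add: mult.commute)
      also have "\<dots> \<le> N + N * \<bar>a x\<bar>"
        using N by (intro add_mono mult_right_mono) auto
      finally show ?thesis by (simp add: algebra_simps)
    qed
    from A_increment(2)[OF uv dF_int[OF uv(1,3)] this]
    show ?thesis using primitive_on_diff[OF F_primitive uv] by simp
  qed
  have sqN: "A v - A u \<le> N * sqrt (A v - A u)" "0 \<le> A v - A u" "A v - A u \<le> N"
    if uv: "r \<le> u" "u \<le> v" "v \<le> t" for u v
  proof -
    show D: "0 \<le> A v - A u" "A v - A u \<le> N" using A_mono[of u v] A_mono[of r u] A_mono[of v t] uv N(7) by auto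
    have "sqrt (A v - A u) \<le> sqrt (N * N)"
      using D N(1) mult_mono[of 1 N "A v - A u" N] by (intro real_sqrt_le_mono) auto
    hence "sqrt (A v - A u) \<le> N" using N(1) by simp
    hence "sqrt (A v - A u) * sqrt (A v - A u) \<le> N * sqrt (A v - A u)" by (intro mult_right_mono) (use D in auto)
    thus "A v - A u \<le> N * sqrt (A v - A u)" using D by simp
  qed
  \<comment> \<open>\<open>P\<close> is replaced by a difference quotient of \<open>F\<close> in the
    frequency, with step \<open>h\<close>. The Taylor error is of order \<open>h\<close> and the
    increments of \<open>F\<close> contribute order \<open>?D / h\<close>; the choice
    \<open>h = sqrt ?D\<close> balances them. For \<open>?D > 1\<close> boundedness of
    \<open>P\<close> is enough.\<close>
  have incP: "\<bar>P v k d - P u k d\<bar> \<le> 4 * N * sqrt (A v - A u)"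
    if uv: "r \<le> u" "u < v" "v \<le> t" and k: "\<bar>k\<bar> \<le> L" for u v k d
  proof -
    let ?D = "A v - A u"
    have D: "?D > 0" using A_increment(1)[of u v] uv by auto
    show ?thesis
    proof (cases "?D \<le> 1")
      case False
      have "\<bar>P v k d - P u k d\<bar> \<le> 2 * N" using bF(3)[of u k d] bF(3)[of v k d] uv N(2) by auto
      also have "\<dots> \<le> 4 * N * 1" using N(1) by simp
      also have "\<dots> \<le> 4 * N * sqrt ?D" using N(1) False by (intro mult_left_mono) auto
      finally show ?thesis .
    next
      case True
      define h where "h = sqrt ?D"
      have h: "0 < h" "h \<le> 1" "h\<^sup>2 = ?D" using D True by (auto simp: h_def)
      have app: "\<bar>h * P s k d + (F s (k + h) d - F s k d)\<bar> \<le> h\<^sup>2 * N" if s: "s \<in> {r..t}" for s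
      proof -
        note [simp] = integrable_trig[OF s]
        have "h * P s k d + (F s (k + h) d - F s k d) =
          (\<integral>x. cos ((k + h) * x + d) - cos (k * x + d) + h * (x * sin (k * x + d)) \<partial>\<mu> s)"
          unfolding P_def F_def by simp
        also have "\<bar>\<dots>\<bar> \<le> h\<^sup>2 * B"
        proof (rule integral_quadratic_bound[OF s _ _ B(2)[OF s]])
          fix x
          have "\<bar>cos ((k * x + d) + h * x) - cos (k * x + d) + (h * x) * sin (k * x + d)\<bar> \<le> (h * x)\<^sup>2"
            by (rule cos_taylor)
          also have "\<dots> \<le> h\<^sup>2 * (1 + x\<^sup>2)" by (simp add: power_mult_distrib algebra_simps)
          finally show "\<bar>cos ((k + h) * x + d) - cos (k * x + d) + h * (x * sin (k * x + d))\<bar> \<le> h\<^sup>2 * (1 + x\<^sup>2)"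
            by (simp add: algebra_simps)
        qed auto
        also have "\<dots> \<le> h\<^sup>2 * N" using N(2) by (intro mult_left_mono) auto
        finally show ?thesis .
      qed
      have kh: "\<bar>k + h\<bar> \<le> L + 1" "\<bar>k\<bar> \<le> L + 1" using k h by auto
      have "\<bar>h * P v k d - h * P u k d\<bar> \<le> 2 * (h\<^sup>2 * N) + 2 * (N * ?D)"
        using app[of u] app[of v] incF[of u v "k + h" d] incF[of u v k d] uv kh by auto
      also have "\<dots> = h * (4 * N * h)" using h by (simp add: power2_eq_square)
      finally have "h * \<bar>P v k d - P u k d\<bar> \<le> h * (4 * N * h)"
        using h(1) by (simp add: abs_mult flip: right_diff_distrib)
      thus ?thesis using h(1) unfolding h_def by simp
    qed
  qed
  have incs: "\<bar>l v - l u\<bar> \<le> N\<^sup>2 * (A v - A u)" "\<bar>c v - c u\<bar> \<le> N * (A v - A u)" "\<bar>w v - w u\<bar> \<le> N^3 * (A v - A u)"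
    if uv: "r \<le> u" "u \<le> v" "v \<le> t" for u v
  proof -
    note sub = set_integrable_Icc_subset[OF primitive_on_integrable uv(1,3)]
    have "\<bar>\<theta> * l x\<bar> \<le> N\<^sup>2 * (1 + \<bar>a x\<bar>)" if "x \<in> {u..v}" for x
    proof -
      have "\<bar>\<theta>\<bar> * \<bar>l x\<bar> \<le> N * N" using N L(2)[of x] that uv by (intro mult_mono) auto
      also have "\<dots> \<le> N * N * (1 + \<bar>a x\<bar>)" using N(1) by (simp add: algebra_simps)
      finally show ?thesis by (simp add: abs_mult power2_eq_square)
    qed
    from A_increment(2)[OF uv sub[OF l_prim] this] show "\<bar>l v - l u\<bar> \<le> N\<^sup>2 * (A v - A u)"
      using primitive_on_diff[OF l_prim uv] by simp
    have "\<bar>- l x * a x\<bar> \<le> N * (1 + \<bar>a x\<bar>)" if "x \<in> {u..v}" for x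
    proof -
      have "\<bar>l x\<bar> * \<bar>a x\<bar> \<le> N * (1 + \<bar>a x\<bar>)" using N L(2)[of x] that uv by (intro mult_mono) auto
      thus ?thesis by (simp add: abs_mult)
    qed
    from A_increment(2)[OF uv sub[OF c_prim] this] show "\<bar>c v - c u\<bar> \<le> N * (A v - A u)"
      using primitive_on_diff[OF c_prim uv] by simp
    have "\<bar>1/2 * b\<^sup>2 * (l x)\<^sup>2\<bar> \<le> N^3 * (1 + \<bar>a x\<bar>)" if "x \<in> {u..v}" for x
    proof -
      have "\<bar>l x\<bar> * \<bar>l x\<bar> \<le> N * N" using N L(2)[of x] that uv by (intro mult_mono) auto
      hence "(1/2 * b\<^sup>2) * (l x)\<^sup>2 \<le> N * (N * N)"
        using N by (intro mult_mono) (auto simp: power2_eq_square)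
      also have "\<dots> \<le> N^3 * (1 + \<bar>a x\<bar>)" using N(1) by (simp add: algebra_simps power3_eq_cube)
      finally show ?thesis by (simp add: abs_mult)
    qed
    from A_increment(2)[OF uv sub[OF w_prim] this] show "\<bar>w v - w u\<bar> \<le> N^3 * (A v - A u)"
      using primitive_on_diff[OF w_prim uv] by simp
  qed
  define k where "k u = F u (l u) (c u)" for u
  \<comment> \<open>Up to an error of order 3/2 in the clock, \<open>k\<close> behaves like a
    solution of \<open>k' = - w' * k\<close>.\<close>
  have step: "\<bar>k v - k u + (w v - w u) * k u\<bar> \<le> (10 * N^5 + 4 * N^6) * (A v - A u) * sqrt (A v - A u)"
    if uv: "r \<le> u" "u < v" "v \<le> t" for u v
  proof -
    define D where "D = A v - A u"
    define q where "q = sqrt D"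
    note uv' = uv(1) less_imp_le[OF uv(2)] uv(3)
    have D: "0 \<le> D" "D \<le> N * q" "D = q * q" "0 \<le> q"
      using sqN[OF uv'] by (auto simp: D_def q_def)
    have Npow: "N^i \<le> N^j" if "i \<le> j" for i j by (rule power_increasing[OF that N(1)])
    have Dq: "N^i * D \<le> N^Suc i * q" for i
      using mult_left_mono[OF D(2), of "N^i"] N(1) by (simp add: mult_ac)
    \<comment> \<open>Frequency and phase move while time stands at \<open>v\<close>. The first
      order terms are removed, so the remainder is quadratic in the clock.\<close>
    define R where "R = F v (l v) (c v) - F v (l u) (c u)
       + (l v - l u) * P v (l u) (c u) + (c v - c u) * Q v (l u) (c u)"
    have R: "\<bar>R\<bar> \<le> 4 * N^6 * D * q"
    proof -
      have v: "v \<in> {r..t}" using uv by auto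
      note [simp] = integrable_trig[OF v]
      define X where "X = 2 * ((l v - l u)\<^sup>2 + (c v - c u)\<^sup>2)"
      have X0: "X \<ge> 0" by (simp add: X_def)
      have eq: "R = (\<integral>x. cos (l v * x + c v) - cos (l u * x + c u) + 
          ((l v - l u) * (x * sin (l u * x + c u)) + (c v - c u) * sin (l u * x + c u)) \<partial>\<mu> v)"
        unfolding R_def F_def P_def Q_def by simp
      have "\<bar>R\<bar> \<le> X * B" unfolding eq
      proof (rule integral_quadratic_bound[OF v _ _ B(2)[OF v] X0])
        fix x
        let ?h = "(l v - l u) * x + (c v - c u)"
        have "\<bar>cos ((l u * x + c u) + ?h) - cos (l u * x + c u) + ?h * sin (l u * x + c u)\<bar> \<le> ?h\<^sup>2"
          by (rule cos_taylor)
        also have "?h\<^sup>2 \<le> 2 * ((l v - l u) * x)\<^sup>2 + 2 * (c v - c u)\<^sup>2" 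
        proof -
          have "(y + z)\<^sup>2 \<le> 2 * y\<^sup>2 + 2 * z\<^sup>2" for y z :: real
            using zero_le_power2[of "y - z"] by (simp add: power2_eq_square algebra_simps)
          thus ?thesis .
        qed
        also have "\<dots> \<le> X * (1 + x\<^sup>2)"
        proof -
          have "2 * (y * x)\<^sup>2 + 2 * z\<^sup>2 \<le> 2 * (y\<^sup>2 + z\<^sup>2) * (1 + x\<^sup>2)" for y z :: real
            by (simp add: power_mult_distrib algebra_simps)
          thus ?thesis unfolding X_def .
        qed
        finally show "\<bar>cos (l v * x + c v) - cos (l u * x + c u) + 
          ((l v - l u) * (x * sin (l u * x + c u)) + (c v - c u) * sin (l u * x + c u))\<bar> \<le> X * (1 + x\<^sup>2)"
          by (simp add: algebra_simps)
      qed auto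
      also have "\<dots> \<le> X * N" using N(2) X0 by (intro mult_left_mono)
      also have "\<dots> \<le> (2 * ((N\<^sup>2 * D)\<^sup>2 + (N * D)\<^sup>2)) * N"
        using incs(1,2)[OF uv'] N(1) unfolding X_def D_def[symmetric]
        by (intro mult_right_mono mult_left_mono add_mono) 
          (auto simp: abs_le_square_iff[symmetric] intro: order_trans[OF _ abs_ge_self])
      also have "\<dots> = 2 * (N^5 + N^3) * D\<^sup>2" by (simp add: algebra_simps eval_nat_numeral)
      also have "\<dots> \<le> 2 * (N^5 + N^5) * D\<^sup>2" using Npow[of 3 5] by (intro mult_right_mono) auto
      also have "\<dots> = 4 * D * (N^5 * D)" by (simp add: power2_eq_square)
      also have "\<dots> \<le> 4 * D * (N^Suc 5 * q)" using Dq[of 5] D by (intro mult_left_mono) auto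
      finally show ?thesis by (simp add: mult_ac)
    qed
    \<comment> \<open>Time moves at frozen frequency and phase, and the first order terms split off
      from \<open>R\<close> are added. The equations for \<open>l\<close>, \<open>c\<close> and
      \<open>w\<close> make everything cancel except the errors of evaluating at \<open>x\<close> in
      place of \<open>u\<close> or \<open>v\<close>; the one in \<open>P\<close> is the worst, of
      order 1/2.\<close>
    define G where "G x = dF x (l u) (c u) - P v (l u) (c u) * (\<theta> * l x) + Q v (l u) (c u) * (l x * a x)
       + k u * (1/2 * b\<^sup>2 * (l x)\<^sup>2)" for x
    note sub = set_integrable_Icc_subset[OF primitive_on_integrable uv(1,3)]
    note ints = sub[OF F_primitive[of "l u" "c u"]] sub[OF l_prim] sub[OF c_prim] sub[OF w_prim]
    have la: "set_integrable lborel {u..v} (\<lambda>x. l x * a x)"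
      using control_integrable_mult[OF l_cont uv(1,3)] .
    have G_int: "set_integrable lborel {u..v} G"
      unfolding G_def using ints la by (intro set_integral_add set_integral_diff set_integrable_mult_right) auto
    have "(LINT x:{u..v}|lborel. G x) = (F v (l u) (c u) - F u (l u) (c u)) - P v (l u) (c u) * (l v - l u)
        - Q v (l u) (c u) * (c v - c u) + k u * (w v - w u)"
    proof -
      have "(LINT x:{u..v}|lborel. l x * a x) = - (c v - c u)"
        unfolding primitive_on_diff[OF c_prim uv'] using set_integral_uminus[OF la] by simp
      moreover have "(LINT x:{u..v}|lborel. f1 x - C2 * f2 x + C3 * f3 x + C4 * f4 x) =
          (LINT x:{u..v}|lborel. f1 x) - C2 * (LINT x:{u..v}|lborel. f2 x)
          + C3 * (LINT x:{u..v}|lborel. f3 x) + C4 * (LINT x:{u..v}|lborel. f4 x)"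
        if "set_integrable lborel {u..v} f1" "set_integrable lborel {u..v} f2"
          "set_integrable lborel {u..v} f3" "set_integrable lborel {u..v} f4"
        for f1 f2 f3 f4 :: "real \<Rightarrow> real" and C2 C3 C4
        using that by (simp add: set_integral_add set_integral_diff set_integrable_mult_right)
      note this[OF ints(1,2) la ints(4)]
      ultimately show ?thesis
        unfolding G_def primitive_on_diff[OF F_primitive uv', symmetric]
          primitive_on_diff[OF l_prim uv', symmetric] primitive_on_diff[OF w_prim uv', symmetric]
        by (simp add: right_diff_distrib)
    qed
    hence eq: "k v - k u + (w v - w u) * k u = R + (LINT x:{u..v}|lborel. G x)"
      by (simp add: R_def k_def algebra_simps)
    have "\<bar>G x\<bar> \<le> (10 * N^5 * q) * (1 + \<bar>a x\<bar>)" if x: "x \<in> {u..v}" for x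
    proof -
      have ux: "r \<le> u" "u \<le> x" "x \<le> t" and xv: "r \<le> x" "x \<le> v" "v \<le> t"
        and mem: "u \<in> {r..t}" "x \<in> {r..t}" "v \<in> {r..t}" using x uv by auto
      have Dx: "A x - A u \<le> D" "A v - A x \<le> D"
        using A_mono[of x v] A_mono[of u x] ux xv by (auto simp: D_def)
      have lx: "\<bar>l x - l u\<bar> \<le> N\<^sup>2 * D"
        using order_trans[OF incs(1)[OF ux] mult_left_mono[OF Dx(1)]] N(1) by simp
      have Lu: "\<bar>l u\<bar> \<le> L + 1" "\<bar>l u\<bar> \<le> L" "\<bar>l u\<bar> \<le> N" "\<bar>l x\<bar> \<le> N" 
        using L(2)[OF mem(1)] L(2)[OF mem(2)] N by auto
      have Px: "\<bar>P x (l u) (c u) - P v (l u) (c u)\<bar> \<le> 4 * N * q"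
      proof (cases "x = v")
        case False
        hence "\<bar>P v (l u) (c u) - P x (l u) (c u)\<bar> \<le> 4 * N * sqrt (A v - A x)"
          using incP[OF xv(1) _ xv(3) Lu(2)] xv by auto
        also have "\<dots> \<le> 4 * N * q" using N(1) Dx by (intro mult_left_mono) (auto simp: q_def)
        finally show ?thesis by linarith
      qed (use N(1) D in auto)
      have Qx: "\<bar>Q v (l u) (c u) - Q x (l u) (c u)\<bar> \<le> N * D"
      proof -
        \<comment> \<open>The sine is the cosine with shifted phase, so the Lipschitz bound for
          \<open>F\<close> serves for \<open>Q\<close>.\<close>
        have "Q s k d = F s k (d - pi/2)" for s k d
          unfolding Q_def F_def by (simp add: cos_diff add_diff_eq)
        hence "\<bar>Q v (l u) (c u) - Q x (l u) (c u)\<bar> \<le> N * (A v - A x)"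
          using incF[OF xv Lu(1)] by simp
        also have "\<dots> \<le> N * D" using Dx N(1) by (intro mult_left_mono) auto
        finally show ?thesis .
      qed
      have Fx: "\<bar>F u (l u) (c u) - F x (l u) (c u)\<bar> \<le> N * D"
      proof -
        have "\<bar>F x (l u) (c u) - F u (l u) (c u)\<bar> \<le> N * (A x - A u)" by (rule incF[OF ux Lu(1)])
        also have "\<dots> \<le> N * D" using Dx N(1) by (intro mult_left_mono) auto
        finally show ?thesis by linarith
      qed
      have t1: "\<bar>\<theta> * (l u * P x (l u) (c u) - l x * P v (l u) (c u))\<bar> \<le> 5 * N^5 * q"
      proof -
        have "\<bar>l u * P x (l u) (c u) - l x * P v (l u) (c u)\<bar> 
           = \<bar>(l u - l x) * P x (l u) (c u) + l x * (P x (l u) (c u) - P v (l u) (c u))\<bar>"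
          by (simp add: algebra_simps)
        also have "\<dots> \<le> \<bar>l u - l x\<bar> * \<bar>P x (l u) (c u)\<bar> + \<bar>l x\<bar> * \<bar>P x (l u) (c u) - P v (l u) (c u)\<bar>"
          by (metis abs_mult abs_triangle_ineq)
        also have "\<dots> \<le> (N\<^sup>2 * D) * N + N * (4 * N * q)"
        proof -
          have "\<bar>P x (l u) (c u)\<bar> \<le> N" "\<bar>l u - l x\<bar> \<le> N\<^sup>2 * D"
            using bF(3)[OF mem(2), of "l u" "c u"] N(2) lx by linarith+
          thus ?thesis using N(1) D(1,4) by (intro add_mono mult_mono Lu(4) Px; simp)
        qed
        also have "\<dots> = N^3 * D + 4 * N^2 * q" by (simp add: eval_nat_numeral)
        also have "\<dots> \<le> N^4 * q + 4 * N^4 * q"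
          using Dq[of 3] Npow[of 2 4] D by (intro add_mono mult_right_mono) auto
        finally have 1: "\<bar>l u * P x (l u) (c u) - l x * P v (l u) (c u)\<bar> \<le> 5 * N^4 * q" by (simp add: mult_ac)
        have "\<bar>\<theta> * (l u * P x (l u) (c u) - l x * P v (l u) (c u))\<bar> \<le> N * (5 * N^4 * q)"
          unfolding abs_mult[of \<theta>] using N 1 by (intro mult_mono) auto
        thus ?thesis by (simp add: eval_nat_numeral mult_ac)
      qed
      have t2: "\<bar>a x * (l x * Q v (l u) (c u) - l u * Q x (l u) (c u))\<bar> \<le> 2 * N^5 * q * \<bar>a x\<bar>"
      proof -
        have "\<bar>l x * Q v (l u) (c u) - l u * Q x (l u) (c u)\<bar> 
           = \<bar>(l x - l u) * Q v (l u) (c u) + l u * (Q v (l u) (c u) - Q x (l u) (c u))\<bar>"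
          by (simp add: algebra_simps)
        also have "\<dots> \<le> \<bar>l x - l u\<bar> * \<bar>Q v (l u) (c u)\<bar> + \<bar>l u\<bar> * \<bar>Q v (l u) (c u) - Q x (l u) (c u)\<bar>"
          by (metis abs_mult abs_triangle_ineq)
        also have "\<dots> \<le> (N\<^sup>2 * D) * 1 + N * (N * D)"
          using N(1) D(1) bF(2)[OF mem(3), of "l u" "c u"] by (intro add_mono mult_mono lx Lu(3) Qx; simp)
        also have "\<dots> = 2 * (N^2 * D)" by (simp add: eval_nat_numeral)
        also have "\<dots> \<le> 2 * (N^3 * q)" using Dq[of 2] by simp
        also have "\<dots> \<le> 2 * N^5 * q" using Npow[of 3 5] D by (simp add: mult_right_mono)
        finally have 1: "\<bar>l x * Q v (l u) (c u) - l u * Q x (l u) (c u)\<bar> \<le> 2 * N^5 * q" .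
        show ?thesis unfolding abs_mult[of "a x"] mult.commute[of "\<bar>a x\<bar>"] using 1 by (intro mult_right_mono) auto
      qed
      have t3: "\<bar>1/2 * b\<^sup>2 * ((l x)\<^sup>2 * F u (l u) (c u) - (l u)\<^sup>2 * F x (l u) (c u))\<bar> \<le> 3 * N^5 * q"
      proof -
        have sq: "\<bar>(l x)\<^sup>2 - (l u)\<^sup>2\<bar> \<le> 2 * N * (N\<^sup>2 * D)"
        proof -
          have "(l x)\<^sup>2 - (l u)\<^sup>2 = (l x + l u) * (l x - l u)" by (simp add: power2_eq_square algebra_simps)
          moreover have "\<bar>l x + l u\<bar> * \<bar>l x - l u\<bar> \<le> (2 * N) * (N\<^sup>2 * D)"
            using lx Lu N(1) by (intro mult_mono) auto
          ultimately show ?thesis by (simp add: abs_mult)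
        qed
        have "(l u)\<^sup>2 \<le> N\<^sup>2" using Lu(3) N(1) abs_le_square_iff[of "l u" N] by auto
        have "\<bar>(l x)\<^sup>2 * F u (l u) (c u) - (l u)\<^sup>2 * F x (l u) (c u)\<bar> 
           = \<bar>((l x)\<^sup>2 - (l u)\<^sup>2) * F u (l u) (c u) + (l u)\<^sup>2 * (F u (l u) (c u) - F x (l u) (c u))\<bar>"
          by (simp add: algebra_simps)
        also have "\<dots> \<le> \<bar>(l x)\<^sup>2 - (l u)\<^sup>2\<bar> * \<bar>F u (l u) (c u)\<bar> + (l u)\<^sup>2 * \<bar>F u (l u) (c u) - F x (l u) (c u)\<bar>"
          by (metis abs_mult abs_triangle_ineq abs_power2)
        also have "\<dots> \<le> (2 * N * (N\<^sup>2 * D)) * 1 + N\<^sup>2 * (N * D)"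
          using N(1) D(1) bF(1)[OF mem(1), of "l u" "c u"]
          by (intro add_mono mult_mono sq Fx \<open>(l u)\<^sup>2 \<le> N\<^sup>2\<close>; simp)
        also have "\<dots> = 3 * (N^3 * D)" by (simp add: eval_nat_numeral)
        also have "\<dots> \<le> 3 * N^4 * q" using Dq[of 3] by simp
        finally have 1: "\<bar>(l x)\<^sup>2 * F u (l u) (c u) - (l u)\<^sup>2 * F x (l u) (c u)\<bar> \<le> 3 * N^4 * q" .
        have "\<bar>1/2 * b\<^sup>2 * ((l x)\<^sup>2 * F u (l u) (c u) - (l u)\<^sup>2 * F x (l u) (c u))\<bar> \<le> N * (3 * N^4 * q)"
          unfolding abs_mult[of "1/2 * b\<^sup>2"] using N 1 by (intro mult_mono) auto
        thus ?thesis by (simp add: eval_nat_numeral mult_ac)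
      qed
      have "G x = \<theta> * (l u * P x (l u) (c u) - l x * P v (l u) (c u))
        + a x * (l x * Q v (l u) (c u) - l u * Q x (l u) (c u))
        + 1/2 * b\<^sup>2 * ((l x)\<^sup>2 * F u (l u) (c u) - (l u)\<^sup>2 * F x (l u) (c u))"
        by (simp add: G_def dF_def k_def algebra_simps)
      hence "\<bar>G x\<bar> \<le> 5 * N^5 * q + 2 * N^5 * q * \<bar>a x\<bar> + 3 * N^5 * q"
        using t1 t2 t3 by linarith
      also have "\<dots> \<le> (10 * N^5 * q) * (1 + \<bar>a x\<bar>)"
      proof -
        have "0 \<le> N^5 * q" "0 \<le> N^5 * q * \<bar>a x\<bar>" using N(1) D by auto
        thus ?thesis by (simp add: algebra_simps)
      qed
      finally show ?thesis .
    qed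
    from A_increment(2)[OF uv' G_int this]
    have "\<bar>LINT x:{u..v}|lborel. G x\<bar> \<le> 10 * N^5 * q * D" unfolding D_def .
    hence "\<bar>k v - k u + (w v - w u) * k u\<bar> \<le> 4 * N^6 * D * q + 10 * N^5 * q * D"
      unfolding eq using R by linarith
    thus ?thesis unfolding D_def[symmetric] q_def[symmetric] by (simp add: algebra_simps)
  qed
  define K where "K = exp N * (10 * N^5 + 4 * N^6 + N^7)"
  have "exp (w t) * k t = exp (w r) * k r"
  proof (rule constant_if_superlinear_increments[where A = A and K = K, OF rt primitive_on_continuous[OF A_primitive]])
    fix u v assume mem: "u \<in> {r..t}" "v \<in> {r..t}" "u \<le> v"
    show "\<bar>exp (w v) * k v - exp (w u) * k u\<bar> \<le> K * \<bar>A v - A u\<bar> * sqrt \<bar>A v - A u\<bar>"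
    proof (cases "u = v")
      case False
      hence uv: "r \<le> u" "u < v" "v \<le> t" and uv': "r \<le> u" "u \<le> v" "v \<le> t" using mem by auto
      define D where "D = A v - A u"
      define h where "h = w v - w u"
      have D: "0 \<le> D" "D \<le> N * sqrt D" using sqN[OF uv'] by (auto simp: D_def)
      have h: "0 \<le> h" "h \<le> N^3 * D" using w_mono[of u v] incs(3)[OF uv'] uv' by (auto simp: h_def D_def)
      \<comment> \<open>Replacing \<open>h\<close> by \<open>1 - exp (- h)\<close> costs only second
        order and turns the relation between increments of \<open>k\<close> and \<open>w\<close>
        into one for the product \<open>exp (w u) * k u\<close>.\<close>
      have e: "\<bar>1 - exp (- h) - h\<bar> \<le> h\<^sup>2"
      proof -
        have 1: "1 - h \<le> exp (- h)" using exp_ge_add_one_self[of "- h"] by simp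
        have "exp (- h) \<le> 1 / (1 + h)"
          using exp_ge_add_one_self[of h] h(1) by (simp add: exp_minus field_simps)
        also have "\<dots> \<le> 1 - h + h\<^sup>2"
          using h(1) by (simp add: divide_simps power2_eq_square) (simp add: algebra_simps)
        finally show ?thesis using 1 by linarith
      qed
      have h2: "h\<^sup>2 \<le> N^7 * D * sqrt D"
      proof -
        have "h * h \<le> (N^3 * D) * (N^3 * D)" using h D N(1) by (intro mult_mono) auto
        also have "\<dots> = N^6 * D * D" by (simp add: eval_nat_numeral)
        also have "\<dots> \<le> N^6 * D * (N * sqrt D)" using D N(1) by (intro mult_left_mono) auto
        finally show ?thesis by (simp add: eval_nat_numeral mult_ac)
      qed
      have ku: "\<bar>k u\<bar> \<le> 1" using bF(1)[OF mem(1)] by (simp add: k_def)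
      have "exp (w v) * k v - exp (w u) * k u = exp (w v) * (k v - k u + (1 - exp (- h)) * k u)"
        by (simp add: h_def algebra_simps exp_diff exp_minus)
      also have "\<bar>\<dots>\<bar> = exp (w v) * \<bar>(k v - k u + h * k u) + (1 - exp (- h) - h) * k u\<bar>"
      proof -
        have "k v - k u + (1 - exp (- h)) * k u = (k v - k u + h * k u) + (1 - exp (- h) - h) * k u"
          by (simp add: algebra_simps)
        thus ?thesis by (simp only: abs_mult abs_exp_cancel)
      qed
      also have "\<dots> \<le> exp N * ((10 * N^5 + 4 * N^6) * D * sqrt D + N^7 * D * sqrt D)"
      proof (intro mult_mono)
        show "exp (w v) \<le> exp N" using w_mono[of v t] N(8) uv by simp
        have "\<bar>(1 - exp (- h) - h) * k u\<bar> \<le> h\<^sup>2 * 1"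
          unfolding abs_mult using e ku by (intro mult_mono) auto
        thus "\<bar>(k v - k u + h * k u) + (1 - exp (- h) - h) * k u\<bar> 
           \<le> (10 * N^5 + 4 * N^6) * D * sqrt D + N^7 * D * sqrt D"
          using step[OF uv] h2 unfolding D_def[symmetric] h_def[symmetric] by linarith
      qed auto
      also have "\<dots> = K * \<bar>D\<bar> * sqrt \<bar>D\<bar>" using D by (simp add: K_def algebra_simps)
      finally show ?thesis unfolding D_def .
    qed simp
  qed
  moreover have "w r = 0" "l r = l0" by (simp_all add: w_def l_def)
  moreover have "c r = c0" unfolding c_def set_integral_Icc_refl by simp
  ultimately show ?thesis unfolding w_def k_def by simp
qed

text \<open>The characteristic is followed backwards: \<open>l0\<close> and \<open>c0\<close> are
  chosen so that it ends in the prescribed pair \<open>(u, d)\<close> at time \<open>t\<close>. The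
  transform of the initial Gaussian law and the integrating factor then combine to the transform of
  the claimed law.\<close>

lemma gaussian_preserved:
  assumes z: "z > 0" and init: "\<mu> r = gaussian m z"
  shows "\<mu> t = gaussian (exp (- \<theta> * (t - r)) * m + (LINT v:{r..t}|lborel. exp (- \<theta> * (t - v)) * a v))
    (ou_variance \<theta> b (t - r) z)"
proof (rule gaussian_eqI)
  have t: "t \<in> {r..t}" using rt by simp
  show "prob_space (\<mu> t)" "sets (\<mu> t) = sets borel" using prob sets_mu t by auto
  show "ou_variance \<theta> b (t - r) z > 0" using z rt by (intro ou_variance_pos) auto
  fix u d
  let ?m = "LINT v:{r..t}|lborel. exp (- \<theta> * (t - v)) * a v"
  define l0 where "l0 = u * exp (- \<theta> * (t - r))"
  have l: "l0 * exp (\<theta> * (v - r)) = u * exp (- \<theta> * (t - v))" for v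
    by (simp add: l0_def algebra_simps flip: exp_add)
  define c0 where "c0 = d + u * ?m"
  have c: "c0 + (LINT v:{r..t}|lborel. - (l0 * exp (\<theta> * (v - r))) * a v) = d"
  proof -
    have "(LINT v:{r..t}|lborel. - (l0 * exp (\<theta> * (v - r))) * a v) =
      (LINT v:{r..t}|lborel. (- u) * (exp (- \<theta> * (t - v)) * a v))"
      unfolding l by (simp add: mult.assoc)
    also have "\<dots> = - u * ?m" by (rule set_integral_mult_right)
    finally show ?thesis by (simp add: c0_def)
  qed
  have "exp (1/2 * b\<^sup>2 * u\<^sup>2 * exp_integral \<theta> (t - r)) * F t u d = F r l0 c0"
    using cos_along_characteristic[of l0 c0] unfolding c unfolding l by simp
  also have "F r l0 c0 = exp (- (l0\<^sup>2 * z) / 2) * cos (l0 * m + c0)"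
    unfolding F_def init by (rule gaussian_cos[OF z])
  also have "exp (- (l0\<^sup>2 * z) / 2) = exp (1/2 * b\<^sup>2 * u\<^sup>2 * exp_integral \<theta> (t - r)) *
     exp (- (u\<^sup>2 * ou_variance \<theta> b (t - r) z) / 2)"
  proof -
    have "l0\<^sup>2 = u\<^sup>2 * exp (- 2 * \<theta> * (t - r))"
      by (simp add: l0_def power_mult_distrib power2_eq_square algebra_simps flip: exp_add)
    thus ?thesis unfolding exp_add[symmetric] ou_variance_def by (simp add: field_simps)
  qed
  finally have "F t u d = exp (- (u\<^sup>2 * ou_variance \<theta> b (t - r) z) / 2) * cos (l0 * m + c0)"
    by simp
  thus "(\<integral>x. cos (u * x + d) \<partial>\<mu> t) = exp (- (u\<^sup>2 * ou_variance \<theta> b (t - r) z) / 2) * 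
     cos (u * (exp (- \<theta> * (t - r)) * m + ?m) + d)"
    by (simp add: F_def l0_def c0_def algebra_simps)
qed

end

section \<open>Gaussian solutions of the weak evolution\<close>

lemma tendsto_gaussian_tail:
  assumes "filterlim (\<lambda>w::real. w\<^sup>2 / 2) at_top G"
  shows "((\<lambda>w. (1 + w\<^sup>2) * std_normal_density w) \<longlongrightarrow> 0) G"
proof -
  have "((\<lambda>y::real. y ^ 0 / exp y + 2 * (y ^ 1 / exp y)) \<longlongrightarrow> 0 + 2 * 0) at_top"
    by (intro tendsto_add tendsto_mult tendsto_const tendsto_power_div_exp_0)
  from tendsto_mult[OF tendsto_const[of "1 / sqrt (2 * pi)"] filterlim_compose[OF this assms]]
  show ?thesis by (simp add: std_normal_density_def exp_minus field_simps)
qed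

lemma filterlim_half_square: "filterlim (\<lambda>w::real. w\<^sup>2 / 2) at_top at_top" "filterlim (\<lambda>w::real. w\<^sup>2 / 2) at_top at_bot"
proof -
  show 1: "filterlim (\<lambda>w::real. w\<^sup>2 / 2) at_top at_top"
    by (rule filterlim_at_top_mono[OF filterlim_ident])
      (use eventually_ge_at_top[of 2] in \<open>eventually_elim, simp add: power2_eq_square\<close>)
  have "filterlim (\<lambda>w::real. (- w)\<^sup>2 / 2) at_top at_bot"
    by (rule filterlim_compose[OF 1 filterlim_uminus_at_top_at_bot])
  thus "filterlim (\<lambda>w::real. w\<^sup>2 / 2) at_top at_bot" by simp
qed

lemma std_gaussian_integrable_quadratic:
  fixes f :: "real \<Rightarrow> real"
  assumes "f \<in> borel_measurable borel" "\<And>x. \<bar>f x\<bar> \<le> K * (1 + x\<^sup>2)"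
  shows "integrable (gaussian 0 1) f"
proof -
  interpret prob_space "gaussian 0 1" by (rule prob_space_gaussian) simp
  show ?thesis
  proof (rule Bochner_Integration.integrable_bound)
    show "integrable (gaussian 0 1) (\<lambda>x. K * (1 + x\<^sup>2))" using std_gaussian_moments by simp
    show "AE x in gaussian 0 1. norm (f x) \<le> norm (K * (1 + x\<^sup>2))"
    proof (rule AE_I2)
      fix x show "norm (f x) \<le> norm (K * (1 + x\<^sup>2))"
        using order_trans[OF assms(2)[of x] abs_ge_self] by simp
    qed
  qed (use assms in simp)
qed

text \<open>Applied with exponent \<open>0\<close> to functions with bounded derivative, and with
  exponent \<open>1\<close> to test functions, whose derivative grows at most linearly.\<close>

lemma DERIV_linear_growth:
  fixes h h' :: "real \<Rightarrow> real"
  assumes "\<And>x. (h has_real_derivative h' x) (at x)" "\<And>x. \<bar>h' x\<bar> \<le> K * (1 + \<bar>x\<bar> ^ n)" "0 \<le> K"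
  shows "\<bar>h x - h 0\<bar> \<le> K * (1 + \<bar>x\<bar> ^ n) * \<bar>x\<bar>"
proof -
  have "norm (h x - h 0) \<le> (K * (1 + \<bar>x\<bar> ^ n)) * norm (x - 0)"
  proof (rule field_differentiable_bound[where S = "closed_segment 0 x" and f' = h'])
    fix y assume "y \<in> closed_segment 0 x"
    hence "\<bar>y\<bar> \<le> \<bar>x\<bar>" by (auto simp: closed_segment_eq_real_ivl split: if_splits)
    hence "K * (1 + \<bar>y\<bar> ^ n) \<le> K * (1 + \<bar>x\<bar> ^ n)"
      using assms(3) by (intro mult_left_mono add_left_mono power_mono) auto
    thus "norm (h' y) \<le> K * (1 + \<bar>x\<bar> ^ n)" using assms(2)[of y] by simp
  qed (use assms in \<open>auto intro: has_field_derivative_at_within\<close>)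
  thus ?thesis by simp
qed

text \<open>The density times \<open>h' w - w * h w\<close> is the derivative of the density times
  \<open>h w\<close>, and the boundary terms vanish because \<open>h\<close> grows at most
  linearly.\<close>

lemma stein_identity:
  fixes h h' :: "real \<Rightarrow> real"
  assumes h: "\<And>x. (h has_real_derivative h' x) (at x)" and h': "continuous_on UNIV h'" "\<And>x. \<bar>h' x\<bar> \<le> B"
  shows "(\<integral>w. w * h w \<partial>gaussian 0 1) = (\<integral>w. h' w \<partial>gaussian 0 1)"
    "integrable (gaussian 0 1) (\<lambda>w. w * h w)" "integrable (gaussian 0 1) h'"
    "integrable (gaussian 0 1) h"
proof -
  have B: "B \<ge> 0" using h'(2)[of 0] by linarith
  have "\<bar>h' x\<bar> \<le> B * (1 + \<bar>x\<bar> ^ 0)" for x using h'(2)[of x] B by simp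
  note growth = DERIV_linear_growth[OF h this B]
  have lin0: "\<bar>h x - h 0\<bar> \<le> 2 * B * \<bar>x\<bar>" for x using growth[of x] by (simp add: mult.commute)
  have lin: "\<bar>h x\<bar> \<le> \<bar>h 0\<bar> + 2 * B * \<bar>x\<bar>" for x
    using abs_triangle_ineq2[of "h x" "h 0"] lin0[of x] by linarith
  define K where "K = \<bar>h 0\<bar> + 2 * B"
  have K: "K \<ge> 0" using B by (simp add: K_def)
  have hK: "\<bar>h x\<bar> \<le> K * (1 + x\<^sup>2)" for x
  proof -
    have "\<bar>h 0\<bar> + 2 * B * \<bar>x\<bar> \<le> \<bar>h 0\<bar> * (1 + x\<^sup>2) + 2 * B * (1 + x\<^sup>2)"
      using B abs_le_1_plus_square[of x] by (intro add_mono mult_left_mono) (auto simp: algebra_simps)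
    thus ?thesis using lin[of x] by (simp add: K_def algebra_simps)
  qed
  have whK: "\<bar>x * h x\<bar> \<le> (2 * K) * (1 + x\<^sup>2)" for x
  proof -
    have "\<bar>x * h x\<bar> \<le> \<bar>x\<bar> * (\<bar>h 0\<bar> + 2 * B * \<bar>x\<bar>)" unfolding abs_mult using lin[of x] by (intro mult_left_mono) auto
    also have "\<dots> = \<bar>h 0\<bar> * \<bar>x\<bar> + 2 * B * x\<^sup>2" by (simp add: algebra_simps power2_eq_square)
    also have "\<dots> \<le> \<bar>h 0\<bar> * (1 + x\<^sup>2) + 2 * B * (1 + x\<^sup>2)"
      using B abs_le_1_plus_square[of x] by (intro add_mono mult_left_mono) auto
    also have "\<dots> \<le> (2 * K) * (1 + x\<^sup>2)" using B by (simp add: K_def algebra_simps)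
    finally show ?thesis .
  qed
  have h'B: "\<bar>h' x\<bar> \<le> B * (1 + x\<^sup>2)" for x
    using h'(2)[of x] B mult_left_mono[of 1 "1 + x\<^sup>2" B] by auto
  have hc: "continuous_on UNIV h" using h by (intro DERIV_continuous_on) auto
  have m: "h \<in> borel_measurable borel" "h' \<in> borel_measurable borel"
    using hc h' by (auto intro: borel_measurable_continuous_onI)
  show i: "integrable (gaussian 0 1) (\<lambda>w. w * h w)" "integrable (gaussian 0 1) h'" "integrable (gaussian 0 1) h"
    using m by (auto intro!: std_gaussian_integrable_quadratic[OF _ whK] std_gaussian_integrable_quadratic[OF _ h'B]
      std_gaussian_integrable_quadratic[OF _ hK])
  let ?f = "\<lambda>w. std_normal_density w * h' w - std_normal_density w * (w * h w)"
  have il: "integrable lborel (\<lambda>w. std_normal_density w * h' w)" "integrable lborel (\<lambda>w. std_normal_density w * (w * h w))"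
    using i m by (auto simp: gaussian_std integrable_density)
  have d: "((\<lambda>w. std_normal_density w * h w) has_real_derivative ?f w) (at w)" for w
    unfolding std_normal_density_def
    by (rule derivative_eq_intros h refl | simp)+ (simp add: algebra_simps)
  have lim: "((\<lambda>w. std_normal_density w * h w) \<longlongrightarrow> 0) G" if "filterlim (\<lambda>w::real. w\<^sup>2 / 2) at_top G" for G
  proof (rule Lim_null_comparison)
    show "\<forall>\<^sub>F w in G. norm (std_normal_density w * h w) \<le> K * ((1 + w\<^sup>2) * std_normal_density w)"
    proof (rule always_eventually, rule allI)
      fix w
      have "std_normal_density w * \<bar>h w\<bar> \<le> std_normal_density w * (K * (1 + w\<^sup>2))"
        using hK by (intro mult_left_mono) auto
      thus "norm (std_normal_density w * h w) \<le> K * ((1 + w\<^sup>2) * std_normal_density w)"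
        by (simp add: abs_mult mult_ac)
    qed
    show "((\<lambda>w. K * ((1 + w\<^sup>2) * std_normal_density w)) \<longlongrightarrow> 0) G"
      using tendsto_mult[OF tendsto_const[of K] tendsto_gaussian_tail[OF that]] by simp
  qed
  have "(LBINT w=-\<infinity>..\<infinity>. ?f w) = 0 - 0"
  proof (rule interval_integral_FTC_integrable)
    show "((\<lambda>w. std_normal_density w * h w) has_vector_derivative ?f w) (at w)" for w
      using d by (simp add: has_real_derivative_iff_has_vector_derivative)
    show "isCont ?f w" for w
      using hc h'(1) unfolding std_normal_density_def
      by (intro continuous_intros) (auto simp: continuous_on_eq_continuous_at)
    show "set_integrable lborel (einterval (-\<infinity>) \<infinity>) ?f" using il by (simp add: set_integrable_def)
    show "(((\<lambda>w. std_normal_density w * h w) \<circ> real_of_ereal) \<longlongrightarrow> 0) (at_right (- \<infinity>))"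
      "(((\<lambda>w. std_normal_density w * h w) \<circ> real_of_ereal) \<longlongrightarrow> 0) (at_left \<infinity>)"
      using lim[OF filterlim_half_square(1)] lim[OF filterlim_half_square(2)] by (simp_all add: ereal_tendsto_simps)
  qed simp
  hence "(\<integral>w. ?f w \<partial>lborel) = 0"
    by (simp add: interval_lebesgue_integral_def set_lebesgue_integral_def)
  thus "(\<integral>w. w * h w \<partial>gaussian 0 1) = (\<integral>w. h' w \<partial>gaussian 0 1)"
    using il m by (simp add: gaussian_std integral_density)
qed

lemma test_functionD:
  assumes "test_function f"
  obtains B where "\<And>x. (f has_real_derivative deriv f x) (at x)" "\<And>x. (deriv f has_real_derivative deriv (deriv f) x) (at x)"
    "continuous_on UNIV (deriv (deriv f))" "\<And>x. \<bar>deriv (deriv f) x\<bar> \<le> B" 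
    "\<And>x. \<bar>deriv f x\<bar> \<le> B * (1 + \<bar>x\<bar>)" "\<And>x. \<bar>f x\<bar> \<le> B * (1 + x\<^sup>2)" "B \<ge> 0"
proof -
  have d: "(f has_real_derivative deriv f x) (at x)" "(deriv f has_real_derivative deriv (deriv f) x) (at x)" for x
    using assms by (auto simp: test_function_def DERIV_deriv_iff_real_differentiable)
  have c: "continuous_on UNIV (deriv (deriv f))" using assms by (simp add: test_function_def)
  obtain B0 where B0: "\<And>x. \<bar>deriv (deriv f) x\<bar> \<le> B0"
    using assms by (force simp: test_function_def bounded_iff)
  have B0': "B0 \<ge> 0" using B0[of 0] by linarith
  have "\<bar>deriv (deriv f) x\<bar> \<le> B0 * (1 + \<bar>x\<bar> ^ 0)" for x using B0[of x] B0' by simp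
  note 1 = DERIV_linear_growth[OF d(2) this B0']
  define K where "K = \<bar>deriv f 0\<bar> + 2 * B0"
  have 2: "\<bar>deriv f x\<bar> \<le> K * (1 + \<bar>x\<bar> ^ 1)" for x
  proof -
    have "\<bar>deriv f x\<bar> \<le> \<bar>deriv f 0\<bar> + 2 * B0 * \<bar>x\<bar>" using 1[of x] by (simp add: mult.commute)
    also have "\<dots> \<le> K * (1 + \<bar>x\<bar> ^ 1)" using B0' by (simp add: K_def algebra_simps)
    finally show ?thesis .
  qed
  have K: "K \<ge> 0" using B0' by (simp add: K_def)
  note 3 = DERIV_linear_growth[OF d(1) 2 K]
  define B where "B = \<bar>f 0\<bar> + 2 * K + B0"
  have 4: "\<bar>f x\<bar> \<le> B * (1 + x\<^sup>2)" for x
  proof -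
    have "\<bar>f x\<bar> \<le> \<bar>f 0\<bar> + K * ((1 + \<bar>x\<bar>) * \<bar>x\<bar>)" using 3[of x] by (simp add: mult.assoc)
    also have "(1 + \<bar>x\<bar>) * \<bar>x\<bar> = \<bar>x\<bar> + x\<^sup>2" by (simp add: algebra_simps power2_eq_square)
    also have "\<bar>f 0\<bar> + K * (\<bar>x\<bar> + x\<^sup>2) \<le> \<bar>f 0\<bar> + K * (2 * (1 + x\<^sup>2))"
      using K abs_le_1_plus_square[of x] by (intro add_left_mono mult_left_mono) auto
    also have "\<dots> \<le> B * (1 + x\<^sup>2)" using B0' by (simp add: B_def algebra_simps)
    finally show ?thesis .
  qed
  have 5: "\<bar>deriv f x\<bar> \<le> B * (1 + \<bar>x\<bar>)" for x
  proof -
    have "K * (1 + \<bar>x\<bar>) \<le> B * (1 + \<bar>x\<bar>)" using K B0' by (intro mult_right_mono) (auto simp: B_def)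
    thus ?thesis using 2[of x] by simp
  qed
  have 6: "\<bar>deriv (deriv f) x\<bar> \<le> B" for x using B0[of x] K by (simp add: B_def)
  have 7: "B \<ge> 0" using K B0' by (simp add: B_def)
  show ?thesis by (rule that[OF d c 6 5 4 7])
qed

text \<open>The existence counterpart of \<open>gaussian_preserved\<close>, with classical
  derivatives because it serves a feedback that is continuous between observations. The law is that
  of \<open>m u + s u * W\<close> with \<open>W\<close> standard normal; differentiating
  \<open>f\<close> along it and taking expectations produces a factor \<open>W\<close>, which
  Stein's identity turns into a second derivative of \<open>f\<close>.\<close>

lemma gaussian_weak_evolution:
  assumes rt: "r \<le> t"
    and m: "\<And>u. u \<in> {r..t} \<Longrightarrow> (m has_real_derivative - \<theta> * m u + a u) (at u within {r..t})"
    and z: "\<And>u. u \<in> {r..t} \<Longrightarrow> (z has_real_derivative b\<^sup>2 - 2 * \<theta> * z u) (at u within {r..t})"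
    and zpos: "\<And>u. u \<in> {r..t} \<Longrightarrow> z u > 0" and a: "continuous_on {r..t} a"
  shows "weak_evolution \<theta> b a (\<lambda>u. gaussian (m u) (z u)) r t"
  unfolding weak_evolution_def
proof (intro allI impI)
  fix f assume f: "test_function f"
  from test_functionD[OF f] obtain B where
    d: "\<And>x. (f has_real_derivative deriv f x) (at x)" "\<And>x. (deriv f has_real_derivative deriv (deriv f) x) (at x)"
    and c: "continuous_on UNIV (deriv (deriv f))" and B: "\<And>x. \<bar>deriv (deriv f) x\<bar> \<le> B" 
    "\<And>x. \<bar>deriv f x\<bar> \<le> B * (1 + \<bar>x\<bar>)" "\<And>x. \<bar>f x\<bar> \<le> B * (1 + x\<^sup>2)" "B \<ge> 0" by metis
  have fc: "continuous_on UNIV f" "continuous_on UNIV (deriv f)" using d by (auto intro: DERIV_continuous_on)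
  have fm: "f \<in> borel_measurable borel" "deriv f \<in> borel_measurable borel" "deriv (deriv f) \<in> borel_measurable borel"
    using fc c by (auto intro: borel_measurable_continuous_onI)
  define s where "s u = sqrt (z u)" for u
  define m' where "m' u = - \<theta> * m u + a u" for u
  define s' where "s' u = (b\<^sup>2 - 2 * \<theta> * z u) / (2 * s u)" for u
  have spos: "s u > 0" if "u \<in> {r..t}" for u using zpos[OF that] by (simp add: s_def)
  have sd: "(s has_real_derivative s' u) (at u within {r..t})" if "u \<in> {r..t}" for u
    unfolding s_def[abs_def] s'_def using z[OF that] zpos[OF that]
    by (auto intro!: derivative_eq_intros simp: s_def divide_simps)
  have md: "(m has_real_derivative m' u) (at u within {r..t})" if "u \<in> {r..t}" for u
    using m[OF that] by (simp add: m'_def)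
  have cont: "continuous_on {r..t} m" "continuous_on {r..t} z" "continuous_on {r..t} s"
    by (rule DERIV_continuous_on[OF md] DERIV_continuous_on[OF z] DERIV_continuous_on[OF sd]; assumption)+
  have cont': "continuous_on {r..t} m'" "continuous_on {r..t} s'"
    unfolding m'_def s'_def using spos by (force intro!: continuous_intros cont a)+
  define g where "g u w = deriv f (m u + s u * w) * (m' u + s' u * w)" for u w
  have g_cont: "continuous_on ({r..t} \<times> UNIV) (\<lambda>(u, w). g u w)"
  proof -
    have q: "continuous_on ({r..t} \<times> (UNIV :: real set)) (\<lambda>p. q (fst p))" if "continuous_on {r..t} q" for q :: "real \<Rightarrow> real"
      by (rule continuous_on_compose2[OF that continuous_on_fst]) auto
    show ?thesis unfolding g_def case_prod_beta
      by (intro continuous_intros continuous_on_compose2[OF fc(2)] q cont cont') auto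
  qed
  obtain M where M: "M \<ge> 0" "\<And>u. u \<in> {r..t} \<Longrightarrow> \<bar>m u\<bar> \<le> M \<and> \<bar>s u\<bar> \<le> M \<and> \<bar>m' u\<bar> \<le> M \<and> \<bar>s' u\<bar> \<le> M"
  proof -
    have bnd: "\<exists>M\<ge>0. \<forall>u\<in>{r..t}. \<bar>q u\<bar> \<le> M" if "continuous_on {r..t} q" for q :: "real \<Rightarrow> real"
    proof -
      from compact_imp_bounded[OF compact_continuous_image[OF that compact_Icc]]
      obtain M where "\<forall>u\<in>{r..t}. \<bar>q u\<bar> \<le> M" by (auto simp: bounded_iff)
      thus ?thesis by (intro exI[of _ "\<bar>M\<bar>"]) (auto intro: order_trans[OF _ abs_ge_self])
    qed
    from bnd[OF cont(1)] bnd[OF cont(3)] bnd[OF cont'(1)] bnd[OF cont'(2)]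
    obtain M1 M2 M3 M4 where *: "M1 \<ge> 0" "M2 \<ge> 0" "M3 \<ge> 0" "M4 \<ge> 0"
      "\<forall>u\<in>{r..t}. \<bar>m u\<bar> \<le> M1" "\<forall>u\<in>{r..t}. \<bar>s u\<bar> \<le> M2" "\<forall>u\<in>{r..t}. \<bar>m' u\<bar> \<le> M3" "\<forall>u\<in>{r..t}. \<bar>s' u\<bar> \<le> M4"
      by blast
    show ?thesis
    proof (rule that[of "M1 + M2 + M3 + M4"])
      fix u assume "u \<in> {r..t}"
      with * have "\<bar>m u\<bar> \<le> M1" "\<bar>s u\<bar> \<le> M2" "\<bar>m' u\<bar> \<le> M3" "\<bar>s' u\<bar> \<le> M4" by blast+
      thus "\<bar>m u\<bar> \<le> M1 + M2 + M3 + M4 \<and> \<bar>s u\<bar> \<le> M1 + M2 + M3 + M4 \<and> \<bar>m' u\<bar> \<le> M1 + M2 + M3 + M4 \<and> \<bar>s' u\<bar> \<le> M1 + M2 + M3 + M4"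
        using *(1-4) by linarith
    qed (use * in auto)
  qed
  define K where "K = 2 * (B * (1 + M) * M)"
  have K0: "K \<ge> 0" using B M by (simp add: K_def)
  have gK: "\<bar>g u w\<bar> \<le> K * (1 + w\<^sup>2)" if u: "u \<in> {r..t}" for u w
  proof -
    note Mu = M(2)[OF u]
    have x: "\<bar>m u + s u * w\<bar> \<le> M + M * \<bar>w\<bar>"
      using Mu mult_right_mono[of "\<bar>s u\<bar>" M "\<bar>w\<bar>"] abs_triangle_ineq[of "m u" "s u * w"] by (simp add: abs_mult)
    have y: "\<bar>m' u + s' u * w\<bar> \<le> M * (1 + \<bar>w\<bar>)"
      using Mu mult_right_mono[of "\<bar>s' u\<bar>" M "\<bar>w\<bar>"] abs_triangle_ineq[of "m' u" "s' u * w"] by (simp add: abs_mult algebra_simps)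
    have "1 + \<bar>m u + s u * w\<bar> \<le> (1 + M) * (1 + \<bar>w\<bar>)"
      using x M(1) by (simp add: algebra_simps)
    hence "\<bar>deriv f (m u + s u * w)\<bar> \<le> B * ((1 + M) * (1 + \<bar>w\<bar>))"
      using order_trans[OF B(2)[of "m u + s u * w"] mult_left_mono[OF _ B(4)]] by blast
    hence "\<bar>g u w\<bar> \<le> (B * ((1 + M) * (1 + \<bar>w\<bar>))) * (M * (1 + \<bar>w\<bar>))"
      unfolding g_def abs_mult using y B(4) M(1) by (intro mult_mono) auto
    also have "\<dots> = B * (1 + M) * M * (1 + \<bar>w\<bar>)\<^sup>2" by (simp add: power2_eq_square mult_ac)
    also have "\<dots> \<le> B * (1 + M) * M * (2 * (1 + w\<^sup>2))"
    proof (rule mult_left_mono)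
      show "(1 + \<bar>w\<bar>)\<^sup>2 \<le> 2 * (1 + w\<^sup>2)"
        using zero_le_power2[of "1 - \<bar>w\<bar>"] by (simp add: power2_eq_square algebra_simps)
    qed (use B(4) M(1) in auto)
    also have "\<dots> = K * (1 + w\<^sup>2)" unfolding K_def by algebra
    finally show ?thesis .
  qed
  have ftc: "f (m u + s u * w) - f (m r + s r * w) = (LINT v:{r..u}|lborel. g v w)" if u: "u \<in> {r..t}" for u w
  proof -
    have "primitive_on r t (\<lambda>v. f (m v + s v * w)) (\<lambda>v. g v w)"
    proof (rule primitive_on_C1[OF rt])
      fix v assume v: "v \<in> {r..t}"
      have "((\<lambda>v. m v + s v * w) has_real_derivative m' v + s' v * w) (at v within {r..t})"
        by (auto intro!: derivative_eq_intros md[OF v] sd[OF v])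
      from DERIV_chain2[OF d(1) this]
      show "((\<lambda>v. f (m v + s v * w)) has_real_derivative g v w) (at v within {r..t})" by (simp add: g_def)
    next
      have "continuous_on {r..t} (\<lambda>v. (\<lambda>(u, w). g u w) (v, w))"
        by (rule continuous_on_compose2[OF g_cont]) (auto intro!: continuous_intros)
      thus "continuous_on {r..t} (\<lambda>v. g v w)" by simp
    qed
    from primitive_on_diff[OF this, of r u] u show ?thesis by simp
  qed
  let ?\<gamma> = "gaussian 0 1"
  interpret G: prob_space ?\<gamma> by (rule prob_space_gaussian) simp
  interpret pair_sigma_finite lborel ?\<gamma> ..
  define H where "H u w = indicator {r..t} u * g u w" for u w
  have Hm: "(\<lambda>(u, w). H u w) \<in> borel_measurable (lborel \<Otimes>\<^sub>M ?\<gamma>)"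
  proof -
    have "(\<lambda>p. indicator ({r..t} \<times> UNIV) p *\<^sub>R (\<lambda>(u, w). g u w) p) \<in> borel_measurable borel"
      by (rule borel_measurable_continuous_on_indicator[OF _ g_cont]) (simp add: borel_Times)
    also have "(\<lambda>p. indicator ({r..t} \<times> UNIV) p *\<^sub>R (\<lambda>(u, w). g u w) p) = (\<lambda>(u, w). H u w)"
      by (auto simp: H_def indicator_def)
    finally have "(\<lambda>(u, w). H u w) \<in> borel_measurable (borel \<Otimes>\<^sub>M borel)" by (simp add: borel_prod)
    moreover have "sets (lborel \<Otimes>\<^sub>M ?\<gamma>) = sets (borel \<Otimes>\<^sub>M borel :: (real \<times> real) measure)"
      by (intro sets_pair_measure_cong) auto
    ultimately show ?thesis using measurable_cong_sets[OF _ refl] by blast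
  qed
  have Hb: "\<bar>H u w\<bar> \<le> indicator {r..t} u * K * (1 + w\<^sup>2)" for u w
    using gK[of u w] K0 by (auto simp: H_def indicator_def)
  \<comment> \<open>Integrability on the product of time and \<open>w\<close>, from the quadratic
    bound \<open>gK\<close>; it permits exchanging the time integral with the expectation.\<close>
  have Hi: "integrable (lborel \<Otimes>\<^sub>M ?\<gamma>) (\<lambda>(u, w). H u w)"
  proof (rule Fubini_integrable[OF Hm])
    have q: "integrable ?\<gamma> (\<lambda>w. H u w)" for u
      using Hb[of u] measurable_Pair2[OF Hm, of u] by (intro std_gaussian_integrable_quadratic[where K = "indicator {r..t} u * K"]) auto
    thus "AE u in lborel. integrable ?\<gamma> (\<lambda>w. (\<lambda>(u, w). H u w) (u, w))" by simp
    have q': "(\<integral>w. norm (H u w) \<partial>?\<gamma>) \<le> indicator {r..t} u * (K * 2)" for u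
    proof -
      have "(\<integral>w. norm (H u w) \<partial>?\<gamma>) \<le> (\<integral>w. indicator {r..t} u * K * (1 + w\<^sup>2) \<partial>?\<gamma>)"
        using q[of u] Hb[of u] std_gaussian_moments by (intro integral_mono) auto
      also have "\<dots> = indicator {r..t} u * K * 2" using std_gaussian_moments G.prob_space by simp
      finally show ?thesis by simp
    qed
    have "integrable lborel (\<lambda>u. indicator {r..t} u * (K * 2))"
      by (intro integrable_mult_left) (use rt in \<open>simp add: integrable_indicator_iff\<close>)
    hence "integrable lborel (\<lambda>u. \<integral>w. norm (H u w) \<partial>?\<gamma>)"
    proof (rule Bochner_Integration.integrable_bound)
      show "(\<lambda>u. \<integral>w. norm (H u w) \<partial>?\<gamma>) \<in> borel_measurable lborel"
        using Hm by (intro G.borel_measurable_lebesgue_integral) (simp add: case_prod_beta)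
      show "AE u in lborel. norm (\<integral>w. norm (H u w) \<partial>?\<gamma>) \<le> norm (indicator {r..t} u * (K * 2))"
      proof (rule AE_I2)
        fix u
        have "0 \<le> (\<integral>w. norm (H u w) \<partial>?\<gamma>)" by simp
        thus "norm (\<integral>w. norm (H u w) \<partial>?\<gamma>) \<le> norm (indicator {r..t} u * (K * 2))"
          using q'[of u] by (metis abs_ge_self abs_of_nonneg order_trans real_norm_def)
      qed
    qed
    thus "integrable lborel (\<lambda>u. \<integral>w. norm ((\<lambda>(u, w). H u w) (u, w)) \<partial>?\<gamma>)" by simp
  qed
  \<comment> \<open>Stein's identity replaces \<open>w * h w\<close> by \<open>h' w\<close> on both
    sides, and \<open>s' u * s u = 1/2 * b\<^sup>2 - \<theta> * z u\<close> makes the coefficients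
    of the second derivative agree.\<close>
  have gen: "(\<integral>w. H u w \<partial>?\<gamma>) = indicator {r..t} u * (\<integral>x. generator \<theta> b (a u) f x \<partial>gaussian (m u) (z u))" for u
  proof (cases "u \<in> {r..t}")
    case True
    define h where "h w = deriv f (m u + s u * w)" for w
    define h' where "h' w = deriv (deriv f) (m u + s u * w) * s u" for w
    have st: "(h has_real_derivative h' w) (at w)" for w
      unfolding h_def h'_def by (rule DERIV_chain2[OF d(2)]) (auto intro!: derivative_eq_intros)
    have st2: "continuous_on UNIV h'" unfolding h'_def
      by (intro continuous_intros continuous_on_compose2[OF c]) auto
    have st3: "\<bar>h' w\<bar> \<le> B * \<bar>s u\<bar>" for w unfolding h'_def abs_mult using B(1) by (intro mult_right_mono) auto
    note stein = stein_identity[OF st st2 st3]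
    have su: "s u * s u = z u" using zpos[OF True] by (simp add: s_def)
    have ss': "s' u * s u = 1/2 * b\<^sup>2 - \<theta> * (s u * s u)"
      using spos[OF True] unfolding su by (simp add: s'_def field_simps)
    have "(\<integral>w. H u w \<partial>?\<gamma>) = (\<integral>w. m' u * h w + s' u * (w * h w) \<partial>?\<gamma>)"
      using True by (simp add: H_def g_def h_def algebra_simps)
    also have "\<dots> = m' u * (\<integral>w. h w \<partial>?\<gamma>) + s' u * (\<integral>w. h' w \<partial>?\<gamma>)"
      using stein by simp
    also have "(\<integral>w. h' w \<partial>?\<gamma>) = s u * (\<integral>w. deriv (deriv f) (m u + s u * w) \<partial>?\<gamma>)"
      by (simp add: h'_def)
    finally have lhs: "(\<integral>w. H u w \<partial>?\<gamma>) = m' u * (\<integral>w. h w \<partial>?\<gamma>) + 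
        (1/2 * b\<^sup>2 - \<theta> * (s u * s u)) * (\<integral>w. deriv (deriv f) (m u + s u * w) \<partial>?\<gamma>)"
      unfolding ss'[symmetric] by (simp add: mult.assoc)
    have i3: "integrable ?\<gamma> (\<lambda>w. deriv (deriv f) (m u + s u * w))"
      using stein(3) spos[OF True] by (simp add: h'_def)
    have "(\<integral>x. generator \<theta> b (a u) f x \<partial>gaussian (m u) (z u)) = 
      (\<integral>w. generator \<theta> b (a u) f (m u + s u * w) \<partial>?\<gamma>)"
      unfolding s_def using zpos[OF True] fm by (intro integral_gaussian) (auto simp: generator_def)
    also have "\<dots> = (\<integral>w. m' u * h w - \<theta> * s u * (w * h w) + 1/2 * b\<^sup>2 * deriv (deriv f) (m u + s u * w) \<partial>?\<gamma>)"
      by (simp add: generator_def h_def m'_def algebra_simps)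
    also have "\<dots> = m' u * (\<integral>w. h w \<partial>?\<gamma>) - \<theta> * s u * (\<integral>w. h' w \<partial>?\<gamma>) 
       + 1/2 * b\<^sup>2 * (\<integral>w. deriv (deriv f) (m u + s u * w) \<partial>?\<gamma>)"
      using stein i3 by simp
    also have "\<dots> = (\<integral>w. H u w \<partial>?\<gamma>)" unfolding lhs by (simp add: h'_def algebra_simps)
    finally show ?thesis using True by simp
  qed (simp add: H_def)
  show "set_integrable lborel {r..t} (\<lambda>u. \<integral>x. generator \<theta> b (a u) f x \<partial>gaussian (m u) (z u)) \<and>
    (\<integral>x. f x \<partial>gaussian (m t) (z t)) = (\<integral>x. f x \<partial>gaussian (m r) (z r)) +
     (LINT u:{r..t}|lborel. (\<integral>x. generator \<theta> b (a u) f x \<partial>gaussian (m u) (z u)))"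
  proof
    show "set_integrable lborel {r..t} (\<lambda>u. \<integral>x. generator \<theta> b (a u) f x \<partial>gaussian (m u) (z u))"
      using integrable_fst[OF Hi] unfolding gen set_integrable_def by simp
    have fi: "integrable ?\<gamma> (\<lambda>w. f (m u + s u * w))" if u: "u \<in> {r..t}" for u
    proof (rule std_gaussian_integrable_quadratic[where K = "B * (1 + 2 * M\<^sup>2)"])
      fix w
      have "(m u + s u * w)\<^sup>2 \<le> 2 * (m u)\<^sup>2 + 2 * ((s u)\<^sup>2 * w\<^sup>2)"
        using zero_le_power2[of "m u - s u * w"] by (simp add: power2_eq_square algebra_simps)
      also have "\<dots> \<le> 2 * M\<^sup>2 + 2 * (M\<^sup>2 * w\<^sup>2)"
        using M(2)[OF u] M(1) by (intro add_mono mult_left_mono mult_right_mono) (auto simp: abs_le_square_iff[symmetric])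
      finally have "1 + (m u + s u * w)\<^sup>2 \<le> (1 + 2 * M\<^sup>2) * (1 + w\<^sup>2)"
        using zero_le_power2[of w] unfolding distrib_left distrib_right by linarith
      from mult_left_mono[OF this B(4)] show "\<bar>f (m u + s u * w)\<bar> \<le> B * (1 + 2 * M\<^sup>2) * (1 + w\<^sup>2)"
        using B(3)[of "m u + s u * w"] by (simp add: mult.assoc)
    qed (use fm in simp)
    have rt': "r \<in> {r..t}" "t \<in> {r..t}" using rt by auto
    have "(\<integral>x. f x \<partial>gaussian (m t) (z t)) - (\<integral>x. f x \<partial>gaussian (m r) (z r)) =
      (\<integral>w. f (m t + s t * w) - f (m r + s r * w) \<partial>?\<gamma>)"
    proof -
      have e: "(\<integral>x. f x \<partial>gaussian (m u) (z u)) = (\<integral>w. f (m u + s u * w) \<partial>?\<gamma>)" if "u \<in> {r..t}" for u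
        unfolding s_def by (rule integral_gaussian[OF zpos[OF that] fm(1)])
      show ?thesis unfolding e[OF rt'(1)] e[OF rt'(2)]
        by (rule Bochner_Integration.integral_diff[OF fi[OF rt'(2)] fi[OF rt'(1)], symmetric])
    qed
    also have "\<dots> = (\<integral>w. (\<integral>u. H u w \<partial>lborel) \<partial>?\<gamma>)"
      unfolding ftc[OF rt'(2)] by (simp add: set_lebesgue_integral_def H_def)
    also have "\<dots> = (\<integral>u. (\<integral>w. H u w \<partial>?\<gamma>) \<partial>lborel)" by (rule Fubini_integral[OF Hi])
    finally show "(\<integral>x. f x \<partial>gaussian (m t) (z t)) = (\<integral>x. f x \<partial>gaussian (m r) (z r)) +
     (LINT u:{r..t}|lborel. (\<integral>x. generator \<theta> b (a u) f x \<partial>gaussian (m u) (z u)))"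
      unfolding gen by (simp add: set_lebesgue_integral_def)
  qed
qed

section \<open>The Riccati equation and the value function\<close>

text \<open>\<open>num' = den - \<theta> num\<close> and \<open>den' = \<theta> den + num / C\<close> linearise the Riccati equation for the
  quotient; \<open>den\<close> is also the fundamental solution of the optimally controlled mean, read backwards.\<close>

definition riccati_rate :: "real \<Rightarrow> real \<Rightarrow> real" where
  "riccati_rate \<theta> C = sqrt (\<theta>\<^sup>2 + 1 / C)"

definition riccati_num :: "real \<Rightarrow> real \<Rightarrow> real \<Rightarrow> real" where
  "riccati_num \<theta> C h = cosh (riccati_rate \<theta> C * h) + (1 - \<theta>) / riccati_rate \<theta> C * sinh (riccati_rate \<theta> C * h)"

definition riccati_den :: "real \<Rightarrow> real \<Rightarrow> real \<Rightarrow> real" where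
  "riccati_den \<theta> C h = cosh (riccati_rate \<theta> C * h) + (\<theta> + 1 / C) / riccati_rate \<theta> C * sinh (riccati_rate \<theta> C * h)"

lemma riccati_rate_bounds:
  assumes "C > 0"
  shows "riccati_rate \<theta> C > \<bar>\<theta>\<bar>" "(riccati_rate \<theta> C)\<^sup>2 = \<theta>\<^sup>2 + 1 / C"
proof -
  show "(riccati_rate \<theta> C)\<^sup>2 = \<theta>\<^sup>2 + 1 / C" using assms by (simp add: riccati_rate_def)
  have "sqrt (\<theta>\<^sup>2) < sqrt (\<theta>\<^sup>2 + 1 / C)" using assms by (intro real_sqrt_less_mono) simp
  thus "riccati_rate \<theta> C > \<bar>\<theta>\<bar>" by (simp add: riccati_rate_def)
qed

text \<open>The linear system for the pair has trace zero and determinant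
  \<open>- k\<^sup>2\<close>, where \<open>k\<^sup>2 = \<theta>\<^sup>2 + 1 / C\<close>; hence the
  hyperbolic functions of \<open>k * h\<close>.\<close>

lemma riccati_deriv:
  assumes "C > 0"
  shows "(riccati_num \<theta> C has_real_derivative riccati_den \<theta> C h - \<theta> * riccati_num \<theta> C h) (at h)"
    "(riccati_den \<theta> C has_real_derivative \<theta> * riccati_den \<theta> C h + riccati_num \<theta> C h / C) (at h)"
proof -
  define k where "k = riccati_rate \<theta> C"
  have k: "k > 0" "k\<^sup>2 = \<theta>\<^sup>2 + 1 / C" using riccati_rate_bounds[OF assms, of \<theta>] by (auto simp: k_def)
  have q: "(X / k) * k = X" "k * k = \<theta> * \<theta> + 1 / C" for X using k by (auto simp: power2_eq_square)
  have kk: "k = (\<theta> * \<theta> + 1 / C) / k" using k by (simp add: power2_eq_square field_simps)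
  have "(riccati_num \<theta> C has_real_derivative sinh (k * h) * k + (1 - \<theta>) / k * (cosh (k * h) * k)) (at h)"
    unfolding riccati_num_def[abs_def] k_def[symmetric] by (auto intro!: derivative_eq_intros)
  also have "sinh (k * h) * k + (1 - \<theta>) / k * (cosh (k * h) * k) = riccati_den \<theta> C h - \<theta> * riccati_num \<theta> C h"
  proof -
    have "sinh (k * h) * k = sinh (k * h) * ((\<theta> * \<theta> + 1 / C) / k)" using kk by simp
    thus ?thesis unfolding riccati_den_def riccati_num_def k_def[symmetric] using k(1)
      by (simp add: field_simps)
  qed
  finally show "(riccati_num \<theta> C has_real_derivative riccati_den \<theta> C h - \<theta> * riccati_num \<theta> C h) (at h)" .
  have "(riccati_den \<theta> C has_real_derivative sinh (k * h) * k + (\<theta> + 1 / C) / k * (cosh (k * h) * k)) (at h)"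
    unfolding riccati_den_def[abs_def] k_def[symmetric] by (auto intro!: derivative_eq_intros)
  also have "sinh (k * h) * k + (\<theta> + 1 / C) / k * (cosh (k * h) * k) = \<theta> * riccati_den \<theta> C h + riccati_num \<theta> C h / C"
  proof -
    have "sinh (k * h) * k = sinh (k * h) * ((\<theta> * \<theta> + 1 / C) / k)" using kk by simp
    thus ?thesis unfolding riccati_den_def riccati_num_def k_def[symmetric] using k(1) assms
      by (simp add: field_simps)
  qed
  finally show "(riccati_den \<theta> C has_real_derivative \<theta> * riccati_den \<theta> C h + riccati_num \<theta> C h / C) (at h)" .
qed

lemma cosh_sinh_combination_pos:
  fixes c k h :: real
  assumes "k > 0" "c \<ge> - k" "h \<ge> 0"
  shows "cosh (k * h) + c / k * sinh (k * h) > 0"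
proof -
  have "- 1 \<le> c / k" using assms by (simp add: field_simps)
  moreover have "sinh (k * h) \<ge> 0" using assms by simp
  ultimately have "(- 1) * sinh (k * h) \<le> c / k * sinh (k * h)" by (rule mult_right_mono)
  moreover have "cosh (k * h) - sinh (k * h) > 0" by (simp add: cosh_minus_sinh)
  ultimately show ?thesis by linarith
qed

text \<open>The rate exceeds \<open>\<bar>\<theta>\<bar>\<close>, so the hyperbolic cosine wins for
  either sign of \<open>\<theta>\<close>. A positive \<open>riccati_den\<close> means that the
  Riccati solution does not blow up on any horizon.\<close>

lemma riccati_pos:
  assumes "C > 0" "h \<ge> 0"
  shows "riccati_num \<theta> C h > 0" "riccati_den \<theta> C h > 0"
proof -
  have "1 / C > 0" using assms by simp
  hence "riccati_rate \<theta> C > 0" "1 - \<theta> \<ge> - riccati_rate \<theta> C" "\<theta> + 1 / C \<ge> - riccati_rate \<theta> C"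
    using riccati_rate_bounds(1)[OF assms(1), of \<theta>] by linarith+
  thus "riccati_num \<theta> C h > 0" "riccati_den \<theta> C h > 0"
    unfolding riccati_num_def riccati_den_def using assms(2)
    by (blast intro: cosh_sinh_combination_pos)+
qed

text \<open>The integral of \<open>exp_integral \<theta>\<close> from \<open>0\<close> to
  \<open>h\<close>.\<close>

definition exp_integral2 :: "real \<Rightarrow> real \<Rightarrow> real" where
  "exp_integral2 \<theta> h = (if \<theta> = 0 then h\<^sup>2 / 2 else (h - exp_integral \<theta> h) / (2 * \<theta>))"

lemma exp_integral2_deriv:
  "(exp_integral2 \<theta> has_real_derivative exp_integral \<theta> h) (at h)"
proof (cases "\<theta> = 0")
  case True thus ?thesis unfolding exp_integral2_def[abs_def] exp_integral_def
    by (auto intro!: derivative_eq_intros)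
next
  case False thus ?thesis unfolding exp_integral2_def[abs_def]
    by (auto intro!: derivative_eq_intros simp: exp_integral_def diff_divide_distrib)
qed

lemma exp_integral2_0 [simp]: "exp_integral2 \<theta> 0 = 0"
  by (simp add: exp_integral2_def)

lemma exp_integral2_nonneg: assumes "h \<ge> 0" shows "exp_integral2 \<theta> h \<ge> 0"
proof -
  have "exp_integral2 \<theta> 0 \<le> exp_integral2 \<theta> h"
    by (rule DERIV_nonneg_imp_nondecreasing[OF assms])
      (rule exI, rule conjI, rule exp_integral2_deriv, rule exp_integral_nonneg, simp)
  thus ?thesis by simp
qed

text \<open>The time integral of \<open>ou_variance\<close> over a stretch of length
  \<open>h\<close>: the part of the running cost that no control can change.\<close>

definition ou_variance_integral :: "real \<Rightarrow> real \<Rightarrow> real \<Rightarrow> real \<Rightarrow> real" where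
  "ou_variance_integral \<theta> b h z = exp_integral \<theta> h * z + b\<^sup>2 * exp_integral2 \<theta> h"

lemma ou_variance_integral_0 [simp]: "ou_variance_integral \<theta> b 0 z = 0"
  by (simp add: ou_variance_integral_def)

text \<open>The derivative is kept in terms of the initial variance. Since
  \<open>exp (- 2 * \<theta> * h)\<close> is the derivative of \<open>ou_variance\<close> in
  \<open>z\<close>, this is a transport equation in \<open>(h, z)\<close>, the form that
  \<open>var_value_pde\<close> uses; \<open>ou_variance_ode\<close> converts it to the autonomous
  form.\<close>

lemma ou_variance_deriv:
  "((\<lambda>h. ou_variance \<theta> b h z) has_real_derivative exp (- 2 * \<theta> * h) * (b\<^sup>2 - 2 * \<theta> * z)) (at h)"
  unfolding ou_variance_def by (auto intro!: derivative_eq_intros simp: algebra_simps)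

lemma ou_variance_ode:
  "exp (- 2 * \<theta> * h) * (b\<^sup>2 - 2 * \<theta> * z) = b\<^sup>2 - 2 * \<theta> * ou_variance \<theta> b h z"
  using arg_cong[OF exp_integral_eq[of \<theta> h], of "\<lambda>x. b\<^sup>2 * x"]
  by (simp add: ou_variance_def algebra_simps)

lemma ou_variance_integral_deriv:
  "((\<lambda>h. ou_variance_integral \<theta> b h z) has_real_derivative ou_variance \<theta> b h z) (at h)"
  unfolding ou_variance_integral_def
  by (rule derivative_eq_intros exp_integral2_deriv refl | simp)+ (simp add: ou_variance_def)

lemma ou_variance_integral_nonneg: "z > 0 \<Longrightarrow> h \<ge> 0 \<Longrightarrow> ou_variance_integral \<theta> b h z \<ge> 0"
  unfolding ou_variance_integral_def
  by (intro add_nonneg_nonneg mult_nonneg_nonneg exp_integral_nonneg exp_integral2_nonneg) auto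

text \<open>The horizon is the time with index \<open>n + 1\<close>, so that it can be treated as a
  last node without update.\<close>

locale observed_ou =
  fixes \<theta> b C \<epsilon> T :: real and n :: nat and \<tau> :: "nat \<Rightarrow> real"
  assumes C_pos: "C > 0" and eps_pos: "\<epsilon> > 0"
    and tau_T: "\<tau> (Suc n) = T" and tau_mono: "strict_mono_on {0..Suc n} \<tau>"
begin

definition p :: "real \<Rightarrow> real" where "p t = riccati_num \<theta> C (T - t) / riccati_den \<theta> C (T - t)"
definition \<psi> :: "real \<Rightarrow> real" where "\<psi> t = riccati_den \<theta> C (T - t)"

lemma p_pos: "t \<le> T \<Longrightarrow> p t > 0" and psi_pos: "t \<le> T \<Longrightarrow> \<psi> t > 0"
  using riccati_pos[OF C_pos] by (simp_all add: p_def \<psi>_def)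

lemma p_T: "p T = 1"
  by (simp add: p_def riccati_num_def riccati_den_def)

text \<open>This is the mean equation \<open>M' = - \<theta> * M + \<alpha>\<close> with the
  feedback \<open>\<alpha> = - p * M / C\<close> inserted.\<close>

lemma psi_deriv:
  assumes "t \<le> T" shows "(\<psi> has_real_derivative (- \<theta> - p t / C) * \<psi> t) (at t within S)"
proof -
  have "(\<psi> has_real_derivative (\<theta> * riccati_den \<theta> C (T - t) + riccati_num \<theta> C (T - t) / C) * (- 1)) (at t within S)"
    unfolding \<psi>_def[abs_def]
    by (rule DERIV_chain2[OF riccati_deriv(2)[OF C_pos]]) (auto intro!: derivative_eq_intros)
  also have "(\<theta> * riccati_den \<theta> C (T - t) + riccati_num \<theta> C (T - t) / C) * (- 1) = (- \<theta> - p t / C) * \<psi> t"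
    using riccati_pos(2)[OF C_pos, of "T - t" \<theta>] assms C_pos by (simp add: p_def \<psi>_def field_simps)
  finally show ?thesis .
qed

lemma p_deriv:
  assumes "t \<le> T" shows "(p has_real_derivative (p t)\<^sup>2 / C + 2 * \<theta> * p t - 1) (at t within S)"
proof -
  let ?N = "riccati_num \<theta> C (T - t)" and ?D = "riccati_den \<theta> C (T - t)"
  have D: "?D > 0" using riccati_pos[OF C_pos, of "T - t"] assms by simp
  have n: "((\<lambda>t. riccati_num \<theta> C (T - t)) has_real_derivative (?D - \<theta> * ?N) * (- 1)) (at t within S)"
    by (rule DERIV_chain2[OF riccati_deriv(1)[OF C_pos]]) (auto intro!: derivative_eq_intros)
  have d: "((\<lambda>t. riccati_den \<theta> C (T - t)) has_real_derivative (\<theta> * ?D + ?N / C) * (- 1)) (at t within S)"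
    by (rule DERIV_chain2[OF riccati_deriv(2)[OF C_pos]]) (auto intro!: derivative_eq_intros)
  have "(p has_real_derivative ((?D - \<theta> * ?N) * (- 1) * ?D - ?N * ((\<theta> * ?D + ?N / C) * (- 1))) / (?D * ?D)) (at t within S)"
    unfolding p_def[abs_def] by (rule DERIV_divide[OF n d]) (use D in simp)
  also have "((?D - \<theta> * ?N) * (- 1) * ?D - ?N * ((\<theta> * ?D + ?N / C) * (- 1))) / (?D * ?D) = (p t)\<^sup>2 / C + 2 * \<theta> * p t - 1"
    using D C_pos by (simp add: p_def power2_eq_square field_simps)
  finally show ?thesis .
qed

section \<open>Observation times and the variance part of the value\<close>

lemma tau_less: "i < j \<Longrightarrow> j \<le> Suc n \<Longrightarrow> \<tau> i < \<tau> j"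
  using tau_mono by (auto simp: strict_mono_on_def)

lemma tau_le: "i \<le> j \<Longrightarrow> j \<le> Suc n \<Longrightarrow> \<tau> i \<le> \<tau> j"
  using tau_less[of i j] by (cases "i = j") auto

lemma tau_le_T: "i \<le> Suc n \<Longrightarrow> \<tau> i \<le> T"
  using tau_le[of i "Suc n"] tau_T by simp

definition post_variance :: "real \<Rightarrow> real" where "post_variance z = z * \<epsilon>\<^sup>2 / (z + \<epsilon>\<^sup>2)"

lemma post_variance_pos: "z > 0 \<Longrightarrow> post_variance z > 0"
  using eps_pos by (simp add: post_variance_def add_pos_pos)

text \<open>The part of the value that depends on the variance: \<open>pre_value k z\<close> immediately before the
  observation at \<open>\<tau> k\<close>, where \<open>k = n + 1\<close> stands for the final time, and \<open>var_value k s z\<close> at a time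
  \<open>s\<close> after which the next observation is \<open>k\<close>.\<close>

function pre_value :: "nat \<Rightarrow> real \<Rightarrow> real" where
  "pre_value k z = (if k \<le> n then
     ou_variance_integral \<theta> b (\<tau> (Suc k) - \<tau> k) (post_variance z) +
     pre_value (Suc k) (ou_variance \<theta> b (\<tau> (Suc k) - \<tau> k) (post_variance z)) +
     p (\<tau> k) * (z\<^sup>2 / (z + \<epsilon>\<^sup>2)) else z)"
  by auto
termination by (relation "Wellfounded.measure (\<lambda>(k, z). Suc n - k)") auto

declare pre_value.simps [simp del]

definition var_value :: "nat \<Rightarrow> real \<Rightarrow> real \<Rightarrow> real" where
  "var_value k s z = ou_variance_integral \<theta> b (\<tau> k - s) z + pre_value k (ou_variance \<theta> b (\<tau> k - s) z)"

lemma pre_value_last: "pre_value (Suc n) z = z"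
  by (subst pre_value.simps) simp

lemma pre_value_step: "k \<le> n \<Longrightarrow> pre_value k z = var_value (Suc k) (\<tau> k) (post_variance z) + p (\<tau> k) * (z\<^sup>2 / (z + \<epsilon>\<^sup>2))"
  by (subst pre_value.simps) (simp add: var_value_def)

lemma var_value_self: "var_value k (\<tau> k) z = pre_value k z"
  by (simp add: var_value_def)

lemma pre_value_nonneg: "z > 0 \<Longrightarrow> pre_value k z \<ge> 0"
proof (induction k z rule: pre_value.induct)
  case (1 k z)
  show ?case
  proof (cases "k \<le> n")
    case True
    hence h: "\<tau> (Suc k) - \<tau> k \<ge> 0" using tau_le[of k "Suc k"] by simp
    show ?thesis
      using True 1(1)[OF True ou_variance_pos[OF post_variance_pos[OF 1(2)] h]] 1(2) p_pos[of "\<tau> k"] tau_le_T[of k]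
        ou_variance_integral_nonneg[OF post_variance_pos[OF 1(2)] h, of \<theta> b]
      by (subst pre_value.simps) (simp add: add_nonneg_nonneg)
  qed (use 1 in \<open>subst pre_value.simps, simp\<close>)
qed

lemma var_value_nonneg: "z > 0 \<Longrightarrow> s \<le> \<tau> k \<Longrightarrow> var_value k s z \<ge> 0"
  unfolding var_value_def
  by (intro add_nonneg_nonneg pre_value_nonneg ou_variance_integral_nonneg ou_variance_pos) auto

text \<open>No formula for the derivative is kept, because in \<open>var_value_pde\<close> its
  contributions cancel. Positivity of the variance is carried through the recursion and keeps the
  denominators away from zero.\<close>

lemma pre_value_differentiable: "z > 0 \<Longrightarrow> \<exists>D. (pre_value k has_real_derivative D) (at z)"
proof (induction k z rule: pre_value.induct)
  case (1 k z)
  show ?case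
  proof (cases "k \<le> n")
    case True
    let ?h = "\<tau> (Suc k) - \<tau> k"
    have h: "?h \<ge> 0" using tau_le[of k "Suc k"] True by simp
    have pos: "z + \<epsilon>\<^sup>2 > 0" using 1(2) by (simp add: add_pos_nonneg)
    from 1(1)[OF True ou_variance_pos[OF post_variance_pos[OF 1(2)] h]] obtain D where
      D: "(pre_value (Suc k) has_real_derivative D) (at (ou_variance \<theta> b ?h (post_variance z)))" by blast
    have "\<exists>D. (post_variance has_real_derivative D) (at z)"
      unfolding post_variance_def[abs_def] using pos by (auto intro!: exI derivative_eq_intros)
    then obtain D1 where D1: "(post_variance has_real_derivative D1) (at z)" by blast
    have "((\<lambda>z. ou_variance \<theta> b ?h (post_variance z)) has_real_derivative exp (- 2 * \<theta> * ?h) * D1) (at z)"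
      unfolding ou_variance_def by (auto intro!: derivative_eq_intros D1)
    from DERIV_chain2[OF D this] have 2: "((\<lambda>z. pre_value (Suc k) (ou_variance \<theta> b ?h (post_variance z)))
      has_real_derivative D * (exp (- 2 * \<theta> * ?h) * D1)) (at z)" .
    have "\<exists>D. ((\<lambda>z. p (\<tau> k) * (z\<^sup>2 / (z + \<epsilon>\<^sup>2))) has_real_derivative D) (at z)"
      using pos by (auto intro!: exI derivative_eq_intros)
    then obtain D3 where 3: "((\<lambda>z. p (\<tau> k) * (z\<^sup>2 / (z + \<epsilon>\<^sup>2))) has_real_derivative D3) (at z)" by blast
    have 4: "((\<lambda>z. ou_variance_integral \<theta> b ?h (post_variance z)) has_real_derivative exp_integral \<theta> ?h * D1) (at z)"
      unfolding ou_variance_integral_def by (auto intro!: derivative_eq_intros D1)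
    have eq: "pre_value k = (\<lambda>z. ou_variance_integral \<theta> b ?h (post_variance z) + 
       pre_value (Suc k) (ou_variance \<theta> b ?h (post_variance z)) + p (\<tau> k) * (z\<^sup>2 / (z + \<epsilon>\<^sup>2)))"
      using True by (intro ext) (subst pre_value.simps, simp)
    show ?thesis unfolding eq using DERIV_add[OF DERIV_add[OF 4 2] 3] by blast
  next
    case False
    hence "pre_value k = (\<lambda>z. z)" by (intro ext) (subst pre_value.simps, simp)
    thus ?thesis by (auto intro!: exI derivative_eq_intros)
  qed
qed

text \<open>For a fixed next node, \<open>pre_value k\<close> is evaluated along the variance flow,
  so its derivative drops out by the transport equation; what remains is the equation of the
  integrated variance.\<close>

lemma var_value_pde:
  assumes "z > 0" "s \<le> \<tau> k"
  obtains Ws Wz where "((\<lambda>r. var_value k r z) has_real_derivative Ws) (at s within S)"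
    "((\<lambda>z'. var_value k s z') has_real_derivative Wz) (at z)" "Ws + z + (b\<^sup>2 - 2 * \<theta> * z) * Wz = 0"
proof -
  let ?h = "\<tau> k - s"
  have h: "?h \<ge> 0" using assms by simp
  obtain D where D: "(pre_value k has_real_derivative D) (at (ou_variance \<theta> b ?h z))"
    using pre_value_differentiable[OF ou_variance_pos[OF assms(1) h]] by blast
  have hd: "((\<lambda>r. \<tau> k - r) has_real_derivative - 1) (at s within S)" by (auto intro!: derivative_eq_intros)
  have 1: "((\<lambda>r. ou_variance_integral \<theta> b (\<tau> k - r) z) has_real_derivative ou_variance \<theta> b ?h z * (- 1)) (at s within S)"
    by (rule DERIV_chain2[OF ou_variance_integral_deriv hd])
  have 2: "((\<lambda>r. ou_variance \<theta> b (\<tau> k - r) z) has_real_derivative exp (- 2 * \<theta> * ?h) * (b\<^sup>2 - 2 * \<theta> * z) * (- 1)) (at s within S)"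
    by (rule DERIV_chain2[OF ou_variance_deriv hd])
  note s = DERIV_add[OF 1 DERIV_chain2[OF D 2]]
  have 3: "((\<lambda>z. ou_variance_integral \<theta> b ?h z) has_real_derivative exp_integral \<theta> ?h) (at z)"
    unfolding ou_variance_integral_def by (auto intro!: derivative_eq_intros)
  have 4: "((\<lambda>z. ou_variance \<theta> b ?h z) has_real_derivative exp (- 2 * \<theta> * ?h)) (at z)"
    unfolding ou_variance_def by (auto intro!: derivative_eq_intros)
  note z = DERIV_add[OF 3 DERIV_chain2[OF D 4]]
  have e: "exp (- 2 * \<theta> * ?h) = 1 - 2 * \<theta> * exp_integral \<theta> ?h" using exp_integral_eq[of \<theta> ?h] by linarith
  show ?thesis
  proof (rule that[OF s[folded var_value_def] z[folded var_value_def]])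
    show "ou_variance \<theta> b ?h z * (- 1) + D * (exp (- 2 * \<theta> * ?h) * (b\<^sup>2 - 2 * \<theta> * z) * (- 1)) + z + 
      (b\<^sup>2 - 2 * \<theta> * z) * (exp_integral \<theta> ?h + D * exp (- 2 * \<theta> * ?h)) = 0"
      unfolding ou_variance_def e by algebra
  qed
qed

text \<open>The variables separate: the Riccati equation settles the coefficient of
  \<open>m\<^sup>2\<close> and \<open>var_value_pde\<close> the rest. The set \<open>S\<close> is
  left free to allow one-sided time derivatives at observation times.\<close>

lemma value_hjb:
  assumes "z > 0" "t \<le> \<tau> k" "t \<le> T"
  obtains Ut Um Uz where "((\<lambda>r. p r * m\<^sup>2 + var_value k r z) has_real_derivative Ut) (at t within S)"
    "((\<lambda>m'. p t * m'\<^sup>2 + var_value k t z) has_real_derivative Um) (at m)"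
    "((\<lambda>z'. p t * m\<^sup>2 + var_value k t z') has_real_derivative Uz) (at z)"
    "Ut + z + m\<^sup>2 - \<theta> * m * Um + (b\<^sup>2 - 2 * \<theta> * z) * Uz - 1 / (4 * C) * Um\<^sup>2 = 0"
proof -
  obtain Ws Wz where W: "((\<lambda>r. var_value k r z) has_real_derivative Ws) (at t within S)"
    "((\<lambda>z'. var_value k t z') has_real_derivative Wz) (at z)" "Ws + z + (b\<^sup>2 - 2 * \<theta> * z) * Wz = 0"
    by (rule var_value_pde[OF assms(1,2)])
  show ?thesis
  proof (rule that)
    show "((\<lambda>r. p r * m\<^sup>2 + var_value k r z) has_real_derivative ((p t)\<^sup>2 / C + 2 * \<theta> * p t - 1) * m\<^sup>2 + Ws) (at t within S)"
      by (intro DERIV_add W DERIV_cmult_right p_deriv assms)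
    show "((\<lambda>m'. p t * m'\<^sup>2 + var_value k t z) has_real_derivative 2 * p t * m) (at m)"
      by (auto intro!: derivative_eq_intros)
    show "((\<lambda>z'. p t * m\<^sup>2 + var_value k t z') has_real_derivative Wz) (at z)"
      using DERIV_add[OF DERIV_const W(2)] by simp
    have q: "1 / (4 * C) * (2 * p t * m)\<^sup>2 = (p t)\<^sup>2 / C * m\<^sup>2" using C_pos by (simp add: power_mult_distrib field_simps)
    show "((p t)\<^sup>2 / C + 2 * \<theta> * p t - 1) * m\<^sup>2 + Ws + z + m\<^sup>2 - \<theta> * m * (2 * p t * m) +
      (b\<^sup>2 - 2 * \<theta> * z) * Wz - 1 / (4 * C) * (2 * p t * m)\<^sup>2 = 0"
      unfolding q using W(3) by algebra
  qed
qed

end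

section \<open>The filter between two observations\<close>

lemma primitive_on_minus:
  assumes "primitive_on r t F f" "primitive_on r t G g"
  shows "primitive_on r t (\<lambda>u. F u - G u) (\<lambda>u. f u - g u)"
  unfolding primitive_on_def
proof (intro conjI ballI)
  show "set_integrable lborel {r..t} (\<lambda>u. f u - g u)"
    by (rule set_integral_diff(1)[OF primitive_on_integrable[OF assms(1)] primitive_on_integrable[OF assms(2)]])
  fix u assume u: "u \<in> {r..t}"
  have "set_integrable lborel {r..u} f" "set_integrable lborel {r..u} g"
    using set_integrable_Icc_subset[OF primitive_on_integrable[OF assms(1)], of r u]
      set_integrable_Icc_subset[OF primitive_on_integrable[OF assms(2)], of r u] u by auto
  from set_integral_diff(2)[OF this]
  show "F u - G u = F r - G r + (LINT v:{r..u}|lborel. f v - g v)"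
    using primitive_onD[OF assms(1), of u] primitive_onD[OF assms(2), of u] u by simp
qed

text \<open>Both sides may be infinite.\<close>

lemma nn_integral_balance:
  fixes f1 f2 :: "real \<Rightarrow> real"
  assumes meas: "(\<lambda>v. indicator S v * f1 v) \<in> borel_measurable lborel"
    and g: "set_integrable lborel S (\<lambda>v. f2 v - f1 v)"
    and nn: "\<And>v. v \<in> S \<Longrightarrow> f1 v \<ge> 0" "\<And>v. v \<in> S \<Longrightarrow> f2 v \<ge> 0" "x \<ge> 0" "y \<ge> 0"
    and eq: "y - x = (LINT v:S|lborel. f2 v - f1 v)"
  shows "(\<integral>\<^sup>+v\<in>S. ennreal (f1 v) \<partial>lborel) + ennreal y = ennreal x + (\<integral>\<^sup>+v\<in>S. ennreal (f2 v) \<partial>lborel)"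
proof -
  define F1 where "F1 v = indicator S v * f1 v" for v
  define F2 where "F2 v = indicator S v * f2 v" for v
  define G where "G v = indicator S v * (f2 v - f1 v)" for v
  have G: "integrable lborel G" using g by (simp add: set_integrable_def G_def[abs_def])
  have nn': "F1 v \<ge> 0" "F2 v \<ge> 0" for v using nn by (auto simp: F1_def F2_def indicator_def)
  have s: "F2 v = F1 v + G v" "F1 v = F2 v - G v" for v by (auto simp: F1_def F2_def G_def algebra_simps)
  have m1: "F1 \<in> borel_measurable lborel" using meas by (simp add: F1_def[abs_def])
  have m2: "F2 \<in> borel_measurable lborel" using m1 G by (simp add: s(1)[abs_def] borel_measurable_integrable)
  have e: "(\<integral>\<^sup>+v\<in>S. ennreal (f1 v) \<partial>lborel) = (\<integral>\<^sup>+v. ennreal (F1 v) \<partial>lborel)"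
    "(\<integral>\<^sup>+v\<in>S. ennreal (f2 v) \<partial>lborel) = (\<integral>\<^sup>+v. ennreal (F2 v) \<partial>lborel)"
    by (auto intro!: nn_integral_cong simp: F1_def F2_def indicator_def)
  have ig: "(\<integral>v. G v \<partial>lborel) = y - x" using eq by (simp add: set_lebesgue_integral_def G_def)
  show ?thesis
  \<comment> \<open>The two integrands differ by an integrable function, so either both are
    integrable or both integrals are infinite.\<close>
  proof (cases "integrable lborel F1")
    case True
    hence 2: "integrable lborel F2" unfolding s(1)[abs_def] using G by simp
    have "(\<integral>v. F2 v \<partial>lborel) = (\<integral>v. F1 v \<partial>lborel) + (y - x)" unfolding s(1) using True G ig by simp
    moreover have "(\<integral>v. F1 v \<partial>lborel) \<ge> 0" "(\<integral>v. F2 v \<partial>lborel) \<ge> 0" using nn' by (auto intro: integral_nonneg_AE)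
    ultimately show ?thesis unfolding e using nn nn'
      by (simp add: nn_integral_eq_integral[OF True] nn_integral_eq_integral[OF 2] flip: ennreal_plus)
  next
    case False
    hence 2: "\<not> integrable lborel F2" using G unfolding s(2)[abs_def]
      by (metis (no_types, lifting) Bochner_Integration.integrable_diff s(2)[abs_def] ext)
    have "(\<integral>\<^sup>+v. ennreal (F1 v) \<partial>lborel) = \<infinity>" "(\<integral>\<^sup>+v. ennreal (F2 v) \<partial>lborel) = \<infinity>"
      using False 2 m1 m2 nn' by (auto simp: integrable_iff_bounded less_top[symmetric])
    thus ?thesis unfolding e by simp
  qed
qed

text \<open>Monotone exhaustion of the half-open interval. It is used where an identity is known
  only up to times before the next observation.\<close>

lemma LIMSEQ_nn_integral_Icc:
  assumes "\<And>k. u k < t" "incseq u" "u \<longlonglongrightarrow> (t::real)" "f \<in> borel_measurable lborel"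
  shows "(\<lambda>k. \<integral>\<^sup>+v\<in>{r..u k}. f v \<partial>lborel) \<longlonglongrightarrow> (\<integral>\<^sup>+v\<in>{r..<t}. f v \<partial>lborel)"
proof -
  have un: "(\<Union>k. {r..u k}) = {r..<t}"
  proof (intro equalityI subsetI)
    fix x assume x: "x \<in> {r..<t}"
    hence "eventually (\<lambda>k. u k > x) sequentially" using order_tendstoD(1)[OF assms(3), of x] by simp
    then obtain k where "u k > x" using eventually_sequentially by auto
    thus "x \<in> (\<Union>k. {r..u k})" using x by (auto intro!: exI[of _ k])
  next
    fix x assume "x \<in> (\<Union>k. {r..u k})"
    then obtain k where "r \<le> x" "x \<le> u k" by auto
    thus "x \<in> {r..<t}" using assms(1)[of k] by simp
  qed
  have "(\<lambda>k. emeasure (density lborel f) {r..u k}) \<longlonglongrightarrow> emeasure (density lborel f) (\<Union>k. {r..u k})"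
    using assms(2) by (intro Lim_emeasure_incseq) (auto simp: incseq_def intro: order_trans)
  thus ?thesis unfolding un using assms(4) by (simp add: emeasure_density)
qed

text \<open>\<open>U\<close> plays the predicted mean, \<open>X\<close> the state sample,
  \<open>N\<close> the noise and \<open>c\<close> the gain. Given \<open>U\<close>, the correction
  is centred with variance \<open>c\<^sup>2 * (z + e\<^sup>2)\<close>. With nonnegative integrals
  the identity also holds when \<open>U\<close> has infinite second moment.\<close>

lemma cond_gaussian_second_moment:
  fixes U X N :: "'a \<Rightarrow> real"
  assumes "prob_space P" "z > 0"
    and [measurable]: "U \<in> borel_measurable P" "X \<in> borel_measurable P" "N \<in> borel_measurable P"
    and law: "\<And>A B D. A \<in> sets borel \<Longrightarrow> B \<in> sets borel \<Longrightarrow> D \<in> sets borel \<Longrightarrow>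
      emeasure P {\<omega>\<in>space P. U \<omega> \<in> A \<and> X \<omega> \<in> B \<and> N \<omega> \<in> D} =
      (\<integral>\<^sup>+\<omega>. indicator A (U \<omega>) * emeasure (gaussian (U \<omega>) z) B \<partial>P) * emeasure (gaussian 0 1) D"
  shows "(\<integral>\<^sup>+\<omega>. ennreal ((U \<omega> + c * (X \<omega> + e * N \<omega> - U \<omega>))\<^sup>2) \<partial>P) = 
    (\<integral>\<^sup>+\<omega>. ennreal ((U \<omega>)\<^sup>2) \<partial>P) + ennreal (c\<^sup>2 * (z + e\<^sup>2))"
proof -
  interpret P: prob_space P by fact
  let ?\<gamma> = "gaussian 0 1"
  interpret G: prob_space ?\<gamma> by (rule prob_space_gaussian) simp
  interpret GG: pair_prob_space ?\<gamma> ?\<gamma> ..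
  interpret D: prob_space "distr P borel U" by (rule P.prob_space_distr) simp
  interpret DG: pair_prob_space "distr P borel U" "?\<gamma> \<Otimes>\<^sub>M ?\<gamma>" ..
  let ?R = "borel \<Otimes>\<^sub>M (borel \<Otimes>\<^sub>M borel) :: (real \<times> real \<times> real) measure"
  let ?S = "distr P borel U \<Otimes>\<^sub>M (?\<gamma> \<Otimes>\<^sub>M ?\<gamma>)"
  have setsS: "sets ?S = sets ?R" by (intro sets_pair_measure_cong) auto
  define \<Phi> where "\<Phi> = (\<lambda>(u, w, v). (u, u + sqrt z * w, v) :: real \<times> real \<times> real)"
  have \<Phi>: "\<Phi> \<in> ?S \<rightarrow>\<^sub>M ?R" unfolding \<Phi>_def measurable_cong_sets[OF setsS refl] by measurable
  define E where "E = {A \<times> B \<times> D | A B D. A \<in> sets (borel::real measure) \<and> B \<in> sets (borel::real measure) \<and> D \<in> sets (borel::real measure)}"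
  have E_I: "A \<times> B \<times> D \<in> E" if "A \<in> sets borel" "B \<in> sets borel" "D \<in> sets borel" for A B D
    unfolding E_def by (rule CollectI, rule exI[of _ A], rule exI[of _ B], rule exI[of _ D]) (simp add: that)
  have E_eq: "E = {a \<times> b | a b. a \<in> sets (borel::real measure) \<and> b \<in> {B \<times> D | B D. B \<in> sets (borel::real measure) \<and> D \<in> sets (borel::real measure)}}"
    unfolding E_def by blast
  have setsR: "sets ?R = sigma_sets UNIV E"
  proof -
    have "sets ?R = sets (sigma (space borel \<times> space (borel \<Otimes>\<^sub>M borel)) E)"
      unfolding E_eq
    proof (rule sets_pair_eq[where Ca = "{UNIV}" and Cb = "{UNIV \<times> UNIV}"])
      show "sets (borel \<Otimes>\<^sub>M borel) = sigma_sets (space (borel \<Otimes>\<^sub>M borel)) 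
        {B \<times> D | B D. B \<in> sets (borel::real measure) \<and> D \<in> sets (borel::real measure)}"
        by (simp add: sets_pair_measure space_pair_measure)
    qed (auto simp: space_pair_measure sets.sigma_sets_eq[of borel, simplified] intro!: exI[of _ UNIV])
    thus ?thesis by (simp add: space_pair_measure)
  qed
  \<comment> \<open>The hypothesis \<open>law\<close> speaks about boxes. They form an
    intersection-stable generator, so it determines the joint law as the image of a product law
    under \<open>\<Phi>\<close>.\<close>
  have eq: "distr P ?R (\<lambda>\<omega>. (U \<omega>, X \<omega>, N \<omega>)) = distr ?S ?R \<Phi>"
  proof (rule measure_eqI_generator_eq[where E = E and \<Omega> = UNIV and A = "\<lambda>_. UNIV"])
    show "Int_stable E"
      unfolding Int_stable_def
    proof (intro ballI)
      fix Y Y' assume "Y \<in> E" "Y' \<in> E"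
      then obtain A B D A' B' D' where Y: "Y = A \<times> B \<times> D" "Y' = A' \<times> B' \<times> D'" and
        s: "A \<in> sets borel" "B \<in> sets borel" "D \<in> sets borel" "A' \<in> sets borel" "B' \<in> sets borel" "D' \<in> sets borel"
        unfolding E_def by blast
      have "Y \<inter> Y' = (A \<inter> A') \<times> (B \<inter> B') \<times> (D \<inter> D')" unfolding Y by auto
      moreover have "A \<inter> A' \<in> sets borel" "B \<inter> B' \<in> sets borel" "D \<inter> D' \<in> sets borel"
        using s by (simp_all only: sets.Int)
      ultimately show "Y \<inter> Y' \<in> E" by (simp only: E_I)
    qed
    have "UNIV = (UNIV :: real set) \<times> (UNIV :: real set) \<times> (UNIV :: real set)" by simp
    moreover have "(UNIV :: real set) \<times> (UNIV :: real set) \<times> (UNIV :: real set) \<in> E" by (intro E_I) auto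
    ultimately have "UNIV \<in> E" by simp
    thus "range (\<lambda>_::nat. UNIV) \<subseteq> E" by blast
    show "(\<Union>i::nat. UNIV) = (UNIV :: (real \<times> real \<times> real) set)" by simp
    show "emeasure (distr P ?R (\<lambda>\<omega>. (U \<omega>, X \<omega>, N \<omega>))) UNIV \<noteq> \<infinity>" for i :: nat
    proof -
      interpret D3: prob_space "distr P ?R (\<lambda>\<omega>. (U \<omega>, X \<omega>, N \<omega>))" by (rule P.prob_space_distr) measurable
      show ?thesis by simp
    qed
    show "E \<subseteq> Pow UNIV" by simp
    show "sets (distr P ?R (\<lambda>\<omega>. (U \<omega>, X \<omega>, N \<omega>))) = sigma_sets UNIV E" "sets (distr ?S ?R \<Phi>) = sigma_sets UNIV E"
      using setsR by simp_all
    fix Y assume "Y \<in> E"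
    then obtain A B D where Y: "Y = A \<times> B \<times> D" and s: "A \<in> sets borel" "B \<in> sets borel" "D \<in> sets borel"
      unfolding E_def by blast
    note [measurable] = s
    have YR: "Y \<in> sets ?R" unfolding Y using s by (intro pair_measureI) auto
    have "emeasure (distr P ?R (\<lambda>\<omega>. (U \<omega>, X \<omega>, N \<omega>))) Y = emeasure P {\<omega>\<in>space P. U \<omega> \<in> A \<and> X \<omega> \<in> B \<and> N \<omega> \<in> D}"
      using YR by (subst emeasure_distr) (auto simp: Y intro!: arg_cong[where f = "emeasure P"])
    also have "\<dots> = (\<integral>\<^sup>+\<omega>. indicator A (U \<omega>) * emeasure (gaussian (U \<omega>) z) B \<partial>P) * emeasure ?\<gamma> D"
      by (rule law[OF s])
    also have "\<dots> = (\<integral>\<^sup>+\<omega>. indicator A (U \<omega>) * emeasure (gaussian (U \<omega>) z) B * emeasure ?\<gamma> D \<partial>P)"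
    proof (rule nn_integral_multc[symmetric])
      have "(\<lambda>m. emeasure (gaussian m z) B) \<in> borel_measurable borel"
        using measurable_compose[OF measurable_prob_algebraD[OF gaussian_measurable_mean[OF assms(2)]] measurable_emeasure_subprob_algebra[OF s(2)]] .
      thus "(\<lambda>\<omega>. indicator A (U \<omega>) * emeasure (gaussian (U \<omega>) z) B) \<in> borel_measurable P" by measurable
    qed
    also have "\<dots> = (\<integral>\<^sup>+\<omega>. emeasure (?\<gamma> \<Otimes>\<^sub>M ?\<gamma>) (Pair (U \<omega>) -` (\<Phi> -` Y \<inter> space ?S)) \<partial>P)"
    proof (rule nn_integral_cong)
      fix \<omega>
      have "Pair (U \<omega>) -` (\<Phi> -` Y \<inter> space ?S) = (if U \<omega> \<in> A then ((\<lambda>w. U \<omega> + sqrt z * w) -` B) \<times> D else {})"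
        by (auto simp: \<Phi>_def Y space_pair_measure)
      moreover have "(\<lambda>w. U \<omega> + sqrt z * w) -` B \<in> sets borel"
        using measurable_sets[of "\<lambda>w. U \<omega> + sqrt z * w" borel borel B] s by simp
      moreover have "emeasure (gaussian (U \<omega>) z) B = emeasure ?\<gamma> ((\<lambda>w. U \<omega> + sqrt z * w) -` B)"
        unfolding gaussian_eq_distr[OF assms(2), of "U \<omega>"] using s by (subst emeasure_distr) auto
      ultimately show "indicator A (U \<omega>) * emeasure (gaussian (U \<omega>) z) B * emeasure ?\<gamma> D =
         emeasure (?\<gamma> \<Otimes>\<^sub>M ?\<gamma>) (Pair (U \<omega>) -` (\<Phi> -` Y \<inter> space ?S))"
        using s by (simp add: G.emeasure_pair_measure_Times)
    qed
    also have "\<dots> = (\<integral>\<^sup>+u. emeasure (?\<gamma> \<Otimes>\<^sub>M ?\<gamma>) (Pair u -` (\<Phi> -` Y \<inter> space ?S)) \<partial>distr P borel U)"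
    proof (rule nn_integral_distr[symmetric])
      show "(\<lambda>u. emeasure (?\<gamma> \<Otimes>\<^sub>M ?\<gamma>) (Pair u -` (\<Phi> -` Y \<inter> space ?S))) \<in> borel_measurable (distr P borel U)"
        by (rule GG.measurable_emeasure_Pair[OF measurable_sets[OF \<Phi> YR]])
    qed simp
    also have "\<dots> = emeasure ?S (\<Phi> -` Y \<inter> space ?S)"
      using measurable_sets[OF \<Phi> YR] by (rule GG.emeasure_pair_measure_alt[symmetric])
    also have "\<dots> = emeasure (distr ?S ?R \<Phi>) Y" using \<Phi> YR by (simp add: emeasure_distr)
    finally show "emeasure (distr P ?R (\<lambda>\<omega>. (U \<omega>, X \<omega>, N \<omega>))) Y = emeasure (distr ?S ?R \<Phi>) Y" .
  qed
  define g where "g = (\<lambda>(u, x, v). ennreal ((u + c * (x + e * v - u))\<^sup>2))"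
  have g: "g \<in> borel_measurable ?R" unfolding g_def by measurable
  have gS: "(\<lambda>p. g (\<Phi> p)) \<in> borel_measurable ?S" using measurable_compose[OF \<Phi> g] .
  have "(\<integral>\<^sup>+\<omega>. ennreal ((U \<omega> + c * (X \<omega> + e * N \<omega> - U \<omega>))\<^sup>2) \<partial>P) = (\<integral>\<^sup>+p. g p \<partial>distr P ?R (\<lambda>\<omega>. (U \<omega>, X \<omega>, N \<omega>)))"
    using g by (subst nn_integral_distr) (auto simp: g_def)
  also have "\<dots> = (\<integral>\<^sup>+p. g (\<Phi> p) \<partial>?S)" unfolding eq using \<Phi> g by (subst nn_integral_distr) auto
  also have "\<dots> = (\<integral>\<^sup>+u. \<integral>\<^sup>+q. g (\<Phi> (u, q)) \<partial>(?\<gamma> \<Otimes>\<^sub>M ?\<gamma>) \<partial>distr P borel U)"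
    by (rule GG.nn_integral_fst[OF gS, symmetric])
  also have "\<dots> = (\<integral>\<^sup>+u. ennreal (u\<^sup>2) + ennreal (c\<^sup>2 * (z + e\<^sup>2)) \<partial>distr P borel U)"
  proof (rule nn_integral_cong)
    fix u :: real
    have m: "(\<lambda>q. g (\<Phi> (u, q))) \<in> borel_measurable (?\<gamma> \<Otimes>\<^sub>M ?\<gamma>)"
      using measurable_Pair2[OF gS] by simp
    have "(\<integral>\<^sup>+q. g (\<Phi> (u, q)) \<partial>(?\<gamma> \<Otimes>\<^sub>M ?\<gamma>)) = (\<integral>\<^sup>+w. \<integral>\<^sup>+v. g (\<Phi> (u, w, v)) \<partial>?\<gamma> \<partial>?\<gamma>)"
      by (rule G.nn_integral_fst[OF m, symmetric])
    also have "\<dots> = (\<integral>\<^sup>+w. \<integral>\<^sup>+v. ennreal (((u + c * sqrt z * w) + c * e * v)\<^sup>2) \<partial>?\<gamma> \<partial>?\<gamma>)"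
      by (simp add: g_def \<Phi>_def algebra_simps)
    also have "\<dots> = (\<integral>\<^sup>+w. ennreal ((u + c * sqrt z * w)\<^sup>2) + ennreal ((c * e)\<^sup>2) \<partial>?\<gamma>)"
      unfolding std_gaussian_affine_square by (simp add: ennreal_plus)
    also have "\<dots> = ennreal (u\<^sup>2 + (c * sqrt z)\<^sup>2) + ennreal ((c * e)\<^sup>2)"
      using G.emeasure_space_1 by (subst nn_integral_add) (auto simp: std_gaussian_affine_square)
    also have "\<dots> = ennreal (u\<^sup>2) + ennreal (c\<^sup>2 * (z + e\<^sup>2))"
      using assms(2) by (simp add: power_mult_distrib algebra_simps flip: ennreal_plus)
    finally show "(\<integral>\<^sup>+q. g (\<Phi> (u, q)) \<partial>(?\<gamma> \<Otimes>\<^sub>M ?\<gamma>)) = ennreal (u\<^sup>2) + ennreal (c\<^sup>2 * (z + e\<^sup>2))" .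
  qed
  also have "\<dots> = (\<integral>\<^sup>+\<omega>. ennreal ((U \<omega>)\<^sup>2) \<partial>P) + ennreal (c\<^sup>2 * (z + e\<^sup>2))"
    using P.emeasure_space_1 by (subst nn_integral_distr, simp, simp, subst nn_integral_add) auto
  finally show ?thesis .
qed

context observed_ou
begin

text \<open>Filter between two observations, with \<open>L\<close> the law immediately before the second one.\<close>

lemma interval_path:
  fixes a :: "real \<Rightarrow> real" and m z r t :: real
  defines "M \<equiv> \<lambda>u. exp (- \<theta> * (u - r)) * m + (LINT v:{r..u}|lborel. exp (- \<theta> * (u - v)) * a v)"
  assumes rt: "r < t" "t \<le> T" and z: "z > 0" and init: "\<mu> r = gaussian m z"
    and mu: "\<And>u. u \<in> {r..<t} \<Longrightarrow> prob_space (\<mu> u)" "\<And>u. u \<in> {r..<t} \<Longrightarrow> sets (\<mu> u) = sets borel"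
      "\<And>u. u \<in> {r..<t} \<Longrightarrow> has_second_moment (\<mu> u)" "\<And>u. u \<in> {r..<t} \<Longrightarrow> weak_evolution \<theta> b a \<mu> r u"
    and L: "prob_space L" "sets L = sets borel"
      "\<And>f. test_function f \<Longrightarrow> ((\<lambda>u. \<integral>x. f x \<partial>\<mu> u) \<longlongrightarrow> (\<integral>x. f x \<partial>L)) (at_left t)"
    and a: "(\<lambda>u. indicator {r..t} u * a u) \<in> borel_measurable borel"
  shows "\<And>u. u \<in> {r..<t} \<Longrightarrow> \<mu> u = gaussian (M u) (ou_variance \<theta> b (u - r) z)"
    and "L = gaussian (\<integral>x. x \<partial>L) (ou_variance \<theta> b (t - r) z)"
    and "(\<integral>\<^sup>+u\<in>{r..<t}. ennreal ((M u)\<^sup>2 + ou_variance \<theta> b (u - r) z + C * (a u)\<^sup>2) \<partial>lborel) + ennreal (p t * (\<integral>x. x \<partial>L)\<^sup>2) =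
      ennreal (p r * m\<^sup>2 + ou_variance_integral \<theta> b (t - r) z) +
      (\<integral>\<^sup>+u\<in>{r..<t}. ennreal (C * (a u + p u * M u / C)\<^sup>2) \<partial>lborel)"
proof -
  \<comment> \<open>Only intervals that end strictly before \<open>t\<close> are used: at
    \<open>t\<close> an observation may already have changed the law.\<close>
  have path: "weak_ou_path \<theta> b a \<mu> r u" if "u \<in> {r..<t}" for u
  proof (rule weak_ou_path.intro)
    show "r \<le> u" using that by simp
    fix v assume "v \<in> {r..u}"
    hence "v \<in> {r..<t}" using that by auto
    thus "prob_space (\<mu> v)" "sets (\<mu> v) = sets borel" "has_second_moment (\<mu> v)"
      "weak_evolution \<theta> b a \<mu> r v" by (rule mu)+
  qed
  have Z: "ou_variance \<theta> b (u - r) z > 0" if "u \<ge> r" for u using that z by (intro ou_variance_pos) auto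
  show gauss: "\<mu> u = gaussian (M u) (ou_variance \<theta> b (u - r) z)" if "u \<in> {r..<t}" for u
    using weak_ou_path.gaussian_preserved[OF path[OF that] z init] by (simp add: M_def)
  have local_mean: "(\<integral>x. x \<partial>\<mu> u) = M u" if "u \<in> {r..<t}" for u
    using gauss[OF that] gaussian_moments(2)[OF Z, of u] that by simp
  have ev: "\<forall>\<^sub>F u in at_left t. u \<in> {r..<t}"
    using eventually_at_left[OF rt(1)] rt(1) by (auto intro!: exI[of _ r])
  let ?mL = "\<integral>x. x \<partial>L"
  have Mlim: "(M \<longlongrightarrow> ?mL) (at_left t)"
    by (rule Lim_transform_eventually[OF L(3)[OF test_function_id(1)]])
      (use ev in \<open>eventually_elim, simp add: local_mean\<close>)
  have Zlim: "((\<lambda>u. ou_variance \<theta> b (u - r) z) \<longlongrightarrow> ou_variance \<theta> b (t - r) z) (at_left t)"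
  proof -
    have "isCont (\<lambda>u. ou_variance \<theta> b (u - r) z) t"
      by (rule DERIV_isCont[OF DERIV_chain2[OF ou_variance_deriv]]) (auto intro!: derivative_eq_intros)
    thus ?thesis by (auto simp: isCont_def intro: tendsto_mono[OF at_le])
  qed
  \<comment> \<open>Limits of Gaussian laws are identified through their cosine transforms, whose
    means and variances converge from the left.\<close>
  show "L = gaussian ?mL (ou_variance \<theta> b (t - r) z)"
  proof (rule gaussian_eqI[OF L(1,2)])
    show "0 < ou_variance \<theta> b (t - r) z" using Z rt by simp
    fix k c
    have "((\<lambda>u. \<integral>x. cos (k * x + c) \<partial>\<mu> u) \<longlongrightarrow> (\<integral>x. cos (k * x + c) \<partial>L)) (at_left t)"
      by (rule L(3)[OF test_function_cos(1)])
    hence 1: "((\<lambda>u. exp (- (k\<^sup>2 * ou_variance \<theta> b (u - r) z) / 2) * cos (k * M u + c)) \<longlongrightarrow> 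
        (\<integral>x. cos (k * x + c) \<partial>L)) (at_left t)"
      by (rule Lim_transform_eventually) 
        (use ev in \<open>eventually_elim, simp add: gauss gaussian_cos[OF Z]\<close>)
    have 2: "((\<lambda>u. exp (- (k\<^sup>2 * ou_variance \<theta> b (u - r) z) / 2) * cos (k * M u + c)) \<longlongrightarrow> 
        exp (- (k\<^sup>2 * ou_variance \<theta> b (t - r) z) / 2) * cos (k * ?mL + c)) (at_left t)"
      by (intro tendsto_intros Mlim Zlim) auto
    show "(\<integral>x. cos (k * x + c) \<partial>L) = exp (- (k\<^sup>2 * ou_variance \<theta> b (t - r) z) / 2) * cos (k * ?mL + c)"
      by (rule tendsto_unique[OF _ 1 2]) simp
  qed
  define f1 where "f1 u = (M u)\<^sup>2 + ou_variance \<theta> b (u - r) z + C * (a u)\<^sup>2" for u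
  define f2 where "f2 u = C * (a u + p u * M u / C)\<^sup>2" for u
  define RI where "RI u = ou_variance_integral \<theta> b (u - r) z" for u
  have Mr: "M r = m" unfolding M_def set_integral_Icc_refl by simp
  have prim: "primitive_on r u M (\<lambda>v. - \<theta> * M v + a v)" if u: "u \<in> {r..<t}" for u
  proof -
    interpret weak_ou_path \<theta> b a \<mu> r u by (rule path[OF u])
    have 1: "mean v = M v" if "v \<in> {r..u}" for v
    proof -
      have "v \<in> {r..<t}" using that u by auto
      thus ?thesis unfolding mean_def by (rule local_mean)
    qed
    have p: "primitive_on r u mean (\<lambda>v. - \<theta> * M v + a v)"
      by (rule primitive_on_cong[OF mean_primitive]) (simp only: 1)
    show ?thesis unfolding primitive_on_def
    proof (intro conjI ballI)
      show "set_integrable lborel {r..u} (\<lambda>v. - \<theta> * M v + a v)" by (rule primitive_on_integrable[OF p])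
      fix v assume v: "v \<in> {r..u}"
      hence "r \<in> {r..u}" by auto
      thus "M v = M r + (LINT w:{r..v}|lborel. - \<theta> * M w + a w)"
        using primitive_onD[OF p, of v] v 1[OF v] 1[of r] by simp
    qed
  qed
  have RI_prim: "primitive_on r u RI (\<lambda>v. ou_variance \<theta> b (v - r) z)" if "r \<le> u" for u
  proof (rule primitive_on_C1[OF that])
    show "(RI has_real_derivative ou_variance \<theta> b (v - r) z) (at v within {r..u})" for v
      unfolding RI_def[abs_def]
    proof -
      have "((\<lambda>v. v - r) has_real_derivative 1) (at v within {r..u})" by (auto intro!: derivative_eq_intros)
      from DERIV_chain2[OF ou_variance_integral_deriv[where \<theta> = \<theta> and b = b and z = z] this]
      show "((\<lambda>u. ou_variance_integral \<theta> b (u - r) z) has_real_derivative ou_variance \<theta> b (v - r) z) (at v within {r..u})"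
        by simp
    qed
    show "continuous_on {r..u} (\<lambda>v. ou_variance \<theta> b (v - r) z)"
      by (intro DERIV_continuous_on[OF DERIV_chain2[OF ou_variance_deriv]]) (auto intro!: derivative_eq_intros)
  qed
  have f1_nn: "f1 u \<ge> 0" if "r \<le> u" for u using Z[OF that] C_pos by (simp add: f1_def)
  have f2_nn: "f2 u \<ge> 0" for u using C_pos by (simp add: f2_def)
  have RI_nn: "RI u \<ge> 0" if "r \<le> u" for u unfolding RI_def using that z by (intro ou_variance_integral_nonneg) auto
  have p_nn: "p u \<ge> 0" if "u \<le> T" for u using p_pos[OF that] by simp
  have balance: "(\<integral>\<^sup>+v\<in>{r..u}. ennreal (f1 v) \<partial>lborel) + ennreal (p u * (M u)\<^sup>2) =
      ennreal (p r * m\<^sup>2 + RI u) + (\<integral>\<^sup>+v\<in>{r..u}. ennreal (f2 v) \<partial>lborel)" if u: "u \<in> {r..<t}" for u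
  proof -
    have uT: "u \<le> T" "r \<le> T" "r \<le> u" using u rt by auto
    have p: "primitive_on r u p (\<lambda>v. (p v)\<^sup>2 / C + 2 * \<theta> * p v - 1)"
    proof (rule primitive_on_C1[OF uT(3)])
      show d: "(p has_real_derivative (p v)\<^sup>2 / C + 2 * \<theta> * p v - 1) (at v within {r..u})" if "v \<in> {r..u}" for v
        using that uT by (intro p_deriv) auto
      have "continuous_on {r..u} p" by (rule DERIV_continuous_on[OF d])
      thus "continuous_on {r..u} (\<lambda>v. (p v)\<^sup>2 / C + 2 * \<theta> * p v - 1)"
        using C_pos by (intro continuous_intros) auto
    qed
    \<comment> \<open>Subtracting \<open>RI\<close> cancels the variance part of the running cost,
      and the Riccati equation makes the remaining terms the perfect square in
      \<open>f2\<close>.\<close>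
    have "primitive_on r u (\<lambda>v. p v * (M v * M v) - RI v) (\<lambda>v. (((p v)\<^sup>2 / C + 2 * \<theta> * p v - 1) * (M v * M v) +
       p v * ((- \<theta> * M v + a v) * M v + M v * (- \<theta> * M v + a v))) - ou_variance \<theta> b (v - r) z)"
      by (intro primitive_on_minus primitive_on_mult p prim u RI_prim uT)
    moreover have "(((p v)\<^sup>2 / C + 2 * \<theta> * p v - 1) * (M v * M v) +
       p v * ((- \<theta> * M v + a v) * M v + M v * (- \<theta> * M v + a v))) - ou_variance \<theta> b (v - r) z = f2 v - f1 v" for v
      using C_pos by (simp add: f1_def f2_def power2_eq_square field_simps)
    ultimately have pr: "primitive_on r u (\<lambda>v. p v * (M v * M v) - RI v) (\<lambda>v. f2 v - f1 v)" by simp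
    show ?thesis
    proof (rule nn_integral_balance)
      show "set_integrable lborel {r..u} (\<lambda>v. f2 v - f1 v)" by (rule primitive_on_integrable[OF pr])
      show "p u * (M u)\<^sup>2 - (p r * m\<^sup>2 + RI u) = (LINT v:{r..u}|lborel. f2 v - f1 v)"
        using primitive_on_diff[OF pr order_refl uT(3) order_refl] Mr by (simp add: RI_def power2_eq_square)
      have Mm: "(\<lambda>v. indicator {r..u} v *\<^sub>R M v) \<in> borel_measurable borel"
        using primitive_on_continuous[OF prim[OF u]] by (intro borel_measurable_continuous_on_indicator) auto
      have Zm: "(\<lambda>v. ou_variance \<theta> b (v - r) z) \<in> borel_measurable borel"
        unfolding ou_variance_def exp_integral_def by measurable
      have "(\<lambda>v. (indicator {r..u} v *\<^sub>R M v)\<^sup>2 + indicator {r..u} v * ou_variance \<theta> b (v - r) z + 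
          C * (indicator {r..u} v * (indicator {r..t} v * a v))\<^sup>2) \<in> borel_measurable borel"
        using Mm Zm a by measurable
      also have "(\<lambda>v. (indicator {r..u} v *\<^sub>R M v)\<^sup>2 + indicator {r..u} v * ou_variance \<theta> b (v - r) z + 
          C * (indicator {r..u} v * (indicator {r..t} v * a v))\<^sup>2) = (\<lambda>v. indicator {r..u} v * f1 v)"
        using u by (auto simp: fun_eq_iff indicator_def f1_def)
      finally show "(\<lambda>v. indicator {r..u} v * f1 v) \<in> borel_measurable lborel" by simp
    qed (use f1_nn f2_nn RI_nn p_nn uT in auto)
  qed
  \<comment> \<open>Times inside \<open>{r..<t}\<close> that increase to \<open>t\<close>. The costs
    converge by monotonicity, the end terms by continuity of \<open>p\<close> and \<open>RI\<close>
    and by the left limit of the mean.\<close>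
  define u where "u k = t - (t - r) / real (Suc k)" for k :: nat
  have u_mem: "u k \<in> {r..<t}" for k
  proof -
    have "(t - r) / real (Suc k) > 0" "(t - r) / real (Suc k) \<le> (t - r) / 1"
      using rt(1) by (simp, intro divide_left_mono) auto
    thus ?thesis by (simp add: u_def)
  qed
  have u_inc: "incseq u"
    unfolding u_def incseq_def using rt(1) by (auto intro!: divide_left_mono diff_left_mono)
  have u_lim: "u \<longlonglongrightarrow> t"
  proof -
    have "(\<lambda>k. t - (t - r) * inverse (real (Suc k))) \<longlonglongrightarrow> t - (t - r) * 0"
      by (intro tendsto_intros LIMSEQ_inverse_real_of_nat)
    thus ?thesis by (simp add: u_def[abs_def] divide_inverse)
  qed
  have u_left: "filterlim u (at_left t) sequentially"
    using u_lim u_mem by (auto simp: filterlim_at less_le intro!: always_eventually)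
  have Mm: "(\<lambda>v. indicator {r..<t} v * M v) \<in> borel_measurable borel"
  proof (rule borel_measurable_LIMSEQ_real)
    fix k show "(\<lambda>v. indicator {r..u k} v *\<^sub>R M v) \<in> borel_measurable borel"
      using primitive_on_continuous[OF prim[OF u_mem]] by (intro borel_measurable_continuous_on_indicator) auto
  next
    fix v :: real
    show "(\<lambda>k. indicator {r..u k} v *\<^sub>R M v) \<longlonglongrightarrow> indicator {r..<t} v * M v"
    proof (cases "v \<in> {r..<t}")
      case True
      hence "\<forall>\<^sub>F k in sequentially. u k > v" using order_tendstoD(1)[OF u_lim, of v] by simp
      hence "\<forall>\<^sub>F k in sequentially. indicator {r..u k} v *\<^sub>R M v = indicator {r..<t} v * M v"
        by eventually_elim (use True in \<open>auto simp: indicator_def\<close>)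
      thus ?thesis by (rule tendsto_eventually)
    next
      case False
      hence "indicator {r..u k} v *\<^sub>R M v = indicator {r..<t} v * M v" for k
        using u_mem[of k] by (auto simp: indicator_def)
      thus ?thesis by (simp only: tendsto_const)
    qed
  qed
  have f1m: "(\<lambda>v. indicator {r..<t} v * ennreal (f1 v)) \<in> borel_measurable lborel"
  proof -
    have Zm: "(\<lambda>v. ou_variance \<theta> b (v - r) z) \<in> borel_measurable borel"
      unfolding ou_variance_def exp_integral_def by measurable
    have "(\<lambda>v. indicator {r..<t} v * ennreal ((indicator {r..<t} v * M v)\<^sup>2 + ou_variance \<theta> b (v - r) z + 
          C * (indicator {r..t} v * a v)\<^sup>2)) \<in> borel_measurable borel"
      using Mm Zm a by measurable
    also have "(\<lambda>v. indicator {r..<t} v * ennreal ((indicator {r..<t} v * M v)\<^sup>2 + ou_variance \<theta> b (v - r) z + 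
          C * (indicator {r..t} v * a v)\<^sup>2)) = (\<lambda>v. indicator {r..<t} v * ennreal (f1 v))"
      by (auto simp: fun_eq_iff indicator_def f1_def)
    finally show ?thesis by simp
  qed
  have p_cont: "continuous_on {r..T} p"
    by (rule DERIV_continuous_on[OF p_deriv]) auto
  have f2m: "(\<lambda>v. indicator {r..<t} v * ennreal (f2 v)) \<in> borel_measurable lborel"
  proof -
    have pm: "(\<lambda>v. indicator {r..T} v *\<^sub>R p v) \<in> borel_measurable borel"
      using p_cont by (intro borel_measurable_continuous_on_indicator) auto
    have "(\<lambda>v. indicator {r..<t} v * ennreal (C * ((indicator {r..t} v * a v) + (indicator {r..T} v *\<^sub>R p v) *
          (indicator {r..<t} v * M v) / C)\<^sup>2)) \<in> borel_measurable borel"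
      using Mm pm a by measurable
    also have "(\<lambda>v. indicator {r..<t} v * ennreal (C * ((indicator {r..t} v * a v) + (indicator {r..T} v *\<^sub>R p v) *
          (indicator {r..<t} v * M v) / C)\<^sup>2)) = (\<lambda>v. indicator {r..<t} v * ennreal (f2 v))"
      using rt by (auto simp: fun_eq_iff indicator_def f2_def)
    finally show ?thesis by simp
  qed
  have conv: "(\<lambda>k. \<integral>\<^sup>+v\<in>{r..u k}. ennreal (f v) \<partial>lborel) \<longlonglongrightarrow> (\<integral>\<^sup>+v\<in>{r..<t}. ennreal (f v) \<partial>lborel)"
    if fm: "(\<lambda>v. indicator {r..<t} v * ennreal (f v)) \<in> borel_measurable lborel" for f
  proof -
    have "(\<lambda>k. \<integral>\<^sup>+v\<in>{r..u k}. (indicator {r..<t} v * ennreal (f v)) \<partial>lborel) \<longlonglongrightarrow>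
      (\<integral>\<^sup>+v\<in>{r..<t}. (indicator {r..<t} v * ennreal (f v)) \<partial>lborel)"
      using u_mem u_inc u_lim fm by (intro LIMSEQ_nn_integral_Icc) auto
    also have "(\<integral>\<^sup>+v\<in>{r..<t}. (indicator {r..<t} v * ennreal (f v)) \<partial>lborel) = (\<integral>\<^sup>+v\<in>{r..<t}. ennreal (f v) \<partial>lborel)"
      by (intro nn_integral_cong) (auto simp: indicator_def)
    also have "(\<lambda>k. \<integral>\<^sup>+v\<in>{r..u k}. (indicator {r..<t} v * ennreal (f v)) \<partial>lborel) = (\<lambda>k. \<integral>\<^sup>+v\<in>{r..u k}. ennreal (f v) \<partial>lborel)"
    proof (intro ext nn_integral_cong)
      fix k v show "indicator {r..<t} v * ennreal (f v) * indicator {r..u k} v = ennreal (f v) * indicator {r..u k} v"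
        using u_mem[of k] by (auto simp: indicator_def)
    qed
    finally show ?thesis .
  qed
  have p_lim: "(\<lambda>k. p (u k)) \<longlonglongrightarrow> p t"
  proof -
    have "u k \<in> {r..T}" for k using u_mem[of k] rt by auto
    thus ?thesis using continuous_on_tendsto_compose[OF p_cont u_lim] rt by simp
  qed
  have RI_lim: "(\<lambda>k. RI (u k)) \<longlonglongrightarrow> RI t"
  proof -
    have "u k \<in> {r..t}" for k using u_mem[of k] by simp
    thus ?thesis
      using continuous_on_tendsto_compose[OF primitive_on_continuous[OF RI_prim[of t]] u_lim] rt by simp
  qed
  have lhs: "(\<lambda>k. (\<integral>\<^sup>+v\<in>{r..u k}. ennreal (f1 v) \<partial>lborel) + ennreal (p (u k) * (M (u k))\<^sup>2)) \<longlonglongrightarrow>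
     (\<integral>\<^sup>+v\<in>{r..<t}. ennreal (f1 v) \<partial>lborel) + ennreal (p t * ?mL\<^sup>2)"
    by (intro tendsto_add conv f1m tendsto_ennrealI tendsto_mult p_lim tendsto_power filterlim_compose[OF Mlim u_left])
  have rhs: "(\<lambda>k. ennreal (p r * m\<^sup>2 + RI (u k)) + (\<integral>\<^sup>+v\<in>{r..u k}. ennreal (f2 v) \<partial>lborel)) \<longlonglongrightarrow>
     ennreal (p r * m\<^sup>2 + RI t) + (\<integral>\<^sup>+v\<in>{r..<t}. ennreal (f2 v) \<partial>lborel)"
    by (intro tendsto_add conv f2m tendsto_ennrealI tendsto_const RI_lim)
  have "(\<integral>\<^sup>+v\<in>{r..<t}. ennreal (f1 v) \<partial>lborel) + ennreal (p t * ?mL\<^sup>2) = 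
     ennreal (p r * m\<^sup>2 + RI t) + (\<integral>\<^sup>+v\<in>{r..<t}. ennreal (f2 v) \<partial>lborel)"
    using LIMSEQ_unique[OF lhs] rhs unfolding balance[OF u_mem] by blast
  thus "(\<integral>\<^sup>+u\<in>{r..<t}. ennreal ((M u)\<^sup>2 + ou_variance \<theta> b (u - r) z + C * (a u)\<^sup>2) \<partial>lborel) + ennreal (p t * (\<integral>x. x \<partial>L)\<^sup>2) =
      ennreal (p r * m\<^sup>2 + ou_variance_integral \<theta> b (t - r) z) +
      (\<integral>\<^sup>+u\<in>{r..<t}. ennreal (C * (a u + p u * M u / C)\<^sup>2) \<partial>lborel)"
    unfolding f1_def f2_def RI_def .
qed

end

section \<open>The cost of an arbitrary control\<close>

lemma sets_observation_sigma:
  "sets (observation_sigma \<epsilon> I J) = sigma_sets (space (outcome_space I))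
     {observation \<epsilon> j -` B \<inter> space (outcome_space I) | j B. j \<in> J \<and> B \<in> sets borel}"
  unfolding observation_sigma_def by (rule sets_measure_of) blast

lemma space_observation_sigma: "space (observation_sigma \<epsilon> I J) = space (outcome_space I)"
  unfolding observation_sigma_def by (rule space_measure_of) blast

lemma observation_vimage:
  "observation \<epsilon> j -` B = (\<lambda>\<omega>. \<omega> j) -` ((\<lambda>p. fst p + \<epsilon> * snd p) -` B)"
  by (auto simp: observation_def state_sample_def noise_def)

lemma coordinate_measurable: "j \<in> I \<Longrightarrow> (\<lambda>\<omega>. \<omega> j) \<in> outcome_space I \<rightarrow>\<^sub>M borel"
  unfolding outcome_space_def by (rule measurable_component_singleton)

lemma fst_snd_borel [measurable]:
  "(fst :: real \<times> real \<Rightarrow> real) \<in> borel_measurable borel" "(snd :: real \<times> real \<Rightarrow> real) \<in> borel_measurable borel"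
  by (auto intro!: borel_measurable_continuous_onI continuous_intros)

lemma sample_measurable:
  assumes "j \<in> I"
  shows "state_sample j \<in> borel_measurable (outcome_space I)" "noise j \<in> borel_measurable (outcome_space I)"
    "observation \<epsilon> j \<in> borel_measurable (outcome_space I)"
proof -
  note [measurable] = coordinate_measurable[OF assms]
  show 1: "state_sample j \<in> borel_measurable (outcome_space I)" "noise j \<in> borel_measurable (outcome_space I)"
    unfolding state_sample_def[abs_def] noise_def[abs_def] by measurable
  show "observation \<epsilon> j \<in> borel_measurable (outcome_space I)"
    unfolding observation_def[abs_def] using 1 by measurable
qed

lemma observation_sigma_subalgebra: "J \<subseteq> I \<Longrightarrow> subalgebra (outcome_space I) (observation_sigma \<epsilon> I J)"
  unfolding subalgebra_def space_observation_sigma sets_observation_sigma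
  using sample_measurable(3)[of _ I \<epsilon>] by (auto intro!: sets.sigma_sets_subset measurable_sets)

text \<open>An observation is a Borel function of its coordinate, so what is seen through earlier
  observations is an event of the past samples, to which the product formula of the controlled
  filter applies.\<close>

lemma observation_sigma_past:
  assumes "\<And>j. j \<in> J \<Longrightarrow> j \<in> I \<and> j < i"
  shows "sets (observation_sigma \<epsilon> I J) \<subseteq> past_events I i"
  unfolding sets_observation_sigma past_events_def
proof (rule sigma_sets_mono, rule subsetI)
  fix X assume "X \<in> {observation \<epsilon> j -` B \<inter> space (outcome_space I) | j B. j \<in> J \<and> B \<in> sets borel}"
  then obtain j B where X: "X = observation \<epsilon> j -` B \<inter> space (outcome_space I)" "j \<in> J" "B \<in> sets borel" by blast
  have "(\<lambda>p. fst p + \<epsilon> * snd p) \<in> borel_measurable borel" by measurable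
  hence "(\<lambda>p. fst p + \<epsilon> * snd p) -` B \<in> sets borel" using X(3) measurable_sets[of _ borel borel B] by fastforce
  thus "X \<in> sigma_sets (space (outcome_space I))
     {(\<lambda>\<omega>. \<omega> j) -` B \<inter> space (outcome_space I) | j B. j \<in> I \<and> j < i \<and> B \<in> sets borel}"
    unfolding X(1) observation_vimage using assms[OF X(2)] by (intro sigma_sets.Basic) blast
qed

lemma observation_measurable_sigma:
  assumes "j \<in> J" shows "observation \<epsilon> j \<in> borel_measurable (observation_sigma \<epsilon> I J)"
  by (rule measurableI) (use assms in \<open>auto simp: space_observation_sigma sets_observation_sigma intro!: sigma_sets.Basic\<close>)

lemma mean_measurable:
  assumes "f \<in> M \<rightarrow>\<^sub>M prob_algebra (borel :: real measure)"
  shows "(\<lambda>\<omega>. \<integral>x. x \<partial>f \<omega>) \<in> borel_measurable M"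
  by (rule measurable_compose[OF measurable_prob_algebraD[OF assms] integral_measurable_subprob_algebra]) simp

context observed_ou
begin

text \<open>The variance immediately before observation \<open>j\<close> when the first observation
  is \<open>k\<close>. For \<open>j < k\<close> it repeats the value at \<open>k\<close>, so that
  the recursion may start at \<open>0\<close>.\<close>

fun pre_variance :: "nat \<Rightarrow> real \<Rightarrow> real \<Rightarrow> nat \<Rightarrow> real" where
  "pre_variance k s z 0 = ou_variance \<theta> b (\<tau> k - s) z"
| "pre_variance k s z (Suc j) = (if Suc j \<le> k then ou_variance \<theta> b (\<tau> k - s) z
     else ou_variance \<theta> b (\<tau> (Suc j) - \<tau> j) (post_variance (pre_variance k s z j)))"

definition left_time :: "nat \<Rightarrow> real \<Rightarrow> nat \<Rightarrow> real" where
  "left_time k s j = (if j = k then s else \<tau> (j - 1))"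

definition left_variance :: "nat \<Rightarrow> real \<Rightarrow> real \<Rightarrow> nat \<Rightarrow> real" where
  "left_variance k s z j = (if j = k then z else post_variance (pre_variance k s z (j - 1)))"

lemma pre_variance_first: "pre_variance k s z k = ou_variance \<theta> b (\<tau> k - s) z"
  by (cases k) auto

lemma pre_variance_left:
  "k \<le> j \<Longrightarrow> pre_variance k s z j = ou_variance \<theta> b (\<tau> j - left_time k s j) (left_variance k s z j)"
  by (cases j) (auto simp: left_time_def left_variance_def pre_variance_first)

lemma left_time_less:
  assumes "k < j" "j \<le> Suc n" shows "left_time k s j < \<tau> j"
  using assms tau_less[of "j - 1" j] by (auto simp: left_time_def)

lemma left_time_bounds:
  assumes "k \<le> j" "j \<le> Suc n" "s \<le> \<tau> k"
  shows "s \<le> left_time k s j" "left_time k s j \<le> \<tau> j" "\<tau> j \<le> T"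
proof -
  show "\<tau> j \<le> T" using assms tau_le_T by simp
  show "left_time k s j \<le> \<tau> j" using left_time_less[of k j s] assms by (cases "j = k") (auto simp: left_time_def)
  show "s \<le> left_time k s j"
  proof (cases "j = k")
    case False
    hence "k \<le> j - 1" "j - 1 \<le> Suc n" using assms by linarith+
    from tau_le[OF this] assms(3) False show ?thesis by (simp add: left_time_def)
  qed (simp add: left_time_def)
qed

lemma pre_variance_pos:
  assumes "z > 0" "s \<le> \<tau> k" "k \<le> j" "j \<le> Suc n"
  shows "pre_variance k s z j > 0"
  using assms(3,4)
proof (induction j rule: dec_induct)
  case base thus ?case using assms by (auto simp: pre_variance_first intro: ou_variance_pos)
next
  case (step j)
  thus ?case using tau_le[of j "Suc j"] by (auto intro!: ou_variance_pos post_variance_pos)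
qed

lemma left_variance_pos:
  assumes "z > 0" "s \<le> \<tau> k" "k \<le> j" "j \<le> Suc n"
  shows "left_variance k s z j > 0"
  using assms pre_variance_pos[of z s k "j - 1"] by (auto simp: left_variance_def intro!: post_variance_pos)

lemma pre_value_telescope:
  assumes "k \<le> j" "j \<le> n"
  shows "pre_value j (pre_variance k s z j) = 
    ou_variance_integral \<theta> b (\<tau> (Suc j) - left_time k s (Suc j)) (left_variance k s z (Suc j)) +
    pre_value (Suc j) (pre_variance k s z (Suc j)) +
    p (\<tau> j) * ((pre_variance k s z j)\<^sup>2 / (pre_variance k s z j + \<epsilon>\<^sup>2))"
  using assms by (subst pre_value.simps) (simp add: left_time_def left_variance_def)

declare pre_variance.simps [simp del]

end

text \<open>An arbitrary competitor. Besides the ordinary start with \<open>s < \<tau> k\<close>,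
  the case \<open>s = \<tau> k\<close> covers the start immediately before an observation, and with
  \<open>k = n + 1\<close> the start at the horizon.\<close>

locale controlled_ou = observed_ou \<theta> b C \<epsilon> T n \<tau>
  for \<theta> b C \<epsilon> T :: real and n :: nat and \<tau> :: "nat \<Rightarrow> real" +
  fixes k :: nat and s m0 z0 :: real and \<alpha> :: "real \<Rightarrow> outcome \<Rightarrow> real" and P :: "outcome measure"
    and \<mu> :: "real \<Rightarrow> outcome \<Rightarrow> real measure" and \<nu> :: "nat \<Rightarrow> outcome \<Rightarrow> real measure"
  assumes k: "k \<le> Suc n" and s: "s \<le> \<tau> k" and z0: "z0 > 0"
    and admissible: "admissible_control \<epsilon> T \<tau> {k..n} s \<alpha>"
    and controlled: "controlled_filter \<theta> b \<epsilon> T \<tau> {k..n} s (gaussian m0 z0) \<alpha> P \<mu> \<nu>"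
begin

abbreviation "I \<equiv> {k..n}"
abbreviation "lt \<equiv> left_time k s"
abbreviation "zl \<equiv> left_variance k s z0"
abbreviation "zp \<equiv> pre_variance k s z0"

section \<open>Measurability of the filter and of the control\<close>

lemma prob_P: "prob_space P" and sets_P: "sets P = sets (outcome_space I)"
  using controlled by (simp_all add: controlled_filter_def)

lemma space_P: "space P = space (outcome_space I)"
  by (rule sets_eq_imp_space_eq[OF sets_P])

lemma sT: "s \<le> T"
  using s tau_le_T[OF k] by simp

lemma measurable_P: "f \<in> outcome_space I \<rightarrow>\<^sub>M M \<Longrightarrow> f \<in> P \<rightarrow>\<^sub>M M"
  using measurable_cong_sets[OF sets_P refl] by blast

lemma mu_measurable: "t \<in> {s..T} \<Longrightarrow> \<mu> t \<in> obs_filtration \<epsilon> \<tau> I t \<rightarrow>\<^sub>M prob_algebra borel"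
  and nu_measurable: "i \<in> I \<Longrightarrow> \<nu> i \<in> obs_filtration_left \<epsilon> \<tau> I (\<tau> i) \<rightarrow>\<^sub>M prob_algebra borel"
  using controlled by (simp_all add: controlled_filter_def)

lemma mu_prob: "t \<in> {s..T} \<Longrightarrow> \<omega> \<in> space P \<Longrightarrow> prob_space (\<mu> t \<omega>) \<and> sets (\<mu> t \<omega>) = sets borel"
  using measurable_space[OF mu_measurable, of t \<omega>]
  by (simp add: obs_filtration_def space_observation_sigma space_P space_prob_algebra)

lemma nu_prob: "i \<in> I \<Longrightarrow> \<omega> \<in> space P \<Longrightarrow> prob_space (\<nu> i \<omega>) \<and> sets (\<nu> i \<omega>) = sets borel"
  using measurable_space[OF nu_measurable, of i \<omega>]
  by (simp add: obs_filtration_left_def space_observation_sigma space_P space_prob_algebra)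

lemma mu_mean_measurable: 
  assumes "t \<in> {s..T}" shows "(\<lambda>\<omega>. \<integral>x. x \<partial>\<mu> t \<omega>) \<in> borel_measurable P"
proof -
  have "subalgebra (outcome_space I) (obs_filtration \<epsilon> \<tau> I t)"
    unfolding obs_filtration_def by (rule observation_sigma_subalgebra) auto
  from measurable_P[OF measurable_from_subalg[OF this mean_measurable[OF mu_measurable[OF assms]]]]
  show ?thesis .
qed

text \<open>The second claim puts the events determined by the predicted mean into the past of
  \<open>i\<close>, as the product formula requires of its conditioning events.\<close>

lemma nu_mean_measurable:
  assumes "i \<in> I"
  shows "(\<lambda>\<omega>. \<integral>x. x \<partial>\<nu> i \<omega>) \<in> borel_measurable P"
    "A \<in> sets borel \<Longrightarrow> {\<omega>\<in>space P. (\<integral>x. x \<partial>\<nu> i \<omega>) \<in> A} \<in> past_events I i"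
proof -
  note m = mean_measurable[OF nu_measurable[OF assms]]
  have "subalgebra (outcome_space I) (obs_filtration_left \<epsilon> \<tau> I (\<tau> i))"
    unfolding obs_filtration_left_def by (rule observation_sigma_subalgebra) auto
  from measurable_P[OF measurable_from_subalg[OF this m]]
  show "(\<lambda>\<omega>. \<integral>x. x \<partial>\<nu> i \<omega>) \<in> borel_measurable P" .
  assume A: "A \<in> sets borel"
  have "sets (obs_filtration_left \<epsilon> \<tau> I (\<tau> i)) \<subseteq> past_events I i"
    unfolding obs_filtration_left_def
  proof (rule observation_sigma_past)
    fix j assume j: "j \<in> {j \<in> I. \<tau> j < \<tau> i}"
    hence "\<not> i \<le> j" using tau_le[of i j] by auto
    thus "j \<in> I \<and> j < i" using j by auto
  qed
  moreover have "(\<lambda>\<omega>. \<integral>x. x \<partial>\<nu> i \<omega>) -` A \<inter> space (obs_filtration_left \<epsilon> \<tau> I (\<tau> i)) \<in> sets (obs_filtration_left \<epsilon> \<tau> I (\<tau> i))"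
    by (rule measurable_sets[OF m A])
  moreover have "(\<lambda>\<omega>. \<integral>x. x \<partial>\<nu> i \<omega>) -` A \<inter> space (obs_filtration_left \<epsilon> \<tau> I (\<tau> i)) = {\<omega>\<in>space P. (\<integral>x. x \<partial>\<nu> i \<omega>) \<in> A}"
    by (auto simp: obs_filtration_left_def space_observation_sigma space_P)
  ultimately show "{\<omega>\<in>space P. (\<integral>x. x \<partial>\<nu> i \<omega>) \<in> A} \<in> past_events I i" by auto
qed

text \<open>The control, extended to all times so that it is jointly measurable without restriction.\<close>
definition ctrl :: "real \<Rightarrow> outcome \<Rightarrow> real" where "ctrl t \<omega> = \<alpha> (max s (min t T)) \<omega>"

lemma ctrl_eq: "t \<in> {s..T} \<Longrightarrow> ctrl t \<omega> = \<alpha> t \<omega>"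
  by (simp add: ctrl_def min_absorb1 max_absorb2)

lemma ctrl_measurable: "(\<lambda>(t, \<omega>). ctrl t \<omega>) \<in> borel_measurable (borel \<Otimes>\<^sub>M P)"
proof -
  have a: "(\<lambda>(t, \<omega>). \<alpha> t \<omega>) \<in> borel_measurable (restrict_space borel {s..T} \<Otimes>\<^sub>M outcome_space I)"
    using admissible by (simp add: admissible_control_def)
  have c: "(\<lambda>t. max s (min t T)) \<in> borel \<rightarrow>\<^sub>M restrict_space borel {s..T}"
    using sT by (intro measurable_restrict_space2) auto
  have "(\<lambda>p. (max s (min (fst p) T), snd p)) \<in> borel \<Otimes>\<^sub>M outcome_space I \<rightarrow>\<^sub>M restrict_space borel {s..T} \<Otimes>\<^sub>M outcome_space I"
    by (intro measurable_Pair measurable_compose[OF measurable_fst c] measurable_snd)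
  from measurable_compose[OF this a]
  have "(\<lambda>(t, \<omega>). ctrl t \<omega>) \<in> borel_measurable (borel \<Otimes>\<^sub>M outcome_space I)"
    by (simp add: ctrl_def case_prod_beta)
  thus ?thesis using measurable_cong_sets[OF sets_pair_measure_cong[OF refl sets_P] refl] by blast
qed

text \<open>The intervals between observations are indexed by their right end point, with \<open>n + 1\<close> for the final time:
  \<open>lt j\<close>, \<open>ml j\<close>, \<open>zl j\<close> are the time, mean and variance at the left end of the \<open>j\<close>-th interval, and
  \<open>prelaw j\<close>, \<open>mp j\<close>, \<open>zp j\<close> are the law, mean and variance immediately before the \<open>j\<close>-th observation.\<close>

definition prelaw :: "nat \<Rightarrow> outcome \<Rightarrow> real measure" where
  "prelaw j \<omega> = (if j \<le> n then \<nu> j \<omega> else \<mu> T \<omega>)"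

definition mp :: "nat \<Rightarrow> outcome \<Rightarrow> real" where "mp j \<omega> = (\<integral>x. x \<partial>prelaw j \<omega>)"

definition ml :: "nat \<Rightarrow> outcome \<Rightarrow> real" where
  "ml j \<omega> = (if j = k then m0 else (\<integral>x. x \<partial>\<mu> (\<tau> (j - 1)) \<omega>))"

text \<open>Variation of constants for the mean equation. Taking the formula instead of the mean of
  \<open>\<mu> u\<close> gives joint measurability in time and sample point, because a jointly
  measurable function is integrated.\<close>

definition mean :: "nat \<Rightarrow> real \<Rightarrow> outcome \<Rightarrow> real" where
  "mean j u \<omega> = exp (- \<theta> * (u - lt j)) * ml j \<omega> + (LINT v:{lt j..u}|lborel. exp (- \<theta> * (u - v)) * ctrl v \<omega>)"

definition run_cost :: "nat \<Rightarrow> real \<Rightarrow> outcome \<Rightarrow> real" where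
  "run_cost j u \<omega> = (mean j u \<omega>)\<^sup>2 + ou_variance \<theta> b (u - lt j) (zl j) + C * (ctrl u \<omega>)\<^sup>2"

definition excess :: "nat \<Rightarrow> real \<Rightarrow> outcome \<Rightarrow> real" where
  "excess j u \<omega> = C * (ctrl u \<omega> + p u * mean j u \<omega> / C)\<^sup>2"

definition J :: "nat \<Rightarrow> outcome \<Rightarrow> ennreal" where
  "J j \<omega> = (\<integral>\<^sup>+u\<in>{lt j..<\<tau> j}. ennreal (run_cost j u \<omega>) \<partial>lborel)"

definition X :: "nat \<Rightarrow> outcome \<Rightarrow> ennreal" where
  "X j \<omega> = (\<integral>\<^sup>+u\<in>{lt j..<\<tau> j}. ennreal (excess j u \<omega>) \<partial>lborel)"

lemma mp_measurable: "k \<le> j \<Longrightarrow> j \<le> Suc n \<Longrightarrow> mp j \<in> borel_measurable P"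
  using nu_mean_measurable(1)[of j] mu_mean_measurable[of T] sT
  by (cases "j \<le> n") (simp_all add: mp_def[abs_def] prelaw_def)

lemma ml_measurable:
  assumes "k \<le> j" "j \<le> Suc n" shows "ml j \<in> borel_measurable P"
proof (cases "j = k")
  case False
  hence "k \<le> j - 1" "j - 1 \<le> Suc n" using assms by linarith+
  hence "\<tau> (j - 1) \<in> {s..T}" using s tau_le[of k "j - 1"] tau_le_T[of "j - 1"] by auto
  from mu_mean_measurable[OF this] show ?thesis using False by (simp add: ml_def[abs_def])
qed (simp add: ml_def[abs_def])

lemma mean_measurable_joint:
  assumes "k \<le> j" "j \<le> Suc n"
  shows "(\<lambda>(u, \<omega>). mean j u \<omega>) \<in> borel_measurable (borel \<Otimes>\<^sub>M P)"
proof -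
  note [measurable] = ml_measurable[OF assms]
  have c: "(\<lambda>q. ctrl (snd q) (snd (fst q))) \<in> borel_measurable ((borel \<Otimes>\<^sub>M P) \<Otimes>\<^sub>M lborel)"
  proof -
    have "(\<lambda>q. (snd q, snd (fst q))) \<in> (borel \<Otimes>\<^sub>M P) \<Otimes>\<^sub>M lborel \<rightarrow>\<^sub>M borel \<Otimes>\<^sub>M P" by measurable
    from measurable_compose[OF this ctrl_measurable] show ?thesis by simp
  qed
  have "(\<lambda>p. LINT v|lborel. indicator {v. lt j \<le> v \<and> v \<le> fst p} v *\<^sub>R (exp (- \<theta> * (fst p - v)) * ctrl v (snd p))) \<in> borel_measurable (borel \<Otimes>\<^sub>M P)"
  proof (rule lborel.borel_measurable_lebesgue_integral)
    show "(\<lambda>(p, v). indicator {v. lt j \<le> v \<and> v \<le> fst p} v *\<^sub>R (exp (- \<theta> * (fst p - v)) * ctrl v (snd p)))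
       \<in> borel_measurable ((borel \<Otimes>\<^sub>M P) \<Otimes>\<^sub>M lborel)"
      unfolding case_prod_beta using c by measurable
  qed
  moreover have "{v. lt j \<le> v \<and> v \<le> u} = {lt j..u}" for u by auto
  ultimately have "(\<lambda>p. LINT v:{lt j..fst p}|lborel. exp (- \<theta> * (fst p - v)) * ctrl v (snd p)) \<in> borel_measurable (borel \<Otimes>\<^sub>M P)"
    by (simp add: set_lebesgue_integral_def)
  thus ?thesis unfolding mean_def case_prod_beta by measurable
qed

lemma run_cost_measurable:
  assumes "k \<le> j" "j \<le> Suc n"
  shows "(\<lambda>(\<omega>, u). ennreal (run_cost j u \<omega>) * indicator {lt j..<\<tau> j} u) \<in> borel_measurable (P \<Otimes>\<^sub>M lborel)"
    "(\<lambda>(\<omega>, u). ennreal (excess j u \<omega>) * indicator {lt j..<\<tau> j} u) \<in> borel_measurable (P \<Otimes>\<^sub>M lborel)"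
proof -
  have sw: "(\<lambda>(\<omega>, u). (u, \<omega>)) \<in> P \<Otimes>\<^sub>M lborel \<rightarrow>\<^sub>M borel \<Otimes>\<^sub>M P" by measurable
  have m: "(\<lambda>q. mean j (snd q) (fst q)) \<in> borel_measurable (P \<Otimes>\<^sub>M lborel)"
    using measurable_compose[OF sw mean_measurable_joint[OF assms]] by (simp add: case_prod_beta)
  have c: "(\<lambda>q. ctrl (snd q) (fst q)) \<in> borel_measurable (P \<Otimes>\<^sub>M lborel)"
    using measurable_compose[OF sw ctrl_measurable] by (simp add: case_prod_beta)
  have "(\<lambda>q. ou_variance \<theta> b (snd q - lt j) (zl j)) \<in> borel_measurable (P \<Otimes>\<^sub>M lborel)"
    unfolding ou_variance_def exp_integral_def by measurable
  thus "(\<lambda>(\<omega>, u). ennreal (run_cost j u \<omega>) * indicator {lt j..<\<tau> j} u) \<in> borel_measurable (P \<Otimes>\<^sub>M lborel)"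
    unfolding run_cost_def case_prod_beta using m c by measurable
  have "p \<in> borel_measurable borel" unfolding p_def[abs_def] riccati_num_def riccati_den_def cosh_def sinh_def by measurable
  hence "(\<lambda>q. p (snd q)) \<in> borel_measurable (P \<Otimes>\<^sub>M lborel)" by measurable
  thus "(\<lambda>(\<omega>, u). ennreal (excess j u \<omega>) * indicator {lt j..<\<tau> j} u) \<in> borel_measurable (P \<Otimes>\<^sub>M lborel)"
    unfolding excess_def case_prod_beta using m c by measurable
qed

lemma J_measurable: "k \<le> j \<Longrightarrow> j \<le> Suc n \<Longrightarrow> J j \<in> borel_measurable P"
  and X_measurable: "k \<le> j \<Longrightarrow> j \<le> Suc n \<Longrightarrow> X j \<in> borel_measurable P"
  unfolding J_def[abs_def] X_def[abs_def]
  using lborel.borel_measurable_nn_integral[OF run_cost_measurable(1)] lborel.borel_measurable_nn_integral[OF run_cost_measurable(2)]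
  by blast+

definition good :: "outcome \<Rightarrow> bool" where
  "good \<omega> \<longleftrightarrow> \<omega> \<in> space P \<and>
     filter_path \<theta> b \<epsilon> T \<tau> I s (gaussian m0 z0) (\<lambda>t. \<alpha> t \<omega>) (\<lambda>i. observation \<epsilon> i \<omega>) (\<lambda>t. \<mu> t \<omega>) (\<lambda>i. \<nu> i \<omega>)"

lemma AE_good: "AE \<omega> in P. good \<omega>"
  using controlled AE_space[of P] unfolding controlled_filter_def good_def by force

text \<open>The invariant of the pathwise induction over intervals; its last part is the balance of
  \<open>interval_path\<close>. For \<open>s = \<tau> k\<close> the first interval is empty and its
  balance is trivial.\<close>

definition node :: "nat \<Rightarrow> outcome \<Rightarrow> bool" where
  "node j \<omega> \<longleftrightarrow> prelaw j \<omega> = gaussian (mp j \<omega>) (zp j) \<and>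
     (\<forall>u\<in>{lt j..<\<tau> j}. \<mu> u \<omega> = gaussian (mean j u \<omega>) (ou_variance \<theta> b (u - lt j) (zl j))) \<and>
     J j \<omega> + ennreal (p (\<tau> j) * (mp j \<omega>)\<^sup>2) =
       ennreal (p (lt j) * (ml j \<omega>)\<^sup>2 + ou_variance_integral \<theta> b (\<tau> j - lt j) (zl j)) + X j \<omega>"

lemma node_from_left:
  assumes g: "good \<omega>" and j: "k \<le> j" "j \<le> Suc n" and lt: "lt j < \<tau> j"
    and init: "\<mu> (lt j) \<omega> = gaussian (ml j \<omega>) (zl j)"
  shows "node j \<omega>"
proof -
  note b = left_time_bounds[OF j s]
  have \<omega>: "\<omega> \<in> space P" using g by (simp add: good_def)
  note fp = g[unfolded good_def filter_path_def]
  have mem: "u \<in> {s..T}" if "u \<in> {lt j..\<tau> j}" for u using that b by auto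
  have mem': "u \<in> {s..T}" if "u \<in> {lt j..<\<tau> j}" for u using that b by auto
  \<comment> \<open>For \<open>j = n + 1\<close> the right end is included, since no observation
    takes place at \<open>T\<close>.\<close>
  have weak: "weak_evolution \<theta> b (\<lambda>t. \<alpha> t \<omega>) (\<lambda>t. \<mu> t \<omega>) (lt j) u"
    if u: "lt j \<le> u" "u \<le> \<tau> j" "u < \<tau> j \<or> j = Suc n" for u
  proof -
    have "\<forall>i\<in>I. \<tau> i \<notin> {lt j<..u}"
    proof
      fix i assume i: "i \<in> I"
      show "\<tau> i \<notin> {lt j<..u}"
      proof (cases "i < j")
        case True
        hence "k < j" "i \<le> j - 1" "j - 1 \<le> Suc n" using i j by auto
        thus ?thesis using tau_le[of i "j - 1"] by (auto simp: left_time_def)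
      next
        case False
        hence "\<tau> j \<le> \<tau> i" "j \<noteq> Suc n" using tau_le[of j i] i by auto
        thus ?thesis using u by auto
      qed
    qed
    thus ?thesis using fp b(1) u(1,2) b(3) by force
  qed
  \<comment> \<open>Before an observation the left limit is part of the definition of a filter path;
    at the horizon it follows from continuity of the evolution up to \<open>T\<close>.\<close>
  have lim: "((\<lambda>u. \<integral>x. f x \<partial>\<mu> u \<omega>) \<longlongrightarrow> (\<integral>x. f x \<partial>prelaw j \<omega>)) (at_left (\<tau> j))" if f: "test_function f" for f
  proof (cases "j \<le> n")
    case True
    hence "j \<in> I" "s < \<tau> j" using j b lt by auto
    thus ?thesis using fp f True by (auto simp: prelaw_def)
  next
    case False
    hence jn: "j = Suc n" using j by simp
    have "primitive_on (lt j) (\<tau> j) (\<lambda>u. \<integral>x. f x \<partial>\<mu> u \<omega>) (\<lambda>u. \<integral>x. generator \<theta> b (\<alpha> u \<omega>) f x \<partial>\<mu> u \<omega>)"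
    proof (rule weak_ou_path.test_primitive[OF weak_ou_path.intro f])
      fix u assume u: "u \<in> {lt j..\<tau> j}"
      show "prob_space (\<mu> u \<omega>)" "sets (\<mu> u \<omega>) = sets borel" using mu_prob[OF mem[OF u] \<omega>] by auto
      show "has_second_moment (\<mu> u \<omega>)" using fp mem[OF u] by blast
      show "weak_evolution \<theta> b (\<lambda>t. \<alpha> t \<omega>) (\<lambda>t. \<mu> t \<omega>) (lt j) u" using weak[of u] u jn by simp
    qed (use lt in simp)
    from primitive_on_continuous[OF this] lt
    have "((\<lambda>u. \<integral>x. f x \<partial>\<mu> u \<omega>) \<longlongrightarrow> (\<integral>x. f x \<partial>\<mu> (\<tau> j) \<omega>)) (at (\<tau> j) within {lt j..\<tau> j})"
      by (auto simp: continuous_on)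
    moreover have "at (\<tau> j) within {lt j..\<tau> j} = at_left (\<tau> j)"
      by (rule at_within_Icc_at_left[OF lt])
    moreover have "prelaw j \<omega> = \<mu> (\<tau> j) \<omega>" using jn tau_T by (simp add: prelaw_def)
    ultimately show ?thesis by simp
  qed
  have L: "prob_space (prelaw j \<omega>)" "sets (prelaw j \<omega>) = sets borel"
    using nu_prob[of j \<omega>] mu_prob[of T \<omega>] \<omega> j sT by (auto simp: prelaw_def)
  have meas: "(\<lambda>u. indicator {lt j..\<tau> j} u * \<alpha> u \<omega>) \<in> borel_measurable borel"
  proof -
    have "(\<lambda>u. ctrl u \<omega>) \<in> borel_measurable borel"
      using measurable_Pair1[OF ctrl_measurable \<omega>] by simp
    hence "(\<lambda>u. indicator {lt j..\<tau> j} u * ctrl u \<omega>) \<in> borel_measurable borel" by measurable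
    also have "(\<lambda>u. indicator {lt j..\<tau> j} u * ctrl u \<omega>) = (\<lambda>u. indicator {lt j..\<tau> j} u * \<alpha> u \<omega>)"
      using ctrl_eq[OF mem] by (auto simp: fun_eq_iff indicator_def)
    finally show ?thesis .
  qed
  have M: "exp (- \<theta> * (u - lt j)) * ml j \<omega> + (LINT v:{lt j..u}|lborel. exp (- \<theta> * (u - v)) * \<alpha> v \<omega>) = mean j u \<omega>"
    if u: "u \<in> {lt j..<\<tau> j}" for u
  proof -
    have "(LINT v:{lt j..u}|lborel. exp (- \<theta> * (u - v)) * \<alpha> v \<omega>) = (LINT v:{lt j..u}|lborel. exp (- \<theta> * (u - v)) * ctrl v \<omega>)"
    proof (rule set_lebesgue_integral_cong)
      show "\<forall>v. v \<in> {lt j..u} \<longrightarrow> exp (- \<theta> * (u - v)) * \<alpha> v \<omega> = exp (- \<theta> * (u - v)) * ctrl v \<omega>"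
        using ctrl_eq[OF mem] u by auto
    qed simp
    thus ?thesis by (simp add: mean_def)
  qed
  have mu: "prob_space (\<mu> u \<omega>)" "sets (\<mu> u \<omega>) = sets borel" "has_second_moment (\<mu> u \<omega>)" 
    "weak_evolution \<theta> b (\<lambda>t. \<alpha> t \<omega>) (\<lambda>t. \<mu> t \<omega>) (lt j) u" if u: "u \<in> {lt j..<\<tau> j}" for u
  proof -
    show "prob_space (\<mu> u \<omega>)" "sets (\<mu> u \<omega>) = sets borel" using mu_prob[OF mem'[OF u] \<omega>] by auto
    show "has_second_moment (\<mu> u \<omega>)" using fp mem'[OF u] by blast
    show "weak_evolution \<theta> b (\<lambda>t. \<alpha> t \<omega>) (\<lambda>t. \<mu> t \<omega>) (lt j) u" using weak[of u] u by simp
  qed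
  note ip = interval_path[where a = "\<lambda>t. \<alpha> t \<omega>" and \<mu> = "\<lambda>t. \<mu> t \<omega>" and L = "prelaw j \<omega>",
      OF lt b(3) left_variance_pos[OF z0 s j] init mu L lim meas]
  show ?thesis unfolding node_def
  proof (intro conjI ballI)
    show "prelaw j \<omega> = gaussian (mp j \<omega>) (zp j)"
      unfolding mp_def pre_variance_left[OF j(1)] by (rule ip(2); assumption)
    fix u assume u: "u \<in> {lt j..<\<tau> j}"
    show "\<mu> u \<omega> = gaussian (mean j u \<omega>) (ou_variance \<theta> b (u - lt j) (zl j))"
      unfolding M[OF u, symmetric] by (rule ip(1); (assumption | rule u))
  next
    have 1: "J j \<omega> = (\<integral>\<^sup>+u\<in>{lt j..<\<tau> j}. ennreal ((exp (- \<theta> * (u - lt j)) * ml j \<omega> + 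
        (LINT v:{lt j..u}|lborel. exp (- \<theta> * (u - v)) * \<alpha> v \<omega>))\<^sup>2 + ou_variance \<theta> b (u - lt j) (zl j) + C * (\<alpha> u \<omega>)\<^sup>2) \<partial>lborel)"
      unfolding J_def
    proof (rule nn_integral_cong)
      fix u
      show "ennreal (run_cost j u \<omega>) * indicator {lt j..<\<tau> j} u = ennreal ((exp (- \<theta> * (u - lt j)) * ml j \<omega> + 
        (LINT v:{lt j..u}|lborel. exp (- \<theta> * (u - v)) * \<alpha> v \<omega>))\<^sup>2 + ou_variance \<theta> b (u - lt j) (zl j) + C * (\<alpha> u \<omega>)\<^sup>2) *
          indicator {lt j..<\<tau> j} u"
      proof (cases "u \<in> {lt j..<\<tau> j}")
        case True
        show ?thesis unfolding run_cost_def M[OF True] ctrl_eq[OF mem'[OF True]] ..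
      qed simp
    qed
    have 2: "X j \<omega> = (\<integral>\<^sup>+u\<in>{lt j..<\<tau> j}. ennreal (C * (\<alpha> u \<omega> + p u * (exp (- \<theta> * (u - lt j)) * ml j \<omega> + 
        (LINT v:{lt j..u}|lborel. exp (- \<theta> * (u - v)) * \<alpha> v \<omega>)) / C)\<^sup>2) \<partial>lborel)"
      unfolding X_def
    proof (rule nn_integral_cong)
      fix u
      show "ennreal (excess j u \<omega>) * indicator {lt j..<\<tau> j} u = ennreal (C * (\<alpha> u \<omega> + p u * (exp (- \<theta> * (u - lt j)) * ml j \<omega> + 
        (LINT v:{lt j..u}|lborel. exp (- \<theta> * (u - v)) * \<alpha> v \<omega>)) / C)\<^sup>2) * indicator {lt j..<\<tau> j} u"
      proof (cases "u \<in> {lt j..<\<tau> j}")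
        case True
        show ?thesis unfolding excess_def M[OF True] ctrl_eq[OF mem'[OF True]] ..
      qed simp
    qed
    show "J j \<omega> + ennreal (p (\<tau> j) * (mp j \<omega>)\<^sup>2) =
       ennreal (p (lt j) * (ml j \<omega>)\<^sup>2 + ou_variance_integral \<theta> b (\<tau> j - lt j) (zl j)) + X j \<omega>"
      unfolding 1 2 mp_def by (rule ip(3); assumption)
  qed
qed


text \<open>If \<open>s = \<tau> k\<close>, no time passes: the initial law is the law before the
  update when \<open>k \<le> n\<close>, and the terminal law when \<open>k = n + 1\<close>.\<close>

lemma node_first:
  assumes g: "good \<omega>" shows "node k \<omega>"
proof (cases "s < \<tau> k")
  case True
  hence "\<forall>i\<in>I. \<tau> i \<noteq> s" using tau_le[of k] by force
  hence "\<mu> s \<omega> = gaussian m0 z0" using g by (auto simp: good_def filter_path_def)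
  thus ?thesis using True k by (intro node_from_left[OF g]) (auto simp: left_time_def left_variance_def ml_def)
next
  case False
  hence sk: "s = \<tau> k" using s by simp
  have pl: "prelaw k \<omega> = gaussian m0 z0"
  proof (cases "k \<le> n")
    case True
    hence "k \<in> I" by simp
    moreover have "\<forall>i\<in>I. \<tau> i = s \<longrightarrow> \<nu> i \<omega> = gaussian m0 z0"
      using g unfolding good_def filter_path_def by blast
    ultimately have "\<nu> k \<omega> = gaussian m0 z0" using sk by blast
    thus ?thesis using True by (simp add: prelaw_def)
  next
    case False
    hence "k = Suc n" using k by simp
    hence sT: "s = T" and "\<forall>i\<in>I. \<tau> i \<noteq> s" using sk tau_T by auto
    hence "\<mu> s \<omega> = gaussian m0 z0" using g unfolding good_def filter_path_def by blast
    thus ?thesis unfolding sT using False by (simp add: prelaw_def)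
  qed
  have "mp k \<omega> = m0" unfolding mp_def pl by (rule gaussian_moments(2)[OF z0])
  moreover have "lt k = \<tau> k" "zp k = z0" using sk by (simp_all add: left_time_def pre_variance_first)
  moreover have "ml k \<omega> = m0" "zl k = z0" by (simp_all add: ml_def left_variance_def)
  ultimately show ?thesis using pl by (simp add: node_def J_def X_def)
qed

lemma node_update:
  assumes g: "good \<omega>" and j: "j \<in> I" and nd: "node j \<omega>"
  shows "\<mu> (\<tau> j) \<omega> = gaussian (ml (Suc j) \<omega>) (zl (Suc j))"
    and "ml (Suc j) \<omega> = mp j \<omega> + zp j / (zp j + \<epsilon>\<^sup>2) * (observation \<epsilon> j \<omega> - mp j \<omega>)"
proof -
  have z: "zp j > 0" using pre_variance_pos[OF z0 s, of j] j by simp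
  have \<nu>: "\<nu> j \<omega> = gaussian (mp j \<omega>) (zp j)" using nd j by (simp add: node_def prelaw_def)
  have "\<mu> (\<tau> j) \<omega> = density (\<nu> j \<omega>) (\<lambda>x. ennreal (bayes_kernel \<epsilon> (\<nu> j \<omega>) (observation \<epsilon> j \<omega>) x))"
    using g j by (auto simp: good_def filter_path_def)
  hence 1: "\<mu> (\<tau> j) \<omega> = gaussian (mp j \<omega> + zp j / (zp j + \<epsilon>\<^sup>2) * (observation \<epsilon> j \<omega> - mp j \<omega>)) (post_variance (zp j))"
    unfolding \<nu> gaussian_bayes_update[OF z eps_pos] by (simp add: post_variance_def)
  have "ml (Suc j) \<omega> = (\<integral>x. x \<partial>\<mu> (\<tau> j) \<omega>)" using j by (simp add: ml_def)
  thus 2: "ml (Suc j) \<omega> = mp j \<omega> + zp j / (zp j + \<epsilon>\<^sup>2) * (observation \<epsilon> j \<omega> - mp j \<omega>)"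
    unfolding 1 by (simp add: gaussian_moments(2)[OF post_variance_pos[OF z]])
  show "\<mu> (\<tau> j) \<omega> = gaussian (ml (Suc j) \<omega>) (zl (Suc j))"
    unfolding 2 1 using j by (simp add: left_variance_def)
qed

lemma node_all:
  assumes g: "good \<omega>" and "k \<le> j" "j \<le> Suc n" shows "node j \<omega>"
  using assms(2,3)
proof (induction j rule: dec_induct)
  case base show ?case by (rule node_first[OF g])
next
  case (step j)
  hence j: "j \<in> I" by simp
  have "lt (Suc j) < \<tau> (Suc j)" using step by (intro left_time_less) auto
  moreover have "lt (Suc j) = \<tau> j" using step by (simp add: left_time_def)
  moreover have "node j \<omega>" using step by simp
  ultimately show ?case using node_update(1)[OF g j] step by (intro node_from_left[OF g]) auto
qed

text \<open>The innovation is centred given the predicted mean and has variance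
  \<open>zp j + \<epsilon>\<^sup>2\<close>. Multiplied by the squared gain this is a number that is
  the same for all controls.\<close>

lemma update_second_moment:
  assumes j: "j \<in> I"
  shows "(\<integral>\<^sup>+\<omega>. ennreal ((ml (Suc j) \<omega>)\<^sup>2) \<partial>P) =
    (\<integral>\<^sup>+\<omega>. ennreal ((mp j \<omega>)\<^sup>2) \<partial>P) + ennreal ((zp j)\<^sup>2 / (zp j + \<epsilon>\<^sup>2))"
proof -
  have z: "zp j > 0" using pre_variance_pos[OF z0 s, of j] j by simp
  have mpj: "mp j \<omega> = (\<integral>x. x \<partial>\<nu> j \<omega>)" for \<omega> using j by (simp add: mp_def prelaw_def)
  have law: "emeasure P {\<omega>\<in>space P. mp j \<omega> \<in> A \<and> state_sample j \<omega> \<in> B \<and> noise j \<omega> \<in> D} =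
      (\<integral>\<^sup>+\<omega>. indicator A (mp j \<omega>) * emeasure (gaussian (mp j \<omega>) (zp j)) B \<partial>P) * emeasure (gaussian 0 1) D"
    if s: "A \<in> sets borel" "B \<in> sets borel" "D \<in> sets borel" for A B D
  proof -
    let ?A = "{\<omega>\<in>space P. mp j \<omega> \<in> A}"
    have "?A \<in> past_events I j" using nu_mean_measurable(2)[OF j s(1)] by (simp add: mpj)
    hence "emeasure P {\<omega>\<in>?A. state_sample j \<omega> \<in> B \<and> noise j \<omega> \<in> D} =
       (\<integral>\<^sup>+\<omega>\<in>?A. emeasure (\<nu> j \<omega>) B \<partial>P) * emeasure (gaussian 0 1) D"
      using controlled[unfolded controlled_filter_def] j s(2,3) by blast
    moreover have "(\<integral>\<^sup>+\<omega>\<in>?A. emeasure (\<nu> j \<omega>) B \<partial>P) = (\<integral>\<^sup>+\<omega>. indicator A (mp j \<omega>) * emeasure (gaussian (mp j \<omega>) (zp j)) B \<partial>P)"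
    proof (rule nn_integral_cong_AE, use AE_good in eventually_elim)
      fix \<omega> assume g: "good \<omega>"
      hence "\<omega> \<in> space P" by (simp add: good_def)
      moreover have "\<nu> j \<omega> = gaussian (mp j \<omega>) (zp j)"
        using node_all[OF g, of j] j by (simp add: node_def prelaw_def)
      ultimately show "emeasure (\<nu> j \<omega>) B * indicator ?A \<omega> = indicator A (mp j \<omega>) * emeasure (gaussian (mp j \<omega>) (zp j)) B"
        by (auto simp: indicator_def)
    qed
    moreover have "{\<omega>\<in>?A. state_sample j \<omega> \<in> B \<and> noise j \<omega> \<in> D} = {\<omega>\<in>space P. mp j \<omega> \<in> A \<and> state_sample j \<omega> \<in> B \<and> noise j \<omega> \<in> D}"
      by auto
    ultimately show ?thesis by simp
  qed
  define c where "c = zp j / (zp j + \<epsilon>\<^sup>2)"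
  have "(\<integral>\<^sup>+\<omega>. ennreal ((ml (Suc j) \<omega>)\<^sup>2) \<partial>P) = 
     (\<integral>\<^sup>+\<omega>. ennreal ((mp j \<omega> + c * (state_sample j \<omega> + \<epsilon> * noise j \<omega> - mp j \<omega>))\<^sup>2) \<partial>P)"
  proof (rule nn_integral_cong_AE, use AE_good in eventually_elim)
    fix \<omega> assume g: "good \<omega>"
    have "node j \<omega>" using node_all[OF g, of j] j by simp
    from node_update(2)[OF g j this]
    show "ennreal ((ml (Suc j) \<omega>)\<^sup>2) = ennreal ((mp j \<omega> + c * (state_sample j \<omega> + \<epsilon> * noise j \<omega> - mp j \<omega>))\<^sup>2)"
      by (simp add: c_def observation_def)
  qed
  also have "\<dots> = (\<integral>\<^sup>+\<omega>. ennreal ((mp j \<omega>)\<^sup>2) \<partial>P) + ennreal (c\<^sup>2 * (zp j + \<epsilon>\<^sup>2))"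
    using j by (intro cond_gaussian_second_moment[OF prob_P z _ _ _ law] mp_measurable
       measurable_P[OF sample_measurable(1)] measurable_P[OF sample_measurable(2)]) auto
  also have "c\<^sup>2 * (zp j + \<epsilon>\<^sup>2) = (zp j)\<^sup>2 / (zp j + \<epsilon>\<^sup>2)"
  proof -
    have "zp j + \<epsilon>\<^sup>2 > 0" using z by (simp add: add_pos_nonneg)
    thus ?thesis by (simp add: c_def power2_eq_square)
  qed
  finally show ?thesis .
qed

lemma node_expectation:
  assumes j: "k \<le> j" "j \<le> Suc n"
  shows "(\<integral>\<^sup>+\<omega>. J j \<omega> \<partial>P) + ennreal (p (\<tau> j)) * (\<integral>\<^sup>+\<omega>. ennreal ((mp j \<omega>)\<^sup>2) \<partial>P) =
    ennreal (p (lt j)) * (\<integral>\<^sup>+\<omega>. ennreal ((ml j \<omega>)\<^sup>2) \<partial>P) + ennreal (ou_variance_integral \<theta> b (\<tau> j - lt j) (zl j))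
      + (\<integral>\<^sup>+\<omega>. X j \<omega> \<partial>P)"
proof -
  interpret prob_space P by (rule prob_P)
  note [measurable] = J_measurable[OF j] X_measurable[OF j] mp_measurable[OF j] ml_measurable[OF j]
  note b = left_time_bounds[OF j s]
  have pn: "p (\<tau> j) \<ge> 0" "p (lt j) \<ge> 0" using p_pos[of "\<tau> j"] p_pos[of "lt j"] b by auto
  have rn: "ou_variance_integral \<theta> b (\<tau> j - lt j) (zl j) \<ge> 0"
    using left_variance_pos[OF z0 s j] b by (intro ou_variance_integral_nonneg) auto
  have "(\<integral>\<^sup>+\<omega>. J j \<omega> \<partial>P) + ennreal (p (\<tau> j)) * (\<integral>\<^sup>+\<omega>. ennreal ((mp j \<omega>)\<^sup>2) \<partial>P) =
     (\<integral>\<^sup>+\<omega>. J j \<omega> + ennreal (p (\<tau> j) * (mp j \<omega>)\<^sup>2) \<partial>P)"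
    using pn by (simp add: nn_integral_add nn_integral_cmult ennreal_mult)
  also have "\<dots> = (\<integral>\<^sup>+\<omega>. ennreal (p (lt j) * (ml j \<omega>)\<^sup>2 + ou_variance_integral \<theta> b (\<tau> j - lt j) (zl j)) + X j \<omega> \<partial>P)"
    by (rule nn_integral_cong_AE, use AE_good in eventually_elim) (use node_all j in \<open>simp add: node_def\<close>)
  also have "\<dots> = ennreal (p (lt j)) * (\<integral>\<^sup>+\<omega>. ennreal ((ml j \<omega>)\<^sup>2) \<partial>P) + ennreal (ou_variance_integral \<theta> b (\<tau> j - lt j) (zl j))
      + (\<integral>\<^sup>+\<omega>. X j \<omega> \<partial>P)"
    using pn rn by (simp add: nn_integral_add nn_integral_cmult ennreal_mult ennreal_plus emeasure_space_1)
  finally show ?thesis .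
qed

text \<open>The balances are summed over the intervals. At an observation the factor
  \<open>p (\<tau> j)\<close> occurs with the second moment before and after the update, and the
  difference is the last summand of \<open>pre_value j\<close>. As values may be infinite, terms are
  regrouped by addition only.\<close>

lemma cost_telescope:
  assumes "k \<le> j" "j \<le> Suc n"
  shows "(\<Sum>i=k..j. \<integral>\<^sup>+\<omega>. J i \<omega> \<partial>P) + ennreal (p (\<tau> j)) * (\<integral>\<^sup>+\<omega>. ennreal ((mp j \<omega>)\<^sup>2) \<partial>P) + ennreal (pre_value j (zp j)) =
     ennreal (p s * m0\<^sup>2 + var_value k s z0) + (\<Sum>i=k..j. \<integral>\<^sup>+\<omega>. X i \<omega> \<partial>P)"
  using assms
proof (induction j rule: dec_induct)
  case base
  interpret prob_space P by (rule prob_P)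
  have "ennreal (p s * m0\<^sup>2 + var_value k s z0) = ennreal (p s) * ennreal (m0\<^sup>2) + 
     ennreal (ou_variance_integral \<theta> b (\<tau> k - s) z0) + ennreal (pre_value k (zp k))"
    using p_pos[OF sT] s z0
    by (simp add: var_value_def pre_variance_first ennreal_plus ennreal_mult ou_variance_integral_nonneg
        pre_value_nonneg ou_variance_pos add.assoc)
  thus ?case using node_expectation[OF order_refl k]
    by (simp add: left_time_def left_variance_def ml_def emeasure_space_1 add_ac)
next
  case (step j)
  hence j: "j \<in> I" and jS: "k \<le> Suc j" "Suc j \<le> Suc n" by auto
  have zj: "zp j > 0" "zp (Suc j) > 0"
    using pre_variance_pos[OF z0 s, of j] pre_variance_pos[OF z0 s, of "Suc j"] j by auto
  have pj: "p (\<tau> j) \<ge> 0" using p_pos[OF tau_le_T, of j] step by simp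
  let ?g = "(zp j)\<^sup>2 / (zp j + \<epsilon>\<^sup>2)" and ?R = "ou_variance_integral \<theta> b (\<tau> (Suc j) - lt (Suc j)) (zl (Suc j))"
  have R: "?R \<ge> 0" using left_variance_pos[OF z0 s jS] left_time_bounds[OF jS s] by (intro ou_variance_integral_nonneg) auto
  have g: "?g \<ge> 0" using zj by simp
  have lt: "lt (Suc j) = \<tau> j" using step by (simp add: left_time_def)
  have pv: "ennreal (pre_value j (zp j)) = ennreal ?R + ennreal (pre_value (Suc j) (zp (Suc j))) + ennreal (p (\<tau> j)) * ennreal ?g"
  proof -
    have "j \<le> n" using j by simp
    have "pre_value (Suc j) (zp (Suc j)) \<ge> 0" by (rule pre_value_nonneg[OF zj(2)])
    moreover have "ennreal (x + y + q * h) = ennreal x + ennreal y + ennreal q * ennreal h"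
      if "x \<ge> 0" "y \<ge> 0" "q \<ge> 0" "h \<ge> 0" for x y q h using that by (simp add: ennreal_plus ennreal_mult)
    ultimately show ?thesis unfolding pre_value_telescope[OF step(1) \<open>j \<le> n\<close>, of s z0] using R g pj by blast
  qed
  have "(\<Sum>i=k..Suc j. \<integral>\<^sup>+\<omega>. J i \<omega> \<partial>P) + ennreal (p (\<tau> (Suc j))) * (\<integral>\<^sup>+\<omega>. ennreal ((mp (Suc j) \<omega>)\<^sup>2) \<partial>P) + ennreal (pre_value (Suc j) (zp (Suc j)))
    = (\<Sum>i=k..j. \<integral>\<^sup>+\<omega>. J i \<omega> \<partial>P) + ((\<integral>\<^sup>+\<omega>. J (Suc j) \<omega> \<partial>P) + ennreal (p (\<tau> (Suc j))) * (\<integral>\<^sup>+\<omega>. ennreal ((mp (Suc j) \<omega>)\<^sup>2) \<partial>P)) 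
       + ennreal (pre_value (Suc j) (zp (Suc j)))"
    using step by (simp add: add_ac)
  also have "\<dots> = (\<Sum>i=k..j. \<integral>\<^sup>+\<omega>. J i \<omega> \<partial>P) + ennreal (p (\<tau> j)) * (\<integral>\<^sup>+\<omega>. ennreal ((mp j \<omega>)\<^sup>2) \<partial>P) 
       + (ennreal ?R + ennreal (pre_value (Suc j) (zp (Suc j))) + ennreal (p (\<tau> j)) * ennreal ?g) + (\<integral>\<^sup>+\<omega>. X (Suc j) \<omega> \<partial>P)"
    unfolding node_expectation[OF jS] lt update_second_moment[OF j] by (simp add: distrib_left add_ac)
  also have "\<dots> = (\<Sum>i=k..j. \<integral>\<^sup>+\<omega>. J i \<omega> \<partial>P) + ennreal (p (\<tau> j)) * (\<integral>\<^sup>+\<omega>. ennreal ((mp j \<omega>)\<^sup>2) \<partial>P) 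
       + ennreal (pre_value j (zp j)) + (\<integral>\<^sup>+\<omega>. X (Suc j) \<omega> \<partial>P)"
    unfolding pv ..
  also have "\<dots> = ennreal (p s * m0\<^sup>2 + var_value k s z0) + (\<Sum>i=k..j. \<integral>\<^sup>+\<omega>. X i \<omega> \<partial>P) + (\<integral>\<^sup>+\<omega>. X (Suc j) \<omega> \<partial>P)"
    using step.IH step by simp
  also have "\<dots> = ennreal (p s * m0\<^sup>2 + var_value k s z0) + (\<Sum>i=k..Suc j. \<integral>\<^sup>+\<omega>. X i \<omega> \<partial>P)"
    using step by (simp add: add_ac)
  finally show ?case .
qed

text \<open>The cells \<open>{lt j..<\<tau> j}\<close> tile \<open>{s..<T}\<close>, and the point
  \<open>T\<close> is a null set. Measurability of the integrand \<open>c\<close> is obtained cell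
  by cell, from its agreement with \<open>run_cost\<close>.\<close>

lemma path_cost:
  assumes g: "good \<omega>"
  defines "c \<equiv> \<lambda>t. (\<integral>\<^sup>+x. ennreal (x\<^sup>2) \<partial>\<mu> t \<omega>) + ennreal (C * (\<alpha> t \<omega>)\<^sup>2)"
  shows "(\<integral>\<^sup>+t\<in>{s..T}. c t \<partial>lborel) + (\<integral>\<^sup>+x. ennreal (x\<^sup>2) \<partial>\<mu> T \<omega>) =
    (\<Sum>j=k..Suc n. J j \<omega>) + ennreal ((mp (Suc n) \<omega>)\<^sup>2) + ennreal (zp (Suc n))"
proof -
  have \<omega>: "\<omega> \<in> space P" using g by (simp add: good_def)
  have piece: "c u * indicator {lt j..<\<tau> j} u = ennreal (run_cost j u \<omega>) * indicator {lt j..<\<tau> j} u"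
    if j: "k \<le> j" "j \<le> Suc n" for j u
  proof (cases "u \<in> {lt j..<\<tau> j}")
    case True
    note b = left_time_bounds[OF j s]
    have u: "u \<in> {s..T}" using True b by auto
    have Z: "ou_variance \<theta> b (u - lt j) (zl j) > 0" using True left_variance_pos[OF z0 s j] by (intro ou_variance_pos) auto
    have "\<mu> u \<omega> = gaussian (mean j u \<omega>) (ou_variance \<theta> b (u - lt j) (zl j))"
      using node_all[OF g j] True by (simp add: node_def)
    thus ?thesis using Z C_pos by (simp add: c_def run_cost_def gaussian_moments(4)[OF Z] ctrl_eq[OF u] ennreal_plus)
  qed simp
  have piece_meas: "(\<lambda>u. c u * indicator {lt j..<\<tau> j} u) \<in> borel_measurable lborel" if j: "k \<le> j" "j \<le> Suc n" for j
    unfolding piece[OF j] using measurable_Pair2[OF run_cost_measurable(1)[OF j] \<omega>] by simp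
  have "(\<lambda>u. c u * indicator {s..<\<tau> j} u) \<in> borel_measurable lborel \<and>
      (\<integral>\<^sup>+u. c u * indicator {s..<\<tau> j} u \<partial>lborel) = (\<Sum>i=k..j. J i \<omega>)" if "k \<le> j" "j \<le> Suc n" for j
    using that
  proof (induction j rule: dec_induct)
    case base
    have "(\<integral>\<^sup>+u. c u * indicator {lt k..<\<tau> k} u \<partial>lborel) = J k \<omega>" unfolding J_def piece[OF order_refl k] ..
    thus ?case using piece_meas[OF order_refl k] by (simp add: left_time_def)
  next
    case (step j)
    hence jS: "k \<le> Suc j" "Suc j \<le> Suc n" by auto
    have lt: "lt (Suc j) = \<tau> j" using step by (simp add: left_time_def)
    have "s \<le> \<tau> j" "\<tau> j \<le> \<tau> (Suc j)" using left_time_bounds[OF jS s] lt by auto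
    hence split: "c u * indicator {s..<\<tau> (Suc j)} u = c u * indicator {s..<\<tau> j} u + c u * indicator {lt (Suc j)..<\<tau> (Suc j)} u" for u
      unfolding lt by (auto simp: indicator_def)
    have IH: "(\<lambda>u. c u * indicator {s..<\<tau> j} u) \<in> borel_measurable lborel"
      "(\<integral>\<^sup>+u. c u * indicator {s..<\<tau> j} u \<partial>lborel) = (\<Sum>i=k..j. J i \<omega>)" using step by auto
    have 2: "(\<integral>\<^sup>+u. c u * indicator {lt (Suc j)..<\<tau> (Suc j)} u \<partial>lborel) = J (Suc j) \<omega>" unfolding J_def piece[OF jS] ..
    show ?case unfolding split
    proof
      show "(\<lambda>u. c u * indicator {s..<\<tau> j} u + c u * indicator {lt (Suc j)..<\<tau> (Suc j)} u) \<in> borel_measurable lborel"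
        by (intro borel_measurable_add IH(1) piece_meas[OF jS])
      have "(\<integral>\<^sup>+u. c u * indicator {s..<\<tau> j} u + c u * indicator {lt (Suc j)..<\<tau> (Suc j)} u \<partial>lborel) = 
        (\<Sum>i=k..j. J i \<omega>) + J (Suc j) \<omega>"
        unfolding nn_integral_add[OF IH(1) piece_meas[OF jS]] IH(2) 2 ..
      also have "\<dots> = (\<Sum>i=k..Suc j. J i \<omega>)" using jS by (simp add: add_ac)
      finally show "(\<integral>\<^sup>+u. c u * indicator {s..<\<tau> j} u + c u * indicator {lt (Suc j)..<\<tau> (Suc j)} u \<partial>lborel) = (\<Sum>i=k..Suc j. J i \<omega>)" .
    qed
  qed
  from this[OF k order_refl] have "(\<integral>\<^sup>+u. c u * indicator {s..<T} u \<partial>lborel) = (\<Sum>i=k..Suc n. J i \<omega>)"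
    by (simp add: tau_T)
  moreover have "(\<integral>\<^sup>+t\<in>{s..T}. c t \<partial>lborel) = (\<integral>\<^sup>+u. c u * indicator {s..<T} u \<partial>lborel)"
    by (rule nn_integral_cong_AE, use AE_lborel_singleton[of T] in eventually_elim) (auto simp: indicator_def)
  moreover have "(\<integral>\<^sup>+x. ennreal (x\<^sup>2) \<partial>\<mu> T \<omega>) = ennreal ((mp (Suc n) \<omega>)\<^sup>2) + ennreal (zp (Suc n))"
  proof -
    have Z: "zp (Suc n) > 0" using pre_variance_pos[OF z0 s k] by simp
    have "\<mu> T \<omega> = gaussian (mp (Suc n) \<omega>) (zp (Suc n))"
      using node_all[OF g k order_refl] by (simp add: node_def prelaw_def)
    thus ?thesis using Z by (simp add: gaussian_moments(4)[OF Z] ennreal_plus)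
  qed
  ultimately show ?thesis by (simp add: add.assoc)
qed

text \<open>At the node \<open>n + 1\<close> one has \<open>p T = 1\<close>, and the remaining value
  is the variance itself, so the left side of \<open>cost_telescope\<close> becomes the expected
  cost.\<close>

theorem expected_cost_eq:
  "expected_cost C T s \<alpha> P \<mu> = ennreal (p s * m0\<^sup>2 + var_value k s z0) + (\<Sum>j=k..Suc n. \<integral>\<^sup>+\<omega>. X j \<omega> \<partial>P)"
proof -
  interpret prob_space P by (rule prob_P)
  have Jm: "J j \<in> borel_measurable P" if "j \<in> {k..Suc n}" for j using J_measurable that by simp
  note [measurable] = mp_measurable[OF k order_refl]
  have "expected_cost C T s \<alpha> P \<mu> = (\<integral>\<^sup>+\<omega>. (\<Sum>j=k..Suc n. J j \<omega>) + ennreal ((mp (Suc n) \<omega>)\<^sup>2) + ennreal (zp (Suc n)) \<partial>P)"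
    unfolding expected_cost_def
    by (rule nn_integral_cong_AE, use AE_good in eventually_elim) (rule path_cost)
  also have "\<dots> = (\<integral>\<^sup>+\<omega>. (\<Sum>j=k..Suc n. J j \<omega>) \<partial>P) + (\<integral>\<^sup>+\<omega>. ennreal ((mp (Suc n) \<omega>)\<^sup>2) \<partial>P) + ennreal (zp (Suc n))"
  proof -
    have "(\<lambda>\<omega>. \<Sum>j=k..Suc n. J j \<omega>) \<in> borel_measurable P" by (intro borel_measurable_sum Jm)
    thus ?thesis by (subst nn_integral_add, measurable, subst nn_integral_add) (auto simp: emeasure_space_1)
  qed
  also have "(\<integral>\<^sup>+\<omega>. (\<Sum>j=k..Suc n. J j \<omega>) \<partial>P) = (\<Sum>j=k..Suc n. \<integral>\<^sup>+\<omega>. J j \<omega> \<partial>P)"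
    by (intro nn_integral_sum Jm)
  finally show ?thesis
    using cost_telescope[OF k order_refl] by (simp add: tau_T p_T pre_value_last)
qed

end

section \<open>The optimal control\<close>

lemma weak_evolution_cong:
  assumes "weak_evolution \<theta> b a' \<mu>' r t" "r \<le> t"
    and "\<And>u. u \<in> {r..t} \<Longrightarrow> \<mu> u = \<mu>' u" "\<And>u. u \<in> {r..t} \<Longrightarrow> a u = a' u"
  shows "weak_evolution \<theta> b a \<mu> r t"
  unfolding weak_evolution_def
proof (intro allI impI)
  fix f assume f: "test_function f"
  have e: "(\<integral>x. generator \<theta> b (a u) f x \<partial>\<mu> u) = (\<integral>x. generator \<theta> b (a' u) f x \<partial>\<mu>' u)" if "u \<in> {r..t}" for u
    using assms(3,4)[OF that] by simp
  have 1: "set_integrable lborel {r..t} (\<lambda>u. \<integral>x. generator \<theta> b (a u) f x \<partial>\<mu> u) \<longleftrightarrow>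
      set_integrable lborel {r..t} (\<lambda>u. \<integral>x. generator \<theta> b (a' u) f x \<partial>\<mu>' u)"
    by (rule set_integrable_cong) (use e in auto)
  have 2: "(LINT u:{r..t}|lborel. (\<integral>x. generator \<theta> b (a u) f x \<partial>\<mu> u)) = (LINT u:{r..t}|lborel. (\<integral>x. generator \<theta> b (a' u) f x \<partial>\<mu>' u))"
    by (rule set_lebesgue_integral_cong) (use e in auto)
  have "r \<in> {r..t}" "t \<in> {r..t}" using assms(2) by auto
  with assms(3) have 3: "\<mu> r = \<mu>' r" "\<mu> t = \<mu>' t" by blast+
  show "set_integrable lborel {r..t} (\<lambda>u. \<integral>x. generator \<theta> b (a u) f x \<partial>\<mu> u) \<and>
        (\<integral>x. f x \<partial>\<mu> t) = (\<integral>x. f x \<partial>\<mu> r) + (LINT u:{r..t}|lborel. (\<integral>x. generator \<theta> b (a u) f x \<partial>\<mu> u))"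
    unfolding 1 2 3 using assms(1) f unfolding weak_evolution_def by blast
qed

text \<open>Having the same coordinates below \<open>i\<close> is preserved by every operation that
  generates the sigma-algebra. This allows coordinate \<open>i\<close> to be varied inside a past
  event.\<close>

lemma past_events_cong:
  assumes A: "A \<in> past_events I i" and \<omega>: "\<omega> \<in> space (outcome_space I)" "\<omega>' \<in> space (outcome_space I)"
    and eq: "\<And>j. j \<in> I \<Longrightarrow> j < i \<Longrightarrow> \<omega> j = \<omega>' j"
  shows "\<omega> \<in> A \<longleftrightarrow> \<omega>' \<in> A"
  using A unfolding past_events_def
proof (induction rule: sigma_sets.induct)
  case (Basic a) thus ?case using eq \<omega> by auto
next
  case Empty thus ?case by simp
next
  case (Compl a) thus ?case using \<omega> by auto
next
  case (Union a) thus ?case by auto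
qed

lemma past_events_sets: "past_events I i \<subseteq> sets (outcome_space I)"
  unfolding past_events_def
  by (rule sets.sigma_sets_subset) (auto intro!: measurable_sets coordinate_measurable)

text \<open>The start data of a competitor, but without control, probability and filter: these are
  constructed here.\<close>

locale lq_start = observed_ou \<theta> b C \<epsilon> T n \<tau>
  for \<theta> b C \<epsilon> T :: real and n :: nat and \<tau> :: "nat \<Rightarrow> real" +
  fixes k :: nat and s m0 z0 :: real
  assumes k: "k \<le> Suc n" and s: "s \<le> \<tau> k" and z0: "z0 > 0"
begin

abbreviation "I \<equiv> {k..n}"
abbreviation "lt \<equiv> left_time k s"
abbreviation "zl \<equiv> left_variance k s z0"
abbreviation "zp \<equiv> pre_variance k s z0"
abbreviation "gain i \<equiv> zp i / (zp i + \<epsilon>\<^sup>2)"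

lemma sT: "s \<le> T"
  using s tau_le_T[OF k] by simp

lemma zp_pos: "k \<le> j \<Longrightarrow> j \<le> Suc n \<Longrightarrow> zp j > 0" and zl_pos: "k \<le> j \<Longrightarrow> j \<le> Suc n \<Longrightarrow> zl j > 0"
  using pre_variance_pos[OF z0 s] left_variance_pos[OF z0 s] by auto

text \<open>Under the feedback \<open>\<alpha> = - p M / C\<close> the conditional mean is \<open>M = \<psi> coef\<close> with a coefficient that only
  changes at the observations; \<open>coef i\<close> is its value immediately before the observation \<open>i\<close>.\<close>

primrec coef :: "nat \<Rightarrow> outcome \<Rightarrow> real" where
  "coef 0 \<omega> = m0 / \<psi> s"
| "coef (Suc i) \<omega> = (if i \<in> I then coef i \<omega> + gain i * (observation \<epsilon> i \<omega> - \<psi> (\<tau> i) * coef i \<omega>) / \<psi> (\<tau> i) else coef i \<omega>)"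

lemma coef_first: "i \<le> k \<Longrightarrow> coef i \<omega> = m0 / \<psi> s"
  by (induction i) auto

text \<open>The set \<open>J\<close> is free: observations up to a time give adaptedness of the
  mean, strictly earlier ones give measurability of the law before an update.\<close>

lemma coef_measurable:
  assumes "\<And>i. i \<in> I \<Longrightarrow> i < j \<Longrightarrow> i \<in> J"
  shows "coef j \<in> borel_measurable (observation_sigma \<epsilon> I J)"
  using assms
proof (induction j)
  case 0 thus ?case by (simp add: coef.simps(1)[abs_def])
next
  case (Suc j)
  hence IH: "coef j \<in> borel_measurable (observation_sigma \<epsilon> I J)" by simp
  show ?case
  proof (cases "j \<in> I")
    case True
    hence "j \<in> J" using Suc by simp
    note [measurable] = observation_measurable_sigma[OF this, of \<epsilon> I] IH
    have "(\<lambda>\<omega>. coef j \<omega> + gain j * (observation \<epsilon> j \<omega> - \<psi> (\<tau> j) * coef j \<omega>) / \<psi> (\<tau> j)) \<in> borel_measurable (observation_sigma \<epsilon> I J)"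
      by measurable
    thus ?thesis using True by (simp add: coef.simps(2)[abs_def] del: coef.simps)
  next
    case False
    hence "coef (Suc j) = coef j" by (intro ext) auto
    thus ?thesis using IH by (simp only:)
  qed
qed

text \<open>The value \<open>n + 1\<close> means that no observation is left.\<close>
definition next_obs :: "real \<Rightarrow> nat" where "next_obs t = (LEAST j. k \<le> j \<and> (j = Suc n \<or> t < \<tau> j))"

text \<open>The level sets are the cells \<open>{lt j..<\<tau> j}\<close>, except that the last cell
  is unbounded to the right and so contains \<open>T\<close>.\<close>

lemma next_obs_eq:
  assumes "k \<le> j" "j \<le> Suc n" "lt j \<le> u" "u < \<tau> j \<or> j = Suc n"
  shows "next_obs u = j"
  unfolding next_obs_def
proof (rule Least_equality)
  fix i assume i: "k \<le> i \<and> (i = Suc n \<or> u < \<tau> i)"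
  show "j \<le> i"
  proof (rule ccontr)
    assume "\<not> j \<le> i"
    hence ij: "i \<le> j - 1" "k < j" "i \<noteq> Suc n" "j - 1 \<le> Suc n" using i assms by auto
    hence "\<tau> i \<le> \<tau> (j - 1)" by (intro tau_le) auto
    thus False using i ij assms(3) by (auto simp: left_time_def)
  qed
qed (use assms in auto)

lemma next_obs_cell:
  assumes "s \<le> t"
  shows "k \<le> next_obs t" "next_obs t \<le> Suc n" "lt (next_obs t) \<le> t" "t < \<tau> (next_obs t) \<or> next_obs t = Suc n"
proof -
  let ?P = "\<lambda>j. k \<le> j \<and> (j = Suc n \<or> t < \<tau> j)"
  have "?P (Suc n)" using k by simp
  from LeastI[of ?P, OF this] Least_le[of ?P, OF this]
  show 1: "k \<le> next_obs t" "next_obs t \<le> Suc n" "t < \<tau> (next_obs t) \<or> next_obs t = Suc n"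
    by (auto simp: next_obs_def)
  show "lt (next_obs t) \<le> t"
  proof (cases "next_obs t = k")
    case False
    hence "\<not> ?P (next_obs t - 1)" using 1 unfolding next_obs_def by (intro not_less_Least) auto
    thus ?thesis using 1 False by (auto simp: left_time_def)
  qed (use assms in \<open>simp add: left_time_def\<close>)
qed

lemma next_obs_tau: 
  assumes "i \<in> I" shows "next_obs (\<tau> i) = Suc i"
  using assms tau_less[of i "Suc i"] by (intro next_obs_eq) (auto simp: left_time_def)

definition M :: "real \<Rightarrow> outcome \<Rightarrow> real" where "M t \<omega> = \<psi> t * coef (next_obs t) \<omega>"
definition \<alpha> :: "real \<Rightarrow> outcome \<Rightarrow> real" where "\<alpha> t \<omega> = - p t * M t \<omega> / C"
definition \<mu> :: "real \<Rightarrow> outcome \<Rightarrow> real measure" where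
  "\<mu> t \<omega> = gaussian (M t \<omega>) (ou_variance \<theta> b (t - lt (next_obs t)) (zl (next_obs t)))"
definition \<nu> :: "nat \<Rightarrow> outcome \<Rightarrow> real measure" where "\<nu> i \<omega> = gaussian (\<psi> (\<tau> i) * coef i \<omega>) (zp i)"

lemma var_pos: "s \<le> t \<Longrightarrow> ou_variance \<theta> b (t - lt (next_obs t)) (zl (next_obs t)) > 0"
  using next_obs_cell[of t] by (intro ou_variance_pos zl_pos) auto

text \<open>By minimality of \<open>next_obs t\<close>, every observation with a smaller index has
  been made by time \<open>t\<close>.\<close>

lemma M_measurable:
  assumes "t \<in> {s..T}" shows "M t \<in> borel_measurable (obs_filtration \<epsilon> \<tau> I t)"
proof -
  have "coef (next_obs t) \<in> borel_measurable (obs_filtration \<epsilon> \<tau> I t)"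
    unfolding obs_filtration_def
  proof (rule coef_measurable)
    fix i assume i: "i \<in> I" "i < next_obs t"
    hence "\<not> (k \<le> i \<and> (i = Suc n \<or> t < \<tau> i))" unfolding next_obs_def by (intro not_less_Least)
    thus "i \<in> {i \<in> I. \<tau> i \<le> t}" using i by auto
  qed
  thus ?thesis unfolding M_def[abs_def] by measurable
qed

lemma admissible: "admissible_control \<epsilon> T \<tau> I s \<alpha>"
  unfolding admissible_control_def
proof
  show "\<forall>t\<in>{s..T}. \<alpha> t \<in> borel_measurable (obs_filtration \<epsilon> \<tau> I t)"
  proof
    fix t assume "t \<in> {s..T}"
    note [measurable] = M_measurable[OF this]
    show "\<alpha> t \<in> borel_measurable (obs_filtration \<epsilon> \<tau> I t)" unfolding \<alpha>_def[abs_def] by measurable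
  qed
  let ?R = "restrict_space borel {s..T} \<Otimes>\<^sub>M outcome_space I"
  have coef: "coef j \<in> borel_measurable (outcome_space I)" for j
    by (rule measurable_from_subalg[OF observation_sigma_subalgebra coef_measurable[of j I]]) auto
  have id: "(\<lambda>t. t) \<in> borel_measurable (restrict_space borel {s..T})" by (intro measurable_restrict_space1) simp
  have fst: "fst \<in> borel_measurable ?R" by (rule measurable_compose[OF measurable_fst id])
  have N: "next_obs \<in> borel \<rightarrow>\<^sub>M count_space UNIV" unfolding next_obs_def[abs_def] by measurable
  have Nf: "(\<lambda>q. next_obs (fst q)) \<in> ?R \<rightarrow>\<^sub>M count_space UNIV" by (rule measurable_compose[OF fst N])
  \<comment> \<open>The index takes countably many values, so it is enough that each single
    coefficient is measurable.\<close>
  have c: "(\<lambda>q. coef (next_obs (fst q)) (snd q)) \<in> borel_measurable ?R"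
    by (rule measurable_compose_countable[OF measurable_compose[OF measurable_snd coef] Nf])
  have "(\<lambda>t. p t * \<psi> t) \<in> borel_measurable borel"
    unfolding p_def \<psi>_def riccati_num_def riccati_den_def cosh_def sinh_def by measurable
  from measurable_compose[OF fst this] c
  have "(\<lambda>q. - (p (fst q) * \<psi> (fst q) * coef (next_obs (fst q)) (snd q)) / C) \<in> borel_measurable ?R" by measurable
  thus "(\<lambda>(t, \<omega>). \<alpha> t \<omega>) \<in> borel_measurable ?R" by (simp add: \<alpha>_def M_def case_prod_beta mult.assoc)
qed

text \<open>Between observations the coefficient \<open>c\<close> is constant and
  \<open>psi_deriv\<close> is the mean equation under the feedback. The stretch may extend to
  \<open>\<tau> j\<close> itself, which later yields the left limit there.\<close>

lemma path_weak:
  assumes "k \<le> j" "j \<le> Suc n" "lt j \<le> r" "r \<le> t" "t \<le> \<tau> j"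
  shows "weak_evolution \<theta> b (\<lambda>u. - p u * (\<psi> u * c) / C) (\<lambda>u. gaussian (\<psi> u * c) (ou_variance \<theta> b (u - lt j) (zl j))) r t"
proof (rule gaussian_weak_evolution[OF assms(4)])
  have T: "u \<le> T" if "u \<in> {r..t}" for u using that assms tau_le_T[of j] by auto
  fix u assume u: "u \<in> {r..t}"
  show "((\<lambda>u. \<psi> u * c) has_real_derivative - \<theta> * (\<psi> u * c) + - p u * (\<psi> u * c) / C) (at u within {r..t})"
    using DERIV_cmult_right[OF psi_deriv[OF T[OF u]], of c "{r..t}"] by (simp add: algebra_simps)
  have "((\<lambda>u. u - lt j) has_real_derivative 1) (at u within {r..t})" by (auto intro!: derivative_eq_intros)
  from DERIV_chain2[OF ou_variance_deriv[where \<theta> = \<theta> and b = b and z = "zl j"] this]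
  show "((\<lambda>u. ou_variance \<theta> b (u - lt j) (zl j)) has_real_derivative b\<^sup>2 - 2 * \<theta> * ou_variance \<theta> b (u - lt j) (zl j)) (at u within {r..t})"
    unfolding ou_variance_ode by simp
  show "0 < ou_variance \<theta> b (u - lt j) (zl j)" using u assms zl_pos by (intro ou_variance_pos) auto
next
  have T: "u \<le> T" if "u \<in> {r..t}" for u using that assms tau_le_T[of j] by auto
  have "continuous_on {r..t} p" "continuous_on {r..t} \<psi>"
    by (rule DERIV_continuous_on[OF p_deriv[OF T]] DERIV_continuous_on[OF psi_deriv[OF T]]; assumption)+
  thus "continuous_on {r..t} (\<lambda>u. - p u * (\<psi> u * c) / C)" using C_pos by (intro continuous_intros) auto
qed

lemma filter: "filter_path \<theta> b \<epsilon> T \<tau> I s (gaussian m0 z0) (\<lambda>t. \<alpha> t \<omega>) (\<lambda>i. observation \<epsilon> i \<omega>) (\<lambda>t. \<mu> t \<omega>) (\<lambda>i. \<nu> i \<omega>)"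
  unfolding filter_path_def
proof (intro conjI impI ballI allI)
  have psi_s: "\<psi> s > 0" using psi_pos sT by simp
  show "\<mu> s \<omega> = gaussian m0 z0" if "\<forall>i\<in>I. \<tau> i \<noteq> s"
  proof -
    have "s < \<tau> k \<or> k = Suc n" using that s k by (cases "k \<le> n") force+
    hence "next_obs s = k" using k by (intro next_obs_eq) (auto simp: left_time_def)
    thus ?thesis using psi_s by (simp add: \<mu>_def M_def coef_first left_time_def left_variance_def)
  qed
next
  fix i assume i: "i \<in> I" "\<tau> i = s"
  have "i = k" using i s tau_less[of k i] by (cases "i = k") auto
  moreover have "\<psi> s > 0" using psi_pos sT by simp
  ultimately show "\<nu> i \<omega> = gaussian m0 z0" using i by (simp add: \<nu>_def coef_first pre_variance_first)
next
  fix t assume "t \<in> {s..T}"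
  thus "has_second_moment (\<mu> t \<omega>)" unfolding \<mu>_def by (intro gaussian_moments(3) var_pos) simp
next
  fix r t assume rt: "s \<le> r" "r \<le> t" "t \<le> T" and no: "\<forall>i\<in>I. \<tau> i \<notin> {r<..t}"
  define j where "j = next_obs r"
  note cell = next_obs_cell[OF rt(1), folded j_def]
  \<comment> \<open>Without an observation in \<open>{r<..t}\<close> the index
    \<open>next_obs\<close> is constant on \<open>{r..t}\<close>, so one formula describes the whole
    stretch.\<close>
  have tj: "t < \<tau> j \<or> j = Suc n"
  proof (cases "j = Suc n")
    case False
    hence "j \<in> I" "r < \<tau> j" using cell by auto
    thus ?thesis using no rt by force
  qed simp
  have N: "next_obs u = j" if "u \<in> {r..t}" for u
    using that cell tj by (intro next_obs_eq) auto
  have "weak_evolution \<theta> b (\<lambda>u. - p u * (\<psi> u * coef j \<omega>) / C) (\<lambda>u. gaussian (\<psi> u * coef j \<omega>) (ou_variance \<theta> b (u - lt j) (zl j))) r t"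
    using cell tj rt tau_T by (intro path_weak) auto
  thus "weak_evolution \<theta> b (\<lambda>t. \<alpha> t \<omega>) (\<lambda>t. \<mu> t \<omega>) r t"
    by (rule weak_evolution_cong[OF _ rt(2)]) (simp_all add: \<mu>_def \<alpha>_def M_def N)
next
  fix i assume "i \<in> I" thus "has_second_moment (\<nu> i \<omega>)" unfolding \<nu>_def by (intro gaussian_moments(3) zp_pos) auto
next
  fix i f assume i: "i \<in> I" "s < \<tau> i" and f: "test_function f"
  have ki: "k \<le> i" "i \<le> Suc n" using i by auto
  have lt: "lt i < \<tau> i" using i left_time_less[of k i s] by (cases "i = k") (auto simp: left_time_def)
  \<comment> \<open>The formula of the cell before \<open>\<tau> i\<close>, continued to its right
    end, where it gives \<open>\<nu> i\<close> and not the updated law.\<close>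
  let ?\<mu> = "\<lambda>u. gaussian (\<psi> u * coef i \<omega>) (ou_variance \<theta> b (u - lt i) (zl i))"
  have "primitive_on (lt i) (\<tau> i) (\<lambda>u. \<integral>x. f x \<partial>?\<mu> u) (\<lambda>u. \<integral>x. generator \<theta> b (- p u * (\<psi> u * coef i \<omega>) / C) f x \<partial>?\<mu> u)"
  proof (rule weak_ou_path.test_primitive[OF weak_ou_path.intro f])
    show "lt i \<le> \<tau> i" using lt by simp
    fix u assume u: "u \<in> {lt i..\<tau> i}"
    have Z: "ou_variance \<theta> b (u - lt i) (zl i) > 0" using u zl_pos[OF ki] by (intro ou_variance_pos) auto
    show "prob_space (?\<mu> u)" "sets (?\<mu> u) = sets borel" "has_second_moment (?\<mu> u)"
      using prob_space_gaussian[OF Z] gaussian_moments(3)[OF Z] by auto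
    show "weak_evolution \<theta> b (\<lambda>u. - p u * (\<psi> u * coef i \<omega>) / C) ?\<mu> (lt i) u"
      using u by (intro path_weak[OF ki]) auto
  qed
  from primitive_on_continuous[OF this] lt
  have "((\<lambda>u. \<integral>x. f x \<partial>?\<mu> u) \<longlongrightarrow> (\<integral>x. f x \<partial>?\<mu> (\<tau> i))) (at (\<tau> i) within {lt i..\<tau> i})"
    by (auto simp: continuous_on)
  moreover have "?\<mu> (\<tau> i) = \<nu> i \<omega>" unfolding \<nu>_def pre_variance_left[OF ki(1)] ..
  ultimately have 1: "((\<lambda>u. \<integral>x. f x \<partial>?\<mu> u) \<longlongrightarrow> (\<integral>x. f x \<partial>\<nu> i \<omega>)) (at_left (\<tau> i))"
    by (simp add: at_within_Icc_at_left[OF lt])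
  have "\<forall>\<^sub>F u in at_left (\<tau> i). u \<in> {lt i..<\<tau> i}"
    using eventually_at_left[OF lt] lt by (auto intro!: exI[of _ "lt i"])
  hence "\<forall>\<^sub>F u in at_left (\<tau> i). (\<integral>x. f x \<partial>?\<mu> u) = (\<integral>x. f x \<partial>\<mu> u \<omega>)"
  proof eventually_elim
    fix u assume "u \<in> {lt i..<\<tau> i}"
    hence "next_obs u = i" using ki by (intro next_obs_eq) auto
    thus "(\<integral>x. f x \<partial>?\<mu> u) = (\<integral>x. f x \<partial>\<mu> u \<omega>)" by (simp add: \<mu>_def M_def)
  qed
  from Lim_transform_eventually[OF 1 this]
  show "((\<lambda>t. \<integral>x. f x \<partial>\<mu> t \<omega>) \<longlongrightarrow> (\<integral>x. f x \<partial>\<nu> i \<omega>)) (at_left (\<tau> i))" .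
next
  fix i assume i: "i \<in> I"
  have z: "zp i > 0" using i by (intro zp_pos) auto
  have "\<tau> i \<le> T" using i by (intro tau_le_T) auto
  hence ps: "\<psi> (\<tau> i) > 0" by (rule psi_pos)
  have "\<mu> (\<tau> i) \<omega> = gaussian (\<psi> (\<tau> i) * coef (Suc i) \<omega>) (post_variance (zp i))"
    using i by (simp add: \<mu>_def M_def next_obs_tau[OF i] left_time_def left_variance_def del: coef.simps)
  also have "\<psi> (\<tau> i) * coef (Suc i) \<omega> = \<psi> (\<tau> i) * coef i \<omega> + gain i * (observation \<epsilon> i \<omega> - \<psi> (\<tau> i) * coef i \<omega>)"
    using i ps by (simp add: distrib_left)
  also have "gaussian \<dots> (post_variance (zp i)) = density (\<nu> i \<omega>) (\<lambda>x. ennreal (bayes_kernel \<epsilon> (\<nu> i \<omega>) (observation \<epsilon> i \<omega>) x))"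
    unfolding \<nu>_def gaussian_bayes_update[OF z eps_pos] post_variance_def ..
  finally show "\<mu> (\<tau> i) \<omega> = density (\<nu> i \<omega>) (\<lambda>x. ennreal (bayes_kernel \<epsilon> (\<nu> i \<omega>) (observation \<epsilon> i \<omega>) x))" .
qed

text \<open>The law of states and noises, as the image of independent standard Gaussian pairs \<open>x i\<close>:
  \<open>icoef\<close> is \<open>coef\<close> as a function of these innovations.\<close>

abbreviation "pair_law \<equiv> gaussian 0 1 \<Otimes>\<^sub>M gaussian 0 1"

definition Q :: "outcome measure" where "Q = (\<Pi>\<^sub>M i\<in>I. pair_law)"

primrec icoef :: "nat \<Rightarrow> outcome \<Rightarrow> real" where
  "icoef 0 x = m0 / \<psi> s"
| "icoef (Suc i) x = (if i \<in> I then icoef i x + gain i * (sqrt (zp i) * fst (x i) + \<epsilon> * snd (x i)) / \<psi> (\<tau> i) else icoef i x)"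

definition \<Theta> :: "outcome \<Rightarrow> outcome" where
  "\<Theta> x = (\<lambda>i\<in>I. (\<psi> (\<tau> i) * icoef i x + sqrt (zp i) * fst (x i), snd (x i)))"

definition P :: "outcome measure" where "P = distr Q (outcome_space I) \<Theta>"

lemma sets_pair_law: "sets pair_law = sets (borel :: (real \<times> real) measure)"
proof -
  have "sets pair_law = sets (borel \<Otimes>\<^sub>M borel :: (real \<times> real) measure)"
    by (intro sets_pair_measure_cong sets_gaussian)
  thus ?thesis by (simp only: borel_prod)
qed

lemma sets_Q: "sets Q = sets (outcome_space I)"
  unfolding Q_def outcome_space_def by (intro sets_PiM_cong refl sets_pair_law)

lemma prob_space_pair_law: "prob_space pair_law"
proof -
  interpret G: prob_space "gaussian 0 1" by (rule prob_space_gaussian) simp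
  interpret pair_prob_space "gaussian 0 1" "gaussian 0 1" ..
  show ?thesis by unfold_locales
qed

lemma prob_space_Q: "prob_space Q"
  unfolding Q_def by (rule prob_space_PiM) (rule prob_space_pair_law)

lemma coord_Q: "i \<in> I \<Longrightarrow> (\<lambda>x. x i) \<in> Q \<rightarrow>\<^sub>M borel"
  using coordinate_measurable[of i I] measurable_cong_sets[OF sets_Q refl] by blast

lemma icoef_measurable: "icoef j \<in> borel_measurable Q"
proof (induction j)
  case 0 thus ?case by (simp add: icoef.simps(1)[abs_def])
next
  case (Suc j)
  show ?case
  proof (cases "j \<in> I")
    case True
    note [measurable] = coord_Q[OF True] Suc
    have "(\<lambda>x. icoef j x + gain j * (sqrt (zp j) * fst (x j) + \<epsilon> * snd (x j)) / \<psi> (\<tau> j)) \<in> borel_measurable Q"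
      by measurable
    thus ?thesis using True by (simp add: icoef.simps(2)[abs_def] del: icoef.simps)
  next
    case False
    hence "icoef (Suc j) = icoef j" by (intro ext) auto
    thus ?thesis using Suc by (simp only:)
  qed
qed

lemma Theta_measurable: "\<Theta> \<in> Q \<rightarrow>\<^sub>M outcome_space I"
  unfolding \<Theta>_def[abs_def] outcome_space_def
proof (rule measurable_restrict)
  fix i assume i: "i \<in> I"
  note [measurable] = coord_Q[OF i] icoef_measurable[of i]
  have "(\<lambda>x. (\<psi> (\<tau> i) * icoef i x + sqrt (zp i) * fst (x i), snd (x i))) \<in> Q \<rightarrow>\<^sub>M borel \<Otimes>\<^sub>M borel" by measurable
  thus "(\<lambda>x. (\<psi> (\<tau> i) * icoef i x + sqrt (zp i) * fst (x i), snd (x i))) \<in> Q \<rightarrow>\<^sub>M borel" by (simp add: borel_prod)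
qed

lemma icoef_cong: "(\<And>j. j \<in> I \<Longrightarrow> j < i \<Longrightarrow> x j = y j) \<Longrightarrow> icoef i x = icoef i y"
  by (induction i) auto

text \<open>The observation minus the predicted mean is
  \<open>sqrt (zp i) * fst (x i) + \<epsilon> * snd (x i)\<close>, so the recursion of
  \<open>coef\<close> along \<open>\<Theta>\<close> turns into that of \<open>icoef\<close>.\<close>

lemma coef_Theta: "coef i (\<Theta> x) = icoef i x"
proof (induction i)
  case (Suc i)
  show ?case
  proof (cases "i \<in> I")
    case True
    have "observation \<epsilon> i (\<Theta> x) = \<psi> (\<tau> i) * icoef i x + (sqrt (zp i) * fst (x i) + \<epsilon> * snd (x i))"
      using True by (simp add: observation_def state_sample_def noise_def \<Theta>_def)
    thus ?thesis using Suc True by simp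
  qed (use Suc in auto)
qed simp

lemma prob_P: "prob_space P"
  unfolding P_def by (rule prob_space.prob_space_distr[OF prob_space_Q Theta_measurable])

text \<open>Fubini for the independent pairs: coordinate \<open>i\<close> is integrated with all the
  others fixed. Neither the past event nor the predicted mean depends on that coordinate, so the
  inner integral factorises.\<close>

lemma conditional_law:
  assumes i: "i \<in> I" and A: "A \<in> past_events I i" and B: "B \<in> sets borel" and D: "D \<in> sets borel"
  shows "emeasure P {\<omega>\<in>A. state_sample i \<omega> \<in> B \<and> noise i \<omega> \<in> D} =
          (\<integral>\<^sup>+\<omega>\<in>A. emeasure (\<nu> i \<omega>) B \<partial>P) * emeasure (gaussian 0 1) D"
proof -
  interpret pl: prob_space pair_law by (rule prob_space_pair_law)
  interpret G: prob_space "gaussian 0 1" by (rule prob_space_gaussian) simp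
  interpret product_sigma_finite "\<lambda>_. pair_law" by unfold_locales
  let ?I = "I - {i}"
  have I: "I = insert i ?I" "finite ?I" "i \<notin> ?I" using i by auto
  have A': "A \<in> sets (outcome_space I)" using A past_events_sets by blast
  have z: "zp i > 0" using i by (intro zp_pos) auto
  note sm = sample_measurable(1)[OF i] sample_measurable(2)[OF i]
  have E: "{\<omega>\<in>A. state_sample i \<omega> \<in> B \<and> noise i \<omega> \<in> D} \<in> sets (outcome_space I)"
  proof -
    have "A \<inter> (state_sample i -` B \<inter> space (outcome_space I)) \<inter> (noise i -` D \<inter> space (outcome_space I)) \<in> sets (outcome_space I)"
      using A' measurable_sets[OF sm(1) B] measurable_sets[OF sm(2) D] by auto
    also have "A \<inter> (state_sample i -` B \<inter> space (outcome_space I)) \<inter> (noise i -` D \<inter> space (outcome_space I)) =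
       {\<omega>\<in>A. state_sample i \<omega> \<in> B \<and> noise i \<omega> \<in> D}" using sets.sets_into_space[OF A'] by auto
    finally show ?thesis .
  qed
  let ?E = "{\<omega>\<in>A. state_sample i \<omega> \<in> B \<and> noise i \<omega> \<in> D}"
  define g where "g x = emeasure (gaussian (\<psi> (\<tau> i) * icoef i x) (zp i)) B" for x
  have gm: "g \<in> borel_measurable Q"
  proof -
    have "(\<lambda>m. emeasure (gaussian m (zp i)) B) \<in> borel_measurable borel"
      using measurable_compose[OF measurable_prob_algebraD[OF gaussian_measurable_mean[OF z]] measurable_emeasure_subprob_algebra[OF B]] .
    from measurable_compose[OF _ this, of "\<lambda>x. \<psi> (\<tau> i) * icoef i x" Q] icoef_measurable[of i]
    show ?thesis unfolding g_def[abs_def] by measurable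
  qed
  \<comment> \<open>\<open>f\<close> is the indicator of the event, pulled back by
    \<open>\<Theta>\<close>; in \<open>h\<close> the state and noise factors are replaced by their
    probabilities given the past.\<close>
  define f :: "outcome \<Rightarrow> ennreal" where "f x = indicator A (\<Theta> x) * indicator B (\<psi> (\<tau> i) * icoef i x + sqrt (zp i) * fst (x i)) * indicator D (snd (x i))" 
    for x
  define h where "h x = indicator A (\<Theta> x) * g x * emeasure (gaussian 0 1) D" for x
  have indA: "(\<lambda>x. indicator A (\<Theta> x) :: ennreal) \<in> borel_measurable Q"
    using Theta_measurable A' by measurable
  have hm: "h \<in> borel_measurable Q" unfolding h_def[abs_def] using Theta_measurable A' gm by measurable
  have fE: "f x = indicator ?E (\<Theta> x)" for x
    using i by (auto simp: f_def indicator_def \<Theta>_def state_sample_def noise_def)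
  have fm: "f \<in> borel_measurable Q" unfolding fE[abs_def] using Theta_measurable E by measurable
  have inner: "(\<integral>\<^sup>+y. f (x(i := y)) \<partial>pair_law) = (\<integral>\<^sup>+y. h (x(i := y)) \<partial>pair_law)"
    if x: "x \<in> space (\<Pi>\<^sub>M i\<in>?I. pair_law)" for x
  proof -
    \<comment> \<open>An arbitrary reference value for coordinate \<open>i\<close>, to name
      quantities that do not depend on it.\<close>
    let ?y0 = "(0, 0) :: real \<times> real"
    have ic: "icoef i (x(i := y)) = icoef i (x(i := ?y0))" for y by (rule icoef_cong) auto
    have xs: "\<Theta> x' \<in> space (outcome_space I)" for x'
      by (auto simp: outcome_space_def space_PiM \<Theta>_def)
    have AA: "\<Theta> (x(i := y)) \<in> A \<longleftrightarrow> \<Theta> (x(i := ?y0)) \<in> A" for y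
    proof (rule past_events_cong[OF A xs xs])
      fix j assume j: "j \<in> I" "j < i"
      have "icoef j (x(i := y)) = icoef j (x(i := ?y0))" by (rule icoef_cong) (use j in auto)
      thus "\<Theta> (x(i := y)) j = \<Theta> (x(i := ?y0)) j" using j by (simp add: \<Theta>_def)
    qed
    define m where "m = \<psi> (\<tau> i) * icoef i (x(i := ?y0))"
    have mi: "\<psi> (\<tau> i) * icoef i (x(i := y)) = m" for y unfolding m_def using ic[of y] by (rule arg_cong)
    define ia where "ia = (indicator A (\<Theta> (x(i := ?y0))) :: ennreal)"
    have ia: "indicator A (\<Theta> (x(i := y))) = ia" for y unfolding ia_def using AA[of y] by (simp add: indicator_def)
    let ?B = "(\<lambda>w. m + sqrt (zp i) * w) -` B"
    have Bm: "?B \<in> sets borel" using measurable_sets[of "\<lambda>w. m + sqrt (zp i) * w" borel borel B] B by simp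
    have gB: "emeasure (gaussian m (zp i)) B = emeasure (gaussian 0 1) ?B"
      unfolding gaussian_eq_distr[OF z, of m] using B by (subst emeasure_distr) auto
    have "(\<integral>\<^sup>+y. f (x(i := y)) \<partial>pair_law) = (\<integral>\<^sup>+y. ia * indicator (?B \<times> D) y \<partial>pair_law)"
      unfolding f_def ia mi by (intro nn_integral_cong) (auto simp: indicator_def split: prod.splits)
    also have "\<dots> = ia * (emeasure (gaussian 0 1) ?B * emeasure (gaussian 0 1) D)"
      using Bm D by (simp add: nn_integral_cmult_indicator G.emeasure_pair_measure_Times)
    also have "\<dots> = (\<integral>\<^sup>+y. h (x(i := y)) \<partial>pair_law)"
      unfolding h_def g_def ia mi gB by (simp add: pl.emeasure_space_1 mult.assoc)
    finally show ?thesis .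
  qed
  have ins: "(\<integral>\<^sup>+x. q x \<partial>Q) = (\<integral>\<^sup>+x. \<integral>\<^sup>+y. q (x(i := y)) \<partial>pair_law \<partial>(\<Pi>\<^sub>M i\<in>?I. pair_law))"
    if q: "q \<in> borel_measurable Q" for q
  proof -
    have "q \<in> borel_measurable (\<Pi>\<^sub>M i\<in>insert i ?I. pair_law)" using q I(1) by (simp add: Q_def)
    from product_nn_integral_insert[OF I(2,3) this] show ?thesis using I(1) by (simp add: Q_def)
  qed
  have "emeasure P ?E = (\<integral>\<^sup>+x. f x \<partial>Q)"
  proof -
    have "emeasure P ?E = (\<integral>\<^sup>+\<omega>. indicator ?E \<omega> \<partial>P)" using E by (simp add: P_def)
    also have "\<dots> = (\<integral>\<^sup>+x. indicator ?E (\<Theta> x) \<partial>Q)"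
      unfolding P_def using E Theta_measurable by (intro nn_integral_distr) auto
    finally show ?thesis by (simp add: fE)
  qed
  also have "\<dots> = (\<integral>\<^sup>+x. h x \<partial>Q)"
    unfolding ins[OF fm] ins[OF hm] by (rule nn_integral_cong) (rule inner)
  also have "\<dots> = (\<integral>\<^sup>+x. indicator A (\<Theta> x) * g x \<partial>Q) * emeasure (gaussian 0 1) D"
    unfolding h_def
  proof (rule nn_integral_multc)
    show "(\<lambda>x. indicator A (\<Theta> x) * g x) \<in> borel_measurable Q" using Theta_measurable A' gm by measurable
  qed
  also have "(\<integral>\<^sup>+x. indicator A (\<Theta> x) * g x \<partial>Q) = (\<integral>\<^sup>+\<omega>\<in>A. emeasure (\<nu> i \<omega>) B \<partial>P)"
  proof -
    have cm: "coef i \<in> borel_measurable (outcome_space I)"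
      by (rule measurable_from_subalg[OF observation_sigma_subalgebra coef_measurable[of i I]]) auto
    have "(\<lambda>m. emeasure (gaussian m (zp i)) B) \<in> borel_measurable borel"
      using measurable_compose[OF measurable_prob_algebraD[OF gaussian_measurable_mean[OF z]] measurable_emeasure_subprob_algebra[OF B]] .
    from measurable_compose[OF _ this, of "\<lambda>\<omega>. \<psi> (\<tau> i) * coef i \<omega>" "outcome_space I"] cm
    have "(\<lambda>\<omega>. emeasure (\<nu> i \<omega>) B) \<in> borel_measurable (outcome_space I)" unfolding \<nu>_def by measurable
    hence "(\<lambda>\<omega>. emeasure (\<nu> i \<omega>) B * indicator A \<omega>) \<in> borel_measurable (outcome_space I)" using A' by measurable
    hence "(\<integral>\<^sup>+\<omega>\<in>A. emeasure (\<nu> i \<omega>) B \<partial>P) = (\<integral>\<^sup>+x. emeasure (\<nu> i (\<Theta> x)) B * indicator A (\<Theta> x) \<partial>Q)"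
      unfolding P_def using Theta_measurable by (intro nn_integral_distr) auto
    thus ?thesis by (simp add: \<nu>_def g_def coef_Theta mult.commute)
  qed
  finally show ?thesis .
qed

lemma controlled: "controlled_filter \<theta> b \<epsilon> T \<tau> I s (gaussian m0 z0) \<alpha> P \<mu> \<nu>"
  unfolding controlled_filter_def
proof (intro conjI ballI)
  show "prob_space P" by (rule prob_P)
  show "sets P = sets (outcome_space I)" by (simp add: P_def)
  show "\<mu> t \<in> obs_filtration \<epsilon> \<tau> I t \<rightarrow>\<^sub>M prob_algebra borel" if "t \<in> {s..T}" for t
    unfolding \<mu>_def[abs_def] using that
    by (intro measurable_compose[OF M_measurable gaussian_measurable_mean] var_pos) auto
  show "\<nu> i \<in> obs_filtration_left \<epsilon> \<tau> I (\<tau> i) \<rightarrow>\<^sub>M prob_algebra borel" if "i \<in> I" for i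
  proof -
    have "coef i \<in> borel_measurable (obs_filtration_left \<epsilon> \<tau> I (\<tau> i))"
      unfolding obs_filtration_left_def using that by (intro coef_measurable) (auto intro: tau_less)
    hence "(\<lambda>\<omega>. \<psi> (\<tau> i) * coef i \<omega>) \<in> borel_measurable (obs_filtration_left \<epsilon> \<tau> I (\<tau> i))" by measurable
    from measurable_compose[OF this gaussian_measurable_mean] show ?thesis
      unfolding \<nu>_def[abs_def] using zp_pos[of i] that by simp
  qed
  show "emeasure P {\<omega>\<in>A. state_sample i \<omega> \<in> B \<and> noise i \<omega> \<in> D} =
          (\<integral>\<^sup>+\<omega>\<in>A. emeasure (\<nu> i \<omega>) B \<partial>P) * emeasure (gaussian 0 1) D"
    if "i \<in> I" "A \<in> past_events I i" "B \<in> sets borel" "D \<in> sets borel" for i A B D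
    using that by (rule conditional_law)
  show "AE \<omega> in P. filter_path \<theta> b \<epsilon> T \<tau> I s (gaussian m0 z0) (\<lambda>t. \<alpha> t \<omega>) (\<lambda>i. observation \<epsilon> i \<omega>) (\<lambda>t. \<mu> t \<omega>) (\<lambda>i. \<nu> i \<omega>)"
    by (rule AE_I2) (rule filter)
qed

text \<open>Makes the cost identity for competitors available for the constructed control.\<close>

sublocale opt: controlled_ou \<theta> b C \<epsilon> T n \<tau> k s m0 z0 \<alpha> P \<mu> \<nu>
  by unfold_locales (rule k s z0 admissible controlled)+

text \<open>Both \<open>opt.mean\<close> and \<open>M\<close> are the mean of the same law
  \<open>\<mu> u\<close>, so the control coincides with its own feedback and the square
  vanishes.\<close>

lemma opt_excess:
  assumes g: "opt.good \<omega>" and j: "k \<le> j" "j \<le> Suc n"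
  shows "opt.X j \<omega> = 0"
proof -
  have "ennreal (opt.excess j u \<omega>) * indicator {lt j..<\<tau> j} u = 0" for u
  proof (cases "u \<in> {lt j..<\<tau> j}")
    case True
    hence u: "u \<in> {s..T}" using left_time_bounds[OF j s] by auto
    have Z: "ou_variance \<theta> b (u - lt j) (zl j) > 0" using True zl_pos[OF j] by (intro ou_variance_pos) auto
    have N: "next_obs u = j" using True j by (intro next_obs_eq) auto
    have "\<mu> u \<omega> = gaussian (opt.mean j u \<omega>) (ou_variance \<theta> b (u - lt j) (zl j))"
      using opt.node_all[OF g j] True by (simp add: opt.node_def)
    hence "opt.mean j u \<omega> = (\<integral>x. x \<partial>\<mu> u \<omega>)" by (simp add: gaussian_moments(2)[OF Z])
    also have "\<dots> = M u \<omega>" unfolding \<mu>_def N by (rule gaussian_moments(2)[OF Z])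
    finally show ?thesis by (simp add: opt.excess_def opt.ctrl_eq[OF u] \<alpha>_def)
  qed simp
  thus ?thesis unfolding opt.X_def by (simp only: nn_integral_const) simp
qed

theorem optimal_cost_eq:
  "optimal_cost \<theta> b C \<epsilon> T \<tau> I s (gaussian m0 z0) = ennreal (p s * m0\<^sup>2 + var_value k s z0)"
proof (rule antisym)
  have "(\<integral>\<^sup>+\<omega>. opt.X j \<omega> \<partial>P) = 0" if "j \<in> {k..Suc n}" for j
  proof -
    have "(\<integral>\<^sup>+\<omega>. opt.X j \<omega> \<partial>P) = (\<integral>\<^sup>+\<omega>. 0 \<partial>P)"
      by (rule nn_integral_cong_AE, use opt.AE_good in eventually_elim) (use opt_excess that in auto)
    thus ?thesis by simp
  qed
  hence "expected_cost C T s \<alpha> P \<mu> = ennreal (p s * m0\<^sup>2 + var_value k s z0)"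
    unfolding opt.expected_cost_eq by simp
  thus "optimal_cost \<theta> b C \<epsilon> T \<tau> I s (gaussian m0 z0) \<le> ennreal (p s * m0\<^sup>2 + var_value k s z0)"
    unfolding optimal_cost_def using admissible controlled by (intro Inf_lower) (metis (mono_tags, lifting) mem_Collect_eq)
  show "ennreal (p s * m0\<^sup>2 + var_value k s z0) \<le> optimal_cost \<theta> b C \<epsilon> T \<tau> I s (gaussian m0 z0)"
    unfolding optimal_cost_def
  proof (rule Inf_greatest)
    fix c assume "c \<in> {expected_cost C T s \<alpha> P \<mu> |\<alpha> P \<mu> \<nu>.
      admissible_control \<epsilon> T \<tau> I s \<alpha> \<and> controlled_filter \<theta> b \<epsilon> T \<tau> I s (gaussian m0 z0) \<alpha> P \<mu> \<nu>}"
    then obtain \<alpha>' P' \<mu>' \<nu>' where c: "c = expected_cost C T s \<alpha>' P' \<mu>'"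
      and a: "admissible_control \<epsilon> T \<tau> I s \<alpha>'" "controlled_filter \<theta> b \<epsilon> T \<tau> I s (gaussian m0 z0) \<alpha>' P' \<mu>' \<nu>'"
      by blast
    interpret any: controlled_ou \<theta> b C \<epsilon> T n \<tau> k s m0 z0 \<alpha>' P' \<mu>' \<nu>'
      by unfold_locales (rule k s z0 a)+
    show "ennreal (p s * m0\<^sup>2 + var_value k s z0) \<le> c"
      unfolding c any.expected_cost_eq by simp
  qed
qed

end

section \<open>The value function in Gaussian coordinates\<close>

context observed_ou
begin

lemma V_eq:
  assumes k: "k \<le> Suc n" and set: "{i\<in>{1..n}. t < \<tau> i} = {k..n}" and t: "t \<le> \<tau> k" and z: "z > 0"
  shows "V \<theta> b C \<epsilon> T n \<tau> t (gaussian m z) = ennreal (p t * m\<^sup>2 + var_value k t z)"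
proof -
  interpret lq_start \<theta> b C \<epsilon> T n \<tau> k t m z by unfold_locales (rule k t z)+
  show ?thesis unfolding V_def set by (rule optimal_cost_eq)
qed

text \<open>Here the start is \<open>s = \<tau> i\<close> with \<open>k = i\<close>: the first
  stretch has length zero and \<open>var_value\<close> reduces to \<open>pre_value\<close>.\<close>

lemma V_left_eq:
  assumes i: "i \<in> {1..n}" and z: "z > 0"
  shows "V_left \<theta> b C \<epsilon> T n \<tau> (\<tau> i) (gaussian m z) = ennreal (p (\<tau> i) * m\<^sup>2 + pre_value i z)"
proof -
  have set: "{j\<in>{1..n}. \<tau> i \<le> \<tau> j} = {i..n}"
  proof (intro equalityI subsetI)
    fix j assume j: "j \<in> {j\<in>{1..n}. \<tau> i \<le> \<tau> j}"
    hence "\<not> j < i" using tau_less[of j i] i by auto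
    thus "j \<in> {i..n}" using j by auto
  qed (use i tau_le[of i] in auto)
  interpret lq_start \<theta> b C \<epsilon> T n \<tau> i "\<tau> i" m z by unfold_locales (use i z in auto)
  show ?thesis unfolding V_left_def set using optimal_cost_eq by (simp add: var_value_self)
qed

text \<open>The search starts at index \<open>1\<close> because \<open>\<tau> 0\<close> is no
  observation time. At the horizon it returns \<open>n + 1\<close>, with no observation
  left.\<close>

lemma next_observation:
  obtains k where "k \<le> Suc n" "{i\<in>{1..n}. t < \<tau> i} = {k..n}" "t \<le> T \<longrightarrow> t \<le> \<tau> k"
proof -
  define k where "k = (LEAST j. 1 \<le> j \<and> (j = Suc n \<or> t < \<tau> j))"
  let ?P = "\<lambda>j. 1 \<le> j \<and> (j = Suc n \<or> t < \<tau> j)"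
  have "?P (Suc n)" by simp
  from LeastI[of ?P, OF this] Least_le[of ?P, OF this]
  have k: "1 \<le> k" "k = Suc n \<or> t < \<tau> k" "k \<le> Suc n" by (auto simp: k_def)
  have "{i\<in>{1..n}. t < \<tau> i} = {k..n}"
  proof (intro equalityI subsetI)
    fix i assume i: "i \<in> {i\<in>{1..n}. t < \<tau> i}"
    hence "k \<le> i" unfolding k_def by (intro Least_le) auto
    thus "i \<in> {k..n}" using i by auto
  next
    fix i assume i: "i \<in> {k..n}"
    hence "t < \<tau> k" "\<tau> k \<le> \<tau> i" using k tau_le[of k i] by auto
    thus "i \<in> {i\<in>{1..n}. t < \<tau> i}" using i k by auto
  qed
  moreover have "t \<le> T \<longrightarrow> t \<le> \<tau> k" using k tau_T by auto
  ultimately show ?thesis using k that by blast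
qed

lemma U_hat_eq:
  assumes i: "i \<le> n" and r: "r \<in> {\<tau> i..<\<tau> (Suc i)}" and z: "z > 0"
  shows "U_hat \<theta> b C \<epsilon> T n \<tau> r m z = p r * m\<^sup>2 + var_value (Suc i) r z"
proof -
  have set: "{j\<in>{1..n}. r < \<tau> j} = {Suc i..n}"
  proof (intro equalityI subsetI)
    fix j assume j: "j \<in> {j\<in>{1..n}. r < \<tau> j}"
    hence "\<not> j \<le> i" using tau_le[of j i] i r by auto
    thus "j \<in> {Suc i..n}" using j by auto
  next
    fix j assume j: "j \<in> {Suc i..n}"
    thus "j \<in> {j\<in>{1..n}. r < \<tau> j}" using tau_le[of "Suc i" j] r by auto
  qed
  have "r \<le> T" using r tau_le_T[of "Suc i"] i by auto
  hence "p r * m\<^sup>2 + var_value (Suc i) r z \<ge> 0"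
    using p_pos[of r] r by (intro add_nonneg_nonneg var_value_nonneg[OF z]) auto
  thus ?thesis unfolding U_hat_def using i r by (subst V_eq[OF _ set _ z]) auto
qed

lemma U_hat_final:
  assumes "z > 0" shows "U_hat \<theta> b C \<epsilon> T n \<tau> T m z = m\<^sup>2 + z"
proof -
  have set: "{j\<in>{1..n}. T < \<tau> j} = {Suc n..n}" using tau_le_T by (auto simp: not_less)
  have "V \<theta> b C \<epsilon> T n \<tau> T (gaussian m z) = ennreal (m\<^sup>2 + z)"
    using var_value_self[of "Suc n" z] by (subst V_eq[OF _ set _ assms]) (auto simp: tau_T p_T pre_value_last)
  moreover have "m\<^sup>2 + z \<ge> 0" using assms by simp
  ultimately show ?thesis by (simp only: U_hat_def enn2real_ennreal)
qed

text \<open>The closed form with next node \<open>i + 1\<close> holds on this cell, so the time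
  derivative is taken within it; at \<open>\<tau> i\<close> this is the derivative from the
  right.\<close>

lemma U_hat_hjb:
  assumes i: "i \<le> n" and t: "t \<in> {\<tau> i..<\<tau> (Suc i)}" and z: "z > 0"
  shows "\<exists>Ut Um Uz.
    ((\<lambda>r. U_hat \<theta> b C \<epsilon> T n \<tau> r m z) has_real_derivative Ut) (at t within {\<tau> i..<\<tau> (Suc i)}) \<and>
    ((\<lambda>m'. U_hat \<theta> b C \<epsilon> T n \<tau> t m' z) has_real_derivative Um) (at m) \<and>
    ((\<lambda>z'. U_hat \<theta> b C \<epsilon> T n \<tau> t m z') has_real_derivative Uz) (at z) \<and>
    Ut + z + m\<^sup>2 - \<theta> * m * Um + (b\<^sup>2 - 2 * \<theta> * z) * Uz - 1 / (4 * C) * Um\<^sup>2 = 0"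
proof -
  let ?S = "{\<tau> i..<\<tau> (Suc i)}"
  have tT: "t \<le> \<tau> (Suc i)" "t \<le> T" using t tau_le_T[of "Suc i"] i by auto
  obtain Ut Um Uz where
    d: "((\<lambda>r. p r * m\<^sup>2 + var_value (Suc i) r z) has_real_derivative Ut) (at t within ?S)"
    "((\<lambda>m'. p t * m'\<^sup>2 + var_value (Suc i) t z) has_real_derivative Um) (at m)"
    "((\<lambda>z'. p t * m\<^sup>2 + var_value (Suc i) t z') has_real_derivative Uz) (at z)"
    and eq: "Ut + z + m\<^sup>2 - \<theta> * m * Um + (b\<^sup>2 - 2 * \<theta> * z) * Uz - 1 / (4 * C) * Um\<^sup>2 = 0"
    by (rule value_hjb[OF z tT])
  have "((\<lambda>r. U_hat \<theta> b C \<epsilon> T n \<tau> r m z) has_real_derivative Ut) (at t within ?S)"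
    by (rule has_field_derivative_transform_within[OF d(1) zero_less_one t]) (simp add: U_hat_eq[OF i _ z])
  moreover have "((\<lambda>m'. U_hat \<theta> b C \<epsilon> T n \<tau> t m' z) has_real_derivative Um) (at m)"
    by (rule has_field_derivative_transform_within[OF d(2) zero_less_one UNIV_I]) (simp add: U_hat_eq[OF i t z])
  moreover have "((\<lambda>z'. U_hat \<theta> b C \<epsilon> T n \<tau> t m z') has_real_derivative Uz) (at z)"
  \<comment> \<open>The radius \<open>z\<close> keeps the nearby variances positive, where the
    closed form is available.\<close>
  proof (rule has_field_derivative_transform_within[OF d(3) z UNIV_I])
    fix z' assume "dist z' z < z"
    hence "z' > 0" by (simp add: dist_real_def)
    thus "p t * m\<^sup>2 + var_value (Suc i) t z' = U_hat \<theta> b C \<epsilon> T n \<tau> t m z'" by (simp add: U_hat_eq[OF i t])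
  qed
  ultimately show ?thesis using eq by blast
qed

text \<open>The value after the update is quadratic in \<open>w\<close>, so only the second moment
  matters. It adds \<open>p (\<tau> i) * (z\<^sup>2 / (z + \<epsilon>\<^sup>2))\<close>, which is
  the extra summand in \<open>pre_value_step\<close>.\<close>

lemma U_hat_jump:
  fixes m z :: real
  assumes i: "i \<in> {1..n}" and z: "z > 0"
  defines "f \<equiv> \<lambda>w. U_hat \<theta> b C \<epsilon> T n \<tau> (\<tau> i) (m + z / sqrt (z + \<epsilon>\<^sup>2) * w) (z * \<epsilon>\<^sup>2 / (z + \<epsilon>\<^sup>2)) * std_normal_density w"
  shows "integrable lborel f" "U_hat_left \<theta> b C \<epsilon> T n \<tau> (\<tau> i) m z = (\<integral>w. f w \<partial>lborel)"
proof -
  interpret G: prob_space "gaussian 0 1" by (rule prob_space_gaussian) simp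
  have iT: "\<tau> i \<le> T" and it: "\<tau> i \<in> {\<tau> i..<\<tau> (Suc i)}" using i tau_le_T[of i] tau_less[of i "Suc i"] by auto
  define c where "c = z / sqrt (z + \<epsilon>\<^sup>2)"
  define W where "W = var_value (Suc i) (\<tau> i) (post_variance z)"
  have c2: "c\<^sup>2 = z\<^sup>2 / (z + \<epsilon>\<^sup>2)" using z by (simp add: c_def power_divide add_nonneg_nonneg)
  define g where "g w = p (\<tau> i) * (m + c * w)\<^sup>2 + W" for w
  have f: "f = (\<lambda>w. std_normal_density w * g w)"
  proof
    fix w
    have "U_hat \<theta> b C \<epsilon> T n \<tau> (\<tau> i) (m + c * w) (post_variance z) = g w"
      using i unfolding g_def W_def by (intro U_hat_eq[OF _ it post_variance_pos[OF z]]) auto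
    thus "f w = std_normal_density w * g w" by (simp add: f_def c_def post_variance_def mult.commute)
  qed
  have gi: "integrable (gaussian 0 1) g" unfolding g_def
    using std_gaussian_affine_square(1) by (intro Bochner_Integration.integrable_add integrable_mult_right) auto
  have gm: "g \<in> borel_measurable lborel" unfolding g_def by measurable
  show "integrable lborel f" unfolding f using gi gm by (simp add: gaussian_std integrable_density)
  have "(\<integral>w. f w \<partial>lborel) = (\<integral>w. g w \<partial>gaussian 0 1)" unfolding f using gm by (simp add: gaussian_std integral_density)
  also have "\<dots> = p (\<tau> i) * (m\<^sup>2 + c\<^sup>2) + W"
    unfolding g_def using std_gaussian_affine_square(1,2) G.prob_space by simp
  also have "\<dots> = p (\<tau> i) * m\<^sup>2 + pre_value i z"
    using i by (simp add: c2 W_def pre_value_step distrib_left)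
  finally have e: "(\<integral>w. f w \<partial>lborel) = p (\<tau> i) * m\<^sup>2 + pre_value i z" .
  have "p (\<tau> i) * m\<^sup>2 + pre_value i z \<ge> 0"
    using p_pos[OF iT] by (intro add_nonneg_nonneg pre_value_nonneg[OF z]) auto
  thus "U_hat_left \<theta> b C \<epsilon> T n \<tau> (\<tau> i) m z = (\<integral>w. f w \<partial>lborel)"
    unfolding e by (simp add: U_hat_left_def V_left_eq[OF i z])
qed

end

text \<open>Values are read as reals through \<open>enn2real\<close>, which sends infinity to zero,
  and the integral of a non-integrable function is zero by convention. Finiteness and integrability
  are therefore asserted together with the equations, so that none of them holds by a default
  value.\<close>

theorem lemma4p3:
  fixes \<theta> b C \<epsilon> T :: real and n :: nat and \<tau> :: "nat \<Rightarrow> real"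
  defines "U \<equiv> U_hat \<theta> b C \<epsilon> T n \<tau>"
    and "U_left \<equiv> U_hat_left \<theta> b C \<epsilon> T n \<tau>"
  assumes "C > 0" and "\<epsilon> > 0" and "T > 0"
    and "\<tau> 0 = 0" and "\<tau> (Suc n) = T" and "strict_mono_on {0..Suc n} \<tau>"
  shows
    "(\<forall>t\<in>{0..T}. \<forall>m z. z > 0 \<longrightarrow> V \<theta> b C \<epsilon> T n \<tau> t (gaussian m z) < \<infinity>) \<and>
     (\<forall>i\<in>{1..n}. \<forall>m z. z > 0 \<longrightarrow> V_left \<theta> b C \<epsilon> T n \<tau> (\<tau> i) (gaussian m z) < \<infinity>) \<and>
     (\<forall>i\<in>{0..n}. \<forall>t\<in>{\<tau> i..<\<tau> (Suc i)}. \<forall>m z. z > 0 \<longrightarrow>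
        (\<exists>Ut Um Uz.
           ((\<lambda>r. U r m z) has_real_derivative Ut) (at t within {\<tau> i..<\<tau> (Suc i)}) \<and>
           ((\<lambda>m'. U t m' z) has_real_derivative Um) (at m) \<and>
           ((\<lambda>z'. U t m z') has_real_derivative Uz) (at z) \<and>
           Ut + z + m\<^sup>2 - \<theta> * m * Um + (b\<^sup>2 - 2 * \<theta> * z) * Uz - 1 / (4 * C) * Um\<^sup>2 = 0)) \<and>
     (\<forall>i\<in>{1..n}. \<forall>m z. z > 0 \<longrightarrow>
        integrable lborel (\<lambda>w. U (\<tau> i) (m + z / sqrt (z + \<epsilon>\<^sup>2) * w) (z * \<epsilon>\<^sup>2 / (z + \<epsilon>\<^sup>2))
                               * std_normal_density w) \<and>
        U_left (\<tau> i) m z =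
          (\<integral>w. U (\<tau> i) (m + z / sqrt (z + \<epsilon>\<^sup>2) * w) (z * \<epsilon>\<^sup>2 / (z + \<epsilon>\<^sup>2))
                 * std_normal_density w \<partial>lborel)) \<and>
     (\<forall>m z. z > 0 \<longrightarrow> U T m z = m\<^sup>2 + z)"
proof -
  interpret observed_ou \<theta> b C \<epsilon> T n \<tau> by unfold_locales (use assms in auto)
  show ?thesis
  proof (intro conjI ballI allI impI)
    fix t m z :: real assume t: "t \<in> {0..T}" and z: "z > 0"
    obtain k where "k \<le> Suc n" "{i\<in>{1..n}. t < \<tau> i} = {k..n}" "t \<le> T \<longrightarrow> t \<le> \<tau> k" by (rule next_observation)
    thus "V \<theta> b C \<epsilon> T n \<tau> t (gaussian m z) < \<infinity>" using t z by (simp add: V_eq)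
  next
    fix i :: nat and m z :: real assume "i \<in> {1..n}" "z > 0"
    thus "V_left \<theta> b C \<epsilon> T n \<tau> (\<tau> i) (gaussian m z) < \<infinity>" by (simp add: V_left_eq)
  next
    fix i :: nat and t m z :: real assume "i \<in> {0..n}" "t \<in> {\<tau> i..<\<tau> (Suc i)}" "z > 0"
    thus "\<exists>Ut Um Uz.
           ((\<lambda>r. U r m z) has_real_derivative Ut) (at t within {\<tau> i..<\<tau> (Suc i)}) \<and>
           ((\<lambda>m'. U t m' z) has_real_derivative Um) (at m) \<and>
           ((\<lambda>z'. U t m z') has_real_derivative Uz) (at z) \<and>
           Ut + z + m\<^sup>2 - \<theta> * m * Um + (b\<^sup>2 - 2 * \<theta> * z) * Uz - 1 / (4 * C) * Um\<^sup>2 = 0"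
      unfolding U_def by (intro U_hat_hjb) auto
  next
    fix i :: nat and m z :: real assume "i \<in> {1..n}" "z > 0"
    from U_hat_jump[OF this, of m]
    show "integrable lborel (\<lambda>w. U (\<tau> i) (m + z / sqrt (z + \<epsilon>\<^sup>2) * w) (z * \<epsilon>\<^sup>2 / (z + \<epsilon>\<^sup>2)) * std_normal_density w)"
      and "U_left (\<tau> i) m z = (\<integral>w. U (\<tau> i) (m + z / sqrt (z + \<epsilon>\<^sup>2) * w) (z * \<epsilon>\<^sup>2 / (z + \<epsilon>\<^sup>2)) * std_normal_density w \<partial>lborel)"
      unfolding U_def U_left_def by simp_all
  next
    fix m z :: real assume "z > 0"
    thus "U T m z = m\<^sup>2 + z" unfolding U_def by (rule U_hat_final)
  qed
qed

end
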